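(* Let $H$ be a complex Hilbert space and $K$ a finite-dimensional complex Hilbert space. If a group $G$ of h-biholomorphic automorphisms of $C(H,K)$ has at least one bounded orbit (with respect to the metric $d$), then it has a fixed point, i.e. there is $X\in C(H,K)$ with $g(X)=X$ for all $g\in G$.
   Context: $C(H,K)$ is the set of all closed densely-defined linear operators from $H$ to $K$. For $T,X\in C(H,K)$ put $L_T(X)=(I+T^*T)^{1/2}X^*-T^*(I+XX^* )^{1/2}$ and $R_T(X)=(I+XX^* )^{1/2}(I+TT^* )^{1/2}-XT^*$. The metric is $d(T,S)=\tanh^{-1}\|L_T(S)R_S(T)^{-1}\|$ (for $\dim K<\infty$ the inverse exists and $d$ is a metric on $C(H,K)$). $\mathcal{B}$ is the open unit ball of $L(K,H)$, the space of bounded linear operators from $K$ to $H$ with the operator norm. For $T\in C(H,K)$, $\hat T=\widehat{T}=(I+T^*T)^{-1/2}T^*\in\mathcal{B}$; the map $T\mapsto\hat T$ is a bijection from $C(H,K)$ onto $\mathcal{B}$ with inverse $A\mapsto(I-A^*A)^{-1/2}A^*$. A map $\varphi:C(H,K)\to C(H,K)$ is called h-biholomorphic if there exists a biholomorphic map $\psi:\mathcal{B}\to\mathcal{B}$ such that $\psi(\hat X)=\widehat{\varphi(X)}$ for all $X\in C(H,K)$. *)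

theory Defs
  imports "HOL-Analysis.Analysis" "HOL-Algebra.Bij"
begin

section \<open>Complex Hilbert spaces\<close>

text \<open>
  The real vector space structure (and hence the library's norm, topology and derivatives) is
  kept as a superclass; \<open>scaleC_of_real\<close> ties the two scalar multiplications together.
\<close>

class complex_vector = real_vector +
  fixes scaleC :: "complex \<Rightarrow> 'a \<Rightarrow> 'a" (infixr "*\<^sub>C" 75)
  assumes scaleC_add_right: "c *\<^sub>C (x + y) = c *\<^sub>C x + c *\<^sub>C y"
    and scaleC_add_left: "(b + c) *\<^sub>C x = b *\<^sub>C x + c *\<^sub>C x"
    and scaleC_scaleC: "b *\<^sub>C (c *\<^sub>C x) = (b * c) *\<^sub>C x"
    and scaleC_of_real: "complex_of_real r *\<^sub>C x = r *\<^sub>R x"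

class complex_normed_vector = complex_vector + real_normed_vector +
  assumes norm_scaleC: "norm (c *\<^sub>C x) = norm c * norm x"

class complex_hilbert = complex_normed_vector + banach +
  fixes cinner :: "'a \<Rightarrow> 'a \<Rightarrow> complex"
  assumes cinner_commute: "cinner x y = cnj (cinner y x)"
    and cinner_add_left: "cinner (x + y) z = cinner x z + cinner y z"
    and cinner_scaleC_left: "cinner (c *\<^sub>C x) y = c * cinner x y"
    and norm_eq_sqrt_cinner: "norm x = sqrt (Re (cinner x x))"

lemma scaleC_one: "1 *\<^sub>C (x :: 'a::complex_vector) = x"
  using scaleC_of_real[of 1 x] by simp

interpretation complex_vector: vector_space "scaleC :: complex \<Rightarrow> 'a \<Rightarrow> 'a::complex_vector"
  by unfold_locales (auto simp: scaleC_add_right scaleC_add_left scaleC_scaleC scaleC_one)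

definition finite_cdim :: "'a::complex_vector set \<Rightarrow> bool" where
  "finite_cdim V \<longleftrightarrow> (\<exists>B. finite B \<and> complex_vector.span B = V)"

instantiation complex :: complex_hilbert
begin
definition scaleC_complex :: "complex \<Rightarrow> complex \<Rightarrow> complex" where
  "scaleC_complex c x = c * x"
definition cinner_complex :: "complex \<Rightarrow> complex \<Rightarrow> complex" where
  "cinner_complex x y = x * cnj y"
instance
proof
  fix x y z b c :: complex and r :: real
  show "c *\<^sub>C (x + y) = c *\<^sub>C x + c *\<^sub>C y" by (simp add: scaleC_complex_def distrib_left)
  show "(b + c) *\<^sub>C x = b *\<^sub>C x + c *\<^sub>C x" by (simp add: scaleC_complex_def distrib_right)
  show "b *\<^sub>C c *\<^sub>C x = (b * c) *\<^sub>C x" by (simp add: scaleC_complex_def)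
  show "complex_of_real r *\<^sub>C x = r *\<^sub>R x" by (simp add: scaleC_complex_def scaleR_conv_of_real)
  show "norm (c *\<^sub>C x) = norm c * norm x" by (simp add: scaleC_complex_def norm_mult)
  show "cinner x y = cnj (cinner y x)" by (simp add: cinner_complex_def)
  show "cinner (x + y) z = cinner x z + cinner y z" by (simp add: cinner_complex_def distrib_right)
  show "cinner (c *\<^sub>C x) y = c * cinner x y" by (simp add: cinner_complex_def scaleC_complex_def)
  show "norm x = sqrt (Re (cinner x x))"
    by (simp add: cinner_complex_def cmod_def power2_eq_square)
qed
end

instantiation prod :: (complex_vector, complex_vector) complex_vector
begin
definition scaleC_prod :: "complex \<Rightarrow> 'a \<times> 'b \<Rightarrow> 'a \<times> 'b" where
  "scaleC_prod c p = (c *\<^sub>C fst p, c *\<^sub>C snd p)"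
instance
  by standard
    (auto simp: scaleC_prod_def scaleC_add_right scaleC_add_left scaleC_scaleC scaleC_of_real
      scaleR_prod_def)
end


section \<open>The normed space of bounded complex-linear operators\<close>

typedef (overloaded) ('a::complex_normed_vector, 'b::complex_normed_vector) cblinfun =
  "{f :: 'a \<Rightarrow>\<^sub>L 'b. \<forall>c x. blinfun_apply f (c *\<^sub>C x) = c *\<^sub>C blinfun_apply f x}"
  morphisms blinfun_of_cblinfun Abs_cblinfun
proof
  show "0 \<in> {f :: 'a \<Rightarrow>\<^sub>L 'b. \<forall>c x. blinfun_apply f (c *\<^sub>C x) = c *\<^sub>C blinfun_apply f x}"
    by simp
qed

setup_lifting type_definition_cblinfun

lemma scaleC_scaleR_commute: "c *\<^sub>C (r *\<^sub>R x) = r *\<^sub>R (c *\<^sub>C (x :: 'a::complex_vector))"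
  by (simp add: scaleC_of_real[symmetric] scaleC_scaleC mult.commute)

lemma bounded_linear_scaleC: "bounded_linear (scaleC c :: 'a \<Rightarrow> 'a::complex_normed_vector)"
  by (rule bounded_linear_intro[where K = "norm c"])
    (auto simp: scaleC_add_right scaleC_scaleR_commute norm_scaleC)

lift_definition blinfun_scaleC :: "complex \<Rightarrow> 'a::complex_normed_vector \<Rightarrow>\<^sub>L 'a" is
  "\<lambda>c. scaleC c" by (rule bounded_linear_scaleC)

instantiation cblinfun :: (complex_normed_vector, complex_normed_vector) complex_normed_vector
begin

lift_definition zero_cblinfun :: "('a, 'b) cblinfun" is 0 by simp
lift_definition plus_cblinfun :: "('a, 'b) cblinfun \<Rightarrow> ('a, 'b) cblinfun \<Rightarrow> ('a, 'b) cblinfun"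
  is "(+)" by (simp add: blinfun.add_left scaleC_add_right)
lift_definition minus_cblinfun :: "('a, 'b) cblinfun \<Rightarrow> ('a, 'b) cblinfun \<Rightarrow> ('a, 'b) cblinfun"
  is "(-)" by (simp add: blinfun.diff_left complex_vector.scale_right_diff_distrib)
lift_definition uminus_cblinfun :: "('a, 'b) cblinfun \<Rightarrow> ('a, 'b) cblinfun"
  is "uminus" by (simp add: blinfun.minus_left)
lift_definition scaleR_cblinfun :: "real \<Rightarrow> ('a, 'b) cblinfun \<Rightarrow> ('a, 'b) cblinfun"
  is "scaleR" by (simp add: blinfun.scaleR_left scaleC_scaleR_commute)
lift_definition scaleC_cblinfun :: "complex \<Rightarrow> ('a, 'b) cblinfun \<Rightarrow> ('a, 'b) cblinfun"
  is "\<lambda>c f. blinfun_scaleC c o\<^sub>L f" by (simp add: blinfun_scaleC.rep_eq scaleC_scaleC mult.commute)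
lift_definition norm_cblinfun :: "('a, 'b) cblinfun \<Rightarrow> real" is norm .

definition dist_cblinfun :: "('a, 'b) cblinfun \<Rightarrow> ('a, 'b) cblinfun \<Rightarrow> real" where
  "dist_cblinfun f g = norm (f - g)"
definition sgn_cblinfun :: "('a, 'b) cblinfun \<Rightarrow> ('a, 'b) cblinfun" where
  "sgn_cblinfun f = inverse (norm f) *\<^sub>R f"
definition uniformity_cblinfun :: "(('a, 'b) cblinfun \<times> ('a, 'b) cblinfun) filter" where
  "uniformity_cblinfun = (INF e\<in>{0<..}. principal {(f, g). dist f g < e})"
definition open_cblinfun :: "('a, 'b) cblinfun set \<Rightarrow> bool" where
  "open_cblinfun U \<longleftrightarrow> (\<forall>f\<in>U. eventually (\<lambda>(f', g). f' = f \<longrightarrow> g \<in> U) uniformity)"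

instance
proof
  fix f g h :: "('a, 'b) cblinfun" and a b :: real and c d :: complex
  show "f + g + h = f + (g + h)" by transfer (simp add: add.assoc)
  show "f + g = g + f" by transfer (simp add: add.commute)
  show "0 + f = f" by transfer simp
  show "- f + f = 0" by transfer simp
  show "f - g = f + - g" by transfer simp
  show "a *\<^sub>R (f + g) = a *\<^sub>R f + a *\<^sub>R g" by transfer (simp add: scaleR_add_right)
  show "(a + b) *\<^sub>R f = a *\<^sub>R f + b *\<^sub>R f" by transfer (simp add: scaleR_add_left)
  show "a *\<^sub>R b *\<^sub>R f = (a * b) *\<^sub>R f" by transfer simp
  show "1 *\<^sub>R f = f" by transfer simp
  show "c *\<^sub>C (f + g) = c *\<^sub>C f + c *\<^sub>C g"
    by transfer (auto intro!: blinfun_eqI simp: blinfun_scaleC.rep_eq blinfun.add_left scaleC_add_right)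
  show "(c + d) *\<^sub>C f = c *\<^sub>C f + d *\<^sub>C f"
    by transfer (auto intro!: blinfun_eqI simp: blinfun_scaleC.rep_eq blinfun.add_left scaleC_add_left)
  show "c *\<^sub>C d *\<^sub>C f = (c * d) *\<^sub>C f"
    by transfer (auto intro!: blinfun_eqI simp: blinfun_scaleC.rep_eq scaleC_scaleC)
  show "complex_of_real a *\<^sub>C f = a *\<^sub>R f"
    by transfer (auto intro!: blinfun_eqI simp: blinfun_scaleC.rep_eq scaleC_of_real blinfun.scaleR_left)
  show "dist f g = norm (f - g)" by (rule dist_cblinfun_def)
  show "sgn f = inverse (norm f) *\<^sub>R f" by (rule sgn_cblinfun_def)
  show "(uniformity :: (('a, 'b) cblinfun \<times> ('a, 'b) cblinfun) filter) =
      (INF e\<in>{0<..}. principal {(x, y). dist x y < e})" by (rule uniformity_cblinfun_def)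
  show "open U \<longleftrightarrow> (\<forall>x\<in>U. \<forall>\<^sub>F (x', y) in uniformity. x' = x \<longrightarrow> y \<in> U)"
    for U :: "('a, 'b) cblinfun set" by (rule open_cblinfun_def)
  show "norm f = 0 \<longleftrightarrow> f = 0" by transfer simp
  show "norm (f + g) \<le> norm f + norm g" by transfer (rule norm_triangle_ineq)
  show "norm (a *\<^sub>R f) = \<bar>a\<bar> * norm f" by transfer simp
  have le: "norm (c *\<^sub>C f) \<le> norm c * norm f" for c and f :: "('a, 'b) cblinfun"
  proof transfer
    fix c and f :: "'a \<Rightarrow>\<^sub>L 'b"
    show "norm (blinfun_scaleC c o\<^sub>L f) \<le> norm c * norm f"
      by (rule norm_blinfun_bound)
        (auto simp: blinfun_scaleC.rep_eq norm_scaleC mult.assoc intro!: mult_left_mono norm_blinfun)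
  qed
  show "norm (c *\<^sub>C f) = norm c * norm f"
  proof (cases "c = 0")
    case True
    then show ?thesis using le[of c f] by (simp add: \<open>norm f = 0 \<longleftrightarrow> f = 0\<close>) (transfer, simp)
  next
    case False
    have inv: "inverse c *\<^sub>C c *\<^sub>C f = f"
      using False
      by transfer (auto intro!: blinfun_eqI simp: blinfun_scaleC.rep_eq scaleC_scaleC scaleC_one)
    have "norm c * norm f \<le> norm c * (norm (inverse c) * norm (c *\<^sub>C f))"
      using le[of "inverse c" "c *\<^sub>C f"] unfolding inv by (rule mult_left_mono) simp
    also have "\<dots> = norm (c *\<^sub>C f)"
      using False by (simp add: norm_inverse)
    finally have "norm c * norm f \<le> norm (c *\<^sub>C f)" .
    with le[of c f] show ?thesis by simp
  qed
qed

end


section \<open>Unbounded operators as graphs\<close>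

text \<open>
  A possibly unbounded operator is identified with its graph.  The domain is \<open>Domain T\<close>, the
  identity is \<open>Id\<close>, the inverse is \<open>T\<inverse>\<close>.  Sums, differences and products have their natural
  (maximal) domains.
\<close>

abbreviation op_comp :: "('b \<times> 'c) set \<Rightarrow> ('a \<times> 'b) set \<Rightarrow> ('a \<times> 'c) set" (infixr "\<circ>\<^sub>o" 75) where
  "S \<circ>\<^sub>o T \<equiv> T O S"

definition op_add :: "('a \<times> 'b::plus) set \<Rightarrow> ('a \<times> 'b) set \<Rightarrow> ('a \<times> 'b) set" (infixl "+\<^sub>o" 65) where
  "S +\<^sub>o T = {(x, y + z) |x y z. (x, y) \<in> S \<and> (x, z) \<in> T}"

definition op_diff :: "('a \<times> 'b::minus) set \<Rightarrow> ('a \<times> 'b) set \<Rightarrow> ('a \<times> 'b) set" (infixl "-\<^sub>o" 65) where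
  "S -\<^sub>o T = {(x, y - z) |x y z. (x, y) \<in> S \<and> (x, z) \<in> T}"

text \<open>A single-valued relation (an operator) for densely defined \<open>T\<close>.\<close>

definition adj :: "('a::complex_hilbert \<times> 'b::complex_hilbert) set \<Rightarrow> ('b \<times> 'a) set" where
  "adj T = {(y, z). \<forall>(x, w)\<in>T. cinner w y = cinner x z}"

definition linear_operator :: "('a::complex_vector \<times> 'b::complex_vector) set \<Rightarrow> bool" where
  "linear_operator T \<longleftrightarrow> complex_vector.subspace T \<and> single_valued T"

definition densely_defined :: "('a::topological_space \<times> 'b) set \<Rightarrow> bool" where
  "densely_defined T \<longleftrightarrow> closure (Domain T) = UNIV"

definition positive_selfadjoint :: "('a::complex_hilbert \<times> 'a) set \<Rightarrow> bool" where
  "positive_selfadjoint P \<longleftrightarrow>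
     linear_operator P \<and> densely_defined P \<and> adj P = P \<and> (\<forall>(x, y)\<in>P. 0 \<le> Re (cinner y x))"

text \<open>The unique positive self-adjoint square root of a positive self-adjoint operator.\<close>

definition op_sqrt :: "('a::complex_hilbert \<times> 'a) set \<Rightarrow> ('a \<times> 'a) set" where
  "op_sqrt P = (THE R. positive_selfadjoint R \<and> R \<circ>\<^sub>o R = P)"

text \<open>
  The bounded, everywhere defined operator given by \<open>T\<close>; if \<open>T\<close> is bounded but only densely
  defined this is its unique continuous extension.
\<close>

definition bounded_operator ::
  "('a::complex_normed_vector \<times> 'b::complex_normed_vector) set \<Rightarrow> ('a, 'b) cblinfun" where
  "bounded_operator T = (THE A. \<forall>(x, y)\<in>T. blinfun_apply (blinfun_of_cblinfun A) x = y)"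


section \<open>The space \<open>C(H,K)\<close>\<close>

typedef (overloaded) ('h::complex_hilbert, 'k::complex_hilbert) closed_op =
  "{T :: ('h \<times> 'k) set. linear_operator T \<and> closed T \<and> densely_defined T}"
  morphisms graph Abs_closed_op
proof
  have "closed (UNIV \<times> {0} :: ('h \<times> 'k) set)"
    by (intro closed_Times) auto
  moreover have "complex_vector.subspace (UNIV \<times> {0} :: ('h \<times> 'k) set)"
    by (rule complex_vector.subspaceI) (auto simp: scaleC_prod_def zero_prod_def)
  moreover have "single_valued (UNIV \<times> {0} :: ('h \<times> 'k) set)"
    by (auto simp: single_valued_def)
  moreover have "Domain (UNIV \<times> {0} :: ('h \<times> 'k) set) = UNIV"
    by auto
  ultimately show "UNIV \<times> {0} \<in>
      {T :: ('h \<times> 'k) set. linear_operator T \<and> closed T \<and> densely_defined T}"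
    by (auto simp: linear_operator_def densely_defined_def)
qed

definition L_op :: "('h::complex_hilbert, 'k::complex_hilbert) closed_op \<Rightarrow>
    ('h, 'k) closed_op \<Rightarrow> ('k \<times> 'h) set" where
  "L_op T X = op_sqrt (Id +\<^sub>o adj (graph T) \<circ>\<^sub>o graph T) \<circ>\<^sub>o adj (graph X)
     -\<^sub>o adj (graph T) \<circ>\<^sub>o op_sqrt (Id +\<^sub>o graph X \<circ>\<^sub>o adj (graph X))"

definition R_op :: "('h::complex_hilbert, 'k::complex_hilbert) closed_op \<Rightarrow>
    ('h, 'k) closed_op \<Rightarrow> ('k \<times> 'k) set" where
  "R_op T X =
     op_sqrt (Id +\<^sub>o graph X \<circ>\<^sub>o adj (graph X)) \<circ>\<^sub>o op_sqrt (Id +\<^sub>o graph T \<circ>\<^sub>o adj (graph T))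
     -\<^sub>o graph X \<circ>\<^sub>o adj (graph T)"

definition hyp_dist :: "('h::complex_hilbert, 'k::complex_hilbert) closed_op \<Rightarrow>
    ('h, 'k) closed_op \<Rightarrow> real" where
  "hyp_dist T S = artanh (norm (bounded_operator (L_op T S \<circ>\<^sub>o (R_op S T)\<inverse>)))"

definition hyp_bounded :: "('h::complex_hilbert, 'k::complex_hilbert) closed_op set \<Rightarrow> bool" where
  "hyp_bounded S \<longleftrightarrow> (\<exists>X r. \<forall>Y\<in>S. hyp_dist X Y \<le> r)"

definition hat :: "('h::complex_hilbert, 'k::complex_hilbert) closed_op \<Rightarrow> ('k, 'h) cblinfun" where
  "hat T =
     bounded_operator ((op_sqrt (Id +\<^sub>o adj (graph T) \<circ>\<^sub>o graph T))\<inverse> \<circ>\<^sub>o adj (graph T))"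


section \<open>Holomorphic maps\<close>

text \<open>
  Frechet holomorphy on an open set: real differentiability with complex-linear derivative (the
  derivative \<open>D\<close> is already bounded and real-linear).
\<close>

definition cholomorphic_on ::
  "('a::complex_normed_vector \<Rightarrow> 'b::complex_normed_vector) \<Rightarrow> 'a set \<Rightarrow> bool" where
  "cholomorphic_on f U \<longleftrightarrow>
     (\<forall>x\<in>U. \<exists>D. (f has_derivative D) (at x) \<and> (\<forall>c v. D (c *\<^sub>C v) = c *\<^sub>C D v))"

definition biholomorphic_on ::
  "('a::complex_normed_vector \<Rightarrow> 'b::complex_normed_vector) \<Rightarrow> 'a set \<Rightarrow> 'b set \<Rightarrow> bool" where
  "biholomorphic_on f U V \<longleftrightarrow>
     bij_betw f U V \<and> cholomorphic_on f U \<and> cholomorphic_on (inv_into U f) V"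

definition h_biholomorphic ::
  "(('h::complex_hilbert, 'k::complex_hilbert) closed_op \<Rightarrow> ('h, 'k) closed_op) \<Rightarrow> bool" where
  "h_biholomorphic \<phi> \<longleftrightarrow>
     (\<exists>\<psi> :: ('k, 'h) cblinfun \<Rightarrow> ('k, 'h) cblinfun.
        biholomorphic_on \<psi> (ball 0 1) (ball 0 1) \<and> (\<forall>X. \<psi> (hat X) = hat (\<phi> X)))"

end

theory Submission
  imports Defs "HOL-Complex_Analysis.Conformal_Mappings"
begin

text \<open>Closed densely defined operators into a finite-dimensional space are bounded, and
  \<open>T \<mapsto> hat T\<close> identifies them with the open unit ball of \<open>L(K, H)\<close>.  Under this identification the
  relation \<open>d(T, S) \<le> r\<close> becomes
  \<open>s |\<langle>k, v\<rangle> - \<langle>x k, y v\<rangle>|\<^sup>2 \<le> (|k|\<^sup>2 - |x k|\<^sup>2) (|v|\<^sup>2 - |y v|\<^sup>2)\<close> for all \<open>k\<close>, \<open>v\<close>, where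
  \<open>s = 1 - tanh\<^sup>2 r\<close>.  It is preserved by Moebius maps, hence by the Schwarz lemma also by
  biholomorphic maps, and it is convex in \<open>x\<close>.  By Zorn's lemma there is a minimal invariant
  intersection of hyperbolic balls.  Since \<open>K\<close> is finite-dimensional, hyperbolic balls have normal
  structure: a convex set with more than one point contains a non-diametral point.  So the
  minimal set is a single point.\<close>

section \<open>Hilbert space preliminaries\<close>

text \<open>The obstacle is that \<open>H\<close> may be infinite-dimensional, so hyperbolic balls
  need not be compact. Compactness is taken only from the unit sphere of \<open>K\<close>; nested
  intersections are handled by a parallelogram argument, as in a Hilbert space. The relation is
  shaped for this: testing on vectors \<open>k\<close>, \<open>v\<close> removes all inverses and
  square roots, so convexity reduces to the variance identity and closedness to pointwise limits.
  The parameter \<open>s\<close> equals \<open>1 / cosh\<^sup>2 r\<close>, so \<open>s = 1\<close>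
  is distance 0. Zorn's lemma is applied to invariant families of balls, ordered by inclusion. A
  maximal family already contains the balls of one suitable smaller radius about all points of its
  intersection, and this is what turns one non-diametral point into a smaller diameter. Square roots
  are taken only of operators bounded below: existence comes from a contraction, and uniqueness as
  well as the intertwining relations come from one Sylvester equation.\<close>

lemma form_Cauchy_Schwarz:
  fixes B :: "'a::complex_vector \<Rightarrow> 'a \<Rightarrow> complex"
  assumes add: "\<And>x y z. B (x + y) z = B x z + B y z"
    and scale: "\<And>c x y. B (c *\<^sub>C x) y = c * B x y"
    and herm: "\<And>x y. B x y = cnj (B y x)"
    and pos: "\<And>x. 0 \<le> Re (B x x)"
  shows "(cmod (B x y))\<^sup>2 \<le> Re (B x x) * Re (B y y)"
proof -
  define n where "n = (cmod (B x y))\<^sup>2"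
  have n: "B x y * B y x = of_real n"
    unfolding n_def herm[of y x] by (rule complex_norm_square[symmetric])
  have scale2: "B x (c *\<^sub>C y) = cnj c * B x y" for c x y
    using herm[of x "c *\<^sub>C y"] herm[of x y] by (simp add: scale)
  have add2: "B x (y + z) = B x y + B x z" for x y z
    using herm[of x "y + z"] herm[of x y] herm[of x z] by (simp add: add)
  have quad: "0 \<le> Re (B x x) - 2 * t * n + t\<^sup>2 * n * Re (B y y)" for t :: real
  proof -
    define l where "l = of_real (- t) * B x y"
    have "B (x + l *\<^sub>C y) (x + l *\<^sub>C y)
        = B x x + cnj l * B x y + l * B y x + l * cnj l * B y y"
      by (simp add: add add2 scale scale2 algebra_simps)
    also have "\<dots> = B x x - of_real (2 * t) * (B x y * B y x) + of_real (t\<^sup>2) * (B x y * B y x) * B y y"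
      using herm[of y x] by (simp add: l_def algebra_simps power2_eq_square)
    also have "\<dots> = B x x - of_real (2 * t * n) + of_real (t\<^sup>2 * n) * B y y"
      unfolding n by simp
    finally show ?thesis using pos[of "x + l *\<^sub>C y"] by simp
  qed
  have n0: "n \<ge> 0" by (simp add: n_def)
  \<comment> \<open>The degenerate case matters because the lemma serves not only
    \<open>cinner\<close> but also \<open>hform x x\<close>, which may vanish on vectors whose norm
    a contraction \<open>x\<close> preserves. In that case the quadratic is linear in
    \<open>t\<close>, and the chosen \<open>t\<close> gives it the value -1.\<close>
  show ?thesis
  proof (cases "Re (B y y) = 0")
    case True
    have "n = 0"
    proof (rule ccontr)
      assume "n \<noteq> 0"
      then show False using quad[of "(Re (B x x) + 1) / (2 * n)"] True by (simp add: field_simps)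
    qed
    then show ?thesis using True n_def by simp
  next
    case False
    then have b: "Re (B y y) > 0" using pos[of y] by simp
    then show ?thesis
      using quad[of "1 / Re (B y y)"] unfolding n_def[symmetric]
      by (simp add: field_simps power2_eq_square)
  qed
qed

context
  fixes x y z :: "'a::complex_hilbert"
begin

lemma cinner_add_right: "cinner x (y + z) = cinner x y + cinner x z"
  using cinner_commute[of x "y + z"] cinner_commute[of x y] cinner_commute[of x z]
  by (simp add: cinner_add_left)

lemma cinner_scaleC_right: "cinner x (c *\<^sub>C y) = cnj c * cinner x y"
  using cinner_commute[of x "c *\<^sub>C y"] cinner_commute[of x y] by (simp add: cinner_scaleC_left)

lemma cinner_scaleR_left: "cinner (r *\<^sub>R x) y = of_real r * cinner x y"
  using cinner_scaleC_left[of "of_real r" x y] by (simp add: scaleC_of_real)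

lemma cinner_scaleR_right: "cinner x (r *\<^sub>R y) = of_real r * cinner x y"
  using cinner_scaleC_right[of "of_real r"] by (simp add: scaleC_of_real)

lemma cinner_zero_left [simp]: "cinner 0 x = 0"
  using cinner_add_left[of 0 0 x] by simp

lemma cinner_zero_right [simp]: "cinner x 0 = 0"
  using cinner_commute[of x 0] by (simp add: cinner_add_left[of 0 0 x, simplified])

end

lemma cinner_minus_left: "cinner (- x) y = - cinner (x::'a::complex_hilbert) y"
  using cinner_add_left[of x "- x" y] by (simp add: eq_neg_iff_add_eq_0 add.commute)

lemma cinner_minus_right: "cinner x (- y) = - cinner (x::'a::complex_hilbert) y"
  using cinner_add_right[of x y "- y"] by (simp add: eq_neg_iff_add_eq_0 add.commute)

lemma cinner_diff_left: "cinner (x - y) z = cinner x z - cinner (y::'a::complex_hilbert) z"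
  using cinner_add_left[of x "- y" z] by (simp add: cinner_minus_left)

lemma cinner_diff_right: "cinner x (y - z) = cinner x y - cinner (x::'a::complex_hilbert) z"
  using cinner_add_right[of x y "- z"] by (simp add: cinner_minus_right)

lemmas cinner_simps = cinner_add_left cinner_add_right cinner_diff_left cinner_diff_right
  cinner_minus_left cinner_minus_right cinner_scaleC_left cinner_scaleC_right
  cinner_scaleR_left cinner_scaleR_right

lemma Re_cinner_self: "Re (cinner x x) = (norm (x::'a::complex_hilbert))\<^sup>2"
proof -
  have "0 \<le> norm x" by simp
  then have "0 \<le> Re (cinner x x)" unfolding norm_eq_sqrt_cinner by (simp only: real_sqrt_ge_0_iff)
  then show ?thesis unfolding norm_eq_sqrt_cinner by simp
qed

lemma cinner_self: "cinner x x = of_real ((norm (x::'a::complex_hilbert))\<^sup>2)"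
proof -
  have "Im (cinner x x) = 0"
    using arg_cong[OF cinner_commute[of x x], of Im] by simp
  then show ?thesis by (simp add: complex_eq_iff Re_cinner_self)
qed

lemma Re_cinner_commute: "Re (cinner x y) = Re (cinner (y::'a::complex_hilbert) x)"
  by (subst cinner_commute) simp

lemma cinner_Cauchy_Schwarz: "cmod (cinner x y) \<le> norm (x::'a::complex_hilbert) * norm y"
proof -
  have "(cmod (cinner x y))\<^sup>2 \<le> (norm x * norm y)\<^sup>2"
    using form_Cauchy_Schwarz[OF cinner_add_left cinner_scaleC_left cinner_commute, of x y]
    by (simp add: Re_cinner_self power_mult_distrib)
  then show ?thesis by (rule power2_le_imp_le) simp
qed

lemma norm_add_sq: "(norm (x + y))\<^sup>2 = (norm x)\<^sup>2 + 2 * Re (cinner x y) + (norm (y::'a::complex_hilbert))\<^sup>2"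
  using Re_cinner_commute[of y x] by (simp add: Re_cinner_self[symmetric] cinner_simps)

lemma norm_diff_sq: "(norm (x - y))\<^sup>2 = (norm x)\<^sup>2 - 2 * Re (cinner x y) + (norm (y::'a::complex_hilbert))\<^sup>2"
  using Re_cinner_commute[of y x] by (simp add: Re_cinner_self[symmetric] cinner_simps)

text \<open>The parallelogram law, solved for the midpoint: if the midpoint is not much shorter than
  two vectors, they lie close together. The minimising sequences in
  \<open>Riesz_representation\<close> and \<open>chain_Inter_nonempty\<close> rest on it.\<close>

lemma norm_midpoint_sq:
  "(norm ((1/2) *\<^sub>R (x + y)))\<^sup>2 = ((norm x)\<^sup>2 + (norm y)\<^sup>2) / 2 - (norm (x - (y::'a::complex_hilbert)))\<^sup>2 / 4"
  by (simp only: norm_scaleR power_mult_distrib norm_add_sq norm_diff_sq) (simp add: field_simps)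

lemma bounded_bilinear_cinner:
  "bounded_bilinear (cinner :: 'a::complex_hilbert \<Rightarrow> 'a \<Rightarrow> complex)"
  by (rule bounded_bilinear.intro)
    (auto simp: cinner_simps scaleR_conv_of_real intro!: exI[of _ 1] cinner_Cauchy_Schwarz)

lemmas tendsto_cinner = bounded_bilinear.tendsto[OF bounded_bilinear_cinner]
lemmas bounded_linear_cinner_left = bounded_bilinear.bounded_linear_left[OF bounded_bilinear_cinner]

lemma cinner_ext: "(\<And>z. cinner x z = cinner y z) \<Longrightarrow> x = (y::'a::complex_hilbert)"
proof -
  assume "\<And>z. cinner x z = cinner y z"
  then have "cinner (x - y) (x - y) = 0" by (simp add: cinner_diff_left)
  then show ?thesis by (simp add: cinner_self)
qed

lemma cinner_ext_right: "(\<And>z. cinner z x = cinner z y) \<Longrightarrow> x = (y::'a::complex_hilbert)"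
  by (rule cinner_ext) (metis cinner_commute)

lemma norm_le_if_cinner_le:
  assumes "\<And>h. norm h \<le> 1 \<Longrightarrow> cmod (cinner x h) \<le> c"
  shows "norm (x::'a::complex_hilbert) \<le> c"
proof (cases "x = 0")
  case True then show ?thesis using assms[of 0] by simp
next
  case False
  then have "cmod (cinner x ((1 / norm x) *\<^sub>R x)) = norm x"
    by (simp add: cinner_simps cinner_self power2_eq_square norm_mult)
  then show ?thesis using assms[of "(1 / norm x) *\<^sub>R x"] False by simp
qed


subsection \<open>Bounded complex-linear maps and adjoints\<close>

text \<open>A predicate on plain functions, since the same maps also occur as graphs, square roots
  and inverses; the type \<open>cblinfun\<close> serves for points of the ball.\<close>

definition bounded_clinear :: "('a::complex_normed_vector \<Rightarrow> 'b::complex_normed_vector) \<Rightarrow> bool" where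
  "bounded_clinear f \<longleftrightarrow> bounded_linear f \<and> (\<forall>c x. f (c *\<^sub>C x) = c *\<^sub>C f x)"

text \<open>A relation instead of an adjoint operation: self-adjointness becomes
  \<open>adjoint_pair f f\<close>, and existence is a separate matter, settled in
  \<open>adjoint_exists\<close>.\<close>

definition adjoint_pair :: "('a::complex_hilbert \<Rightarrow> 'b::complex_hilbert) \<Rightarrow> ('b \<Rightarrow> 'a) \<Rightarrow> bool" where
  "adjoint_pair f g \<longleftrightarrow> (\<forall>x y. cinner (f x) y = cinner x (g y))"

lemma bounded_clinearI:
  assumes "\<And>x y. f (x + y) = f x + f y" "\<And>c x. f (c *\<^sub>C x) = c *\<^sub>C f x"
    "\<And>x. norm (f x) \<le> norm x * B"
  shows "bounded_clinear f"
  unfolding bounded_clinear_def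
  using assms by (auto intro!: bounded_linear_intro[of f B] simp: scaleC_of_real[symmetric])

lemma
  assumes "bounded_clinear f"
  shows bounded_clinear_add: "f (x + y) = f x + f y"
    and bounded_clinear_diff: "f (x - y) = f x - f y"
    and bounded_clinear_minus: "f (- x) = - f x"
    and bounded_clinear_zero: "f 0 = 0"
    and bounded_clinear_scaleR: "f (r *\<^sub>R x) = r *\<^sub>R f x"
    and bounded_clinear_scaleC: "f (c *\<^sub>C x) = c *\<^sub>C f x"
    and bounded_clinear_imp_bounded_linear: "bounded_linear f"
proof -
  from assms have b: "bounded_linear f" and c: "\<forall>c x. f (c *\<^sub>C x) = c *\<^sub>C f x"
    by (auto simp: bounded_clinear_def)
  note l = bounded_linear.linear[OF b]
  show "f (x + y) = f x + f y" "f (x - y) = f x - f y" "f (- x) = - f x" "f 0 = 0"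
    "f (r *\<^sub>R x) = r *\<^sub>R f x" "f (c *\<^sub>C x) = c *\<^sub>C f x"
    "bounded_linear f"
    using linear_add[OF l] linear_diff[OF l] linear_neg[OF l] linear_0[OF l] linear_scale[OF l]
      b c by auto
qed

lemmas bounded_clinear_simps = bounded_clinear_add bounded_clinear_diff bounded_clinear_minus
  bounded_clinear_zero bounded_clinear_scaleR bounded_clinear_scaleC

lemma bounded_clinear_bound:
  assumes "bounded_clinear f"
  obtains B where "B > 0" "\<And>x. norm (f x) \<le> B * norm x"
  using bounded_linear.pos_bounded[OF bounded_clinear_imp_bounded_linear[OF assms]]
  by (metis mult.commute)

lemma bounded_clinear_id: "bounded_clinear (\<lambda>x. x)"
  by (simp add: bounded_clinear_def bounded_linear_ident)

lemma bounded_clinear_compose: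
  "bounded_clinear f \<Longrightarrow> bounded_clinear g \<Longrightarrow> bounded_clinear (\<lambda>x. f (g x))"
  by (simp add: bounded_clinear_def bounded_linear_compose)

lemma bounded_clinear_plus:
  "bounded_clinear f \<Longrightarrow> bounded_clinear g \<Longrightarrow> bounded_clinear (\<lambda>x. f x + g x)"
  by (simp add: bounded_clinear_def bounded_linear_add scaleC_add_right)

lemma bounded_clinear_sub:
  "bounded_clinear f \<Longrightarrow> bounded_clinear g \<Longrightarrow> bounded_clinear (\<lambda>x. f x - g x)"
  by (simp add: bounded_clinear_def bounded_linear_sub complex_vector.scale_right_diff_distrib)

lemma bounded_clinear_uminus: "bounded_clinear f \<Longrightarrow> bounded_clinear (\<lambda>x. - f x)"
  by (simp add: bounded_clinear_def bounded_linear_minus)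

lemma adjoint_pairD: "adjoint_pair f g \<Longrightarrow> cinner (f x) y = cinner x (g y)"
  by (simp add: adjoint_pair_def)

lemma adjoint_pairD': "adjoint_pair f g \<Longrightarrow> cinner (g x) y = cinner x (f y)"
  by (metis adjoint_pair_def cinner_commute)

lemma adjoint_pair_sym: "adjoint_pair f g \<Longrightarrow> adjoint_pair g f"
  unfolding adjoint_pair_def by (metis cinner_commute)

lemma adjoint_pair_bounded_clinear:
  assumes "bounded_clinear f" "adjoint_pair f g"
  shows "bounded_clinear g"
proof -
  obtain B where B: "B > 0" "\<And>x. norm (f x) \<le> B * norm x"
    using bounded_clinear_bound[OF assms(1)] by blast
  note a = adjoint_pairD[OF assms(2), symmetric]
  show ?thesis
  proof (rule bounded_clinearI[where B = B])
    show "g (x + y) = g x + g y" for x y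
      by (rule cinner_ext_right) (simp add: a cinner_simps)
    show "g (c *\<^sub>C x) = c *\<^sub>C g x" for c x
      by (rule cinner_ext_right) (simp add: a cinner_simps)
    show "norm (g x) \<le> norm x * B" for x
    proof (rule norm_le_if_cinner_le)
      fix h :: 'a assume h: "norm h \<le> 1"
      have "cmod (cinner (g x) h) = cmod (cinner x (f h))"
        by (simp add: adjoint_pairD'[OF assms(2)])
      also have "\<dots> \<le> norm x * (B * 1)"
        using cinner_Cauchy_Schwarz[of x "f h"] B(2)[of h] h B(1)
        by (meson mult_left_mono norm_ge_zero order_trans order_less_imp_le)
      finally show "cmod (cinner (g x) h) \<le> norm x * B" by simp
    qed
  qed
qed

text \<open>For the representing vector \<open>z\<close>, completing the square gives
  \<open>J x = (norm (x - z))\<^sup>2 - (norm z)\<^sup>2\<close>. So \<open>z\<close> is found as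
  the minimiser of \<open>J\<close>.\<close>

lemma Riesz_representation:
  fixes f :: "'a::complex_hilbert \<Rightarrow> complex"
  assumes "bounded_clinear f"
  obtains z where "\<And>x. f x = cinner x z"
proof -
  note fl = bounded_clinear_simps[OF assms]
  obtain B where B: "B > 0" "\<And>x. norm (f x) \<le> B * norm x"
    using bounded_clinear_bound[OF assms] by blast
  define J where "J = (\<lambda>x. (norm x)\<^sup>2 - 2 * Re (f x))"
  have Jlow: "J x \<ge> - B\<^sup>2" for x
  proof -
    have "Re (f x) \<le> B * norm x" using B(2)[of x] complex_Re_le_cmod[of "f x"] by linarith
    moreover have "0 \<le> (norm x - B)\<^sup>2" by simp
    ultimately show ?thesis unfolding J_def by (simp add: power2_diff algebra_simps)
  qed
  have bdd: "bdd_below (range J)" using Jlow by (auto intro!: bdd_belowI[of _ "- B\<^sup>2"])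
  define m where "m = Inf (range J)"
  have mle: "m \<le> J x" for x unfolding m_def by (rule cInf_lower[OF _ bdd]) simp
  have "\<exists>x. J x < m + inverse (real (Suc n))" for n
    using cInf_lessD[of "range J" "m + inverse (real (Suc n))"] unfolding m_def[symmetric] by auto
  then obtain x where x: "\<And>n. J (x n) < m + inverse (real (Suc n))" by metis
  \<comment> \<open>The value of \<open>J\<close> at the midpoint is at least \<open>m\<close>,
    which bounds the distance between two near-minimisers.\<close>
  have near: "(norm (x i - x j))\<^sup>2 \<le> 2 * inverse (real (Suc i)) + 2 * inverse (real (Suc j))" for i j
  proof -
    have "m \<le> J ((1/2) *\<^sub>R (x i + x j))" by (rule mle)
    also have "\<dots> = (J (x i) + J (x j)) / 2 - (norm (x i - x j))\<^sup>2 / 4"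
      unfolding J_def norm_midpoint_sq by (simp add: fl field_simps)
    finally have le: "m \<le> (J (x i) + J (x j)) / 2 - (norm (x i - x j))\<^sup>2 / 4" .
    have "n \<le> 2 * a + 2 * b"
      if "m \<le> (p + q) / 2 - n / 4" "p < m + a" "q < m + b" for p q n a b :: real
      using that by (simp add: field_simps)
    from this[OF le x x] show ?thesis .
  qed
  have "Cauchy x"
  proof (rule metric_CauchyI)
    fix e :: real assume e: "e > 0"
    then obtain N where N: "inverse (real (Suc N)) < e\<^sup>2 / 4"
      using reals_Archimedean[of "e\<^sup>2 / 4"] by auto
    have "dist (x i) (x j) < e" if "i \<ge> N" "j \<ge> N" for i j
    proof -
      have "inverse (real (Suc i)) \<le> inverse (real (Suc N))"
        "inverse (real (Suc j)) \<le> inverse (real (Suc N))" using that by auto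
      then have "(norm (x i - x j))\<^sup>2 < e\<^sup>2" using near[of i j] N by linarith
      then show ?thesis using e by (simp add: dist_norm power2_less_imp_less)
    qed
    then show "\<exists>M. \<forall>i\<ge>M. \<forall>j\<ge>M. dist (x i) (x j) < e" by blast
  qed
  then obtain z where z: "x \<longlonglongrightarrow> z" using Cauchy_convergent convergent_def by blast
  have "(\<lambda>n. J (x n)) \<longlonglongrightarrow> J z"
    unfolding J_def
    by (intro tendsto_intros z bounded_linear.tendsto[OF bounded_clinear_imp_bounded_linear[OF assms]])
  moreover have "(\<lambda>n. m + inverse (real (Suc n))) \<longlonglongrightarrow> m + 0"
    by (intro tendsto_intros LIMSEQ_inverse_real_of_nat)
  ultimately have Jz: "J z \<le> m + 0"
    by (rule LIMSEQ_le) (use x less_imp_le in blast)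
  have Re_eq: "Re (f y) = Re (cinner y z)" for y
  proof -
    define a where "a = Re (cinner y z) - Re (f y)"
    have q: "0 \<le> t\<^sup>2 * (norm y)\<^sup>2 + 2 * t * a" for t :: real
    proof -
      have "J z \<le> J (z + t *\<^sub>R y)" using mle[of "z + t *\<^sub>R y"] Jz by simp
      then show ?thesis unfolding J_def norm_add_sq a_def
        using Re_cinner_commute[of y z]
        by (simp add: fl cinner_simps power_mult_distrib algebra_simps)
    qed
    have "a = 0"
    proof (rule ccontr)
      assume a: "a \<noteq> 0"
      \<comment> \<open>The added 1 keeps the step \<open>- a / u\<close> meaningful for
        \<open>y = 0\<close>.\<close>
      define u where "u = (norm y)\<^sup>2 + 1"
      have u: "u > 0" unfolding u_def by (simp add: add_nonneg_pos)
      have "0 \<le> (- a / u)\<^sup>2 * (norm y)\<^sup>2 + 2 * (- a / u) * a" by (rule q)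
      also have "\<dots> = (a\<^sup>2 / u) * ((norm y)\<^sup>2 / u - 2)"
        using u by (simp add: field_simps power2_eq_square)
      also have "\<dots> < 0"
        using a u by (intro mult_pos_neg) (auto simp: u_def field_simps add_pos_nonneg)
      finally show False by simp
    qed
    then show ?thesis by (simp add: a_def)
  qed
  have "f y = cinner y z" for y
  proof (rule complex_eqI)
    show "Re (f y) = Re (cinner y z)" by (rule Re_eq)
    show "Im (f y) = Im (cinner y z)"
      using Re_eq[of "\<i> *\<^sub>C y"] by (simp add: fl cinner_simps scaleC_complex_def)
  qed
  then show thesis by (rule that)
qed

lemma adjoint_exists:
  fixes f :: "'a::complex_hilbert \<Rightarrow> 'b::complex_hilbert"
  assumes "bounded_clinear f"
  obtains g where "adjoint_pair f g" "bounded_clinear g"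
proof -
  note fl = bounded_clinear_simps[OF assms]
  obtain B where B: "B > 0" "\<And>x. norm (f x) \<le> B * norm x"
    using bounded_clinear_bound[OF assms] by blast
  have "\<exists>z. \<forall>x. cinner (f x) y = cinner x z" for y
  proof -
    have "bounded_clinear (\<lambda>x. cinner (f x) y)"
    proof (rule bounded_clinearI)
      show "norm (cinner (f x) y) \<le> norm x * (B * norm y)" for x
        using cinner_Cauchy_Schwarz[of "f x" y] mult_right_mono[OF B(2)[of x], of "norm y"]
        by (simp add: mult_ac)
    qed (auto simp: fl cinner_simps scaleC_complex_def)
    then show ?thesis by (metis Riesz_representation)
  qed
  then obtain g where g: "\<And>y x. cinner (f x) y = cinner x (g y)" by metis
  then have "adjoint_pair f g" by (simp add: adjoint_pair_def)
  then show thesis using adjoint_pair_bounded_clinear[OF assms] that by blast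
qed


section \<open>Square roots of coercive operators\<close>

text \<open>The lower bound is uniform, not just positivity: it supplies the contraction behind the
  square root and the expansion in the Sylvester argument.\<close>

definition coercive :: "('a::complex_hilbert \<Rightarrow> 'a) \<Rightarrow> bool" where
  "coercive f \<longleftrightarrow> bounded_clinear f \<and> adjoint_pair f f \<and> (\<exists>c>0. \<forall>x. c * (norm x)\<^sup>2 \<le> Re (cinner (f x) x))"

text \<open>For \<open>D\<close> coercive and \<open>C\<close> positive, \<open>D X = - X C\<close> gives \<open>(s + D) X = X (s - C)\<close> for every
  \<open>s\<close>; for large \<open>s\<close> the left factor expands more than the right one.\<close>

lemma Sylvester_zero:
  fixes d :: "'b::complex_hilbert \<Rightarrow> 'b" and c :: "'a::complex_hilbert \<Rightarrow> 'a"
  assumes d: "bounded_clinear d" "e > 0" "\<And>x. e * (norm x)\<^sup>2 \<le> Re (cinner (d x) x)"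
    and c: "bounded_clinear c" "\<And>x. 0 \<le> Re (cinner (c x) x)"
    and X: "bounded_clinear X" "\<And>x. d (X x) + X (c x) = 0"
  shows "X x = 0"
proof -
  obtain C where C: "C > 0" "\<And>x. norm (c x) \<le> C * norm x"
    using bounded_clinear_bound[OF c(1)] by blast
  \<comment> \<open>This \<open>s\<close> satisfies \<open>2 s e = 2 C\<^sup>2\<close>: the factor
    \<open>s + d\<close> expands squared norms at least by \<open>s\<^sup>2 + 2 C\<^sup>2\<close>,
    while \<open>s - c\<close> expands them at most by \<open>s\<^sup>2 + C\<^sup>2\<close>.\<close>
  define s where "s = C\<^sup>2 / e"
  have s: "s > 0" using C d(2) by (simp add: s_def)
  have up: "(norm (s *\<^sub>R x - c x))\<^sup>2 \<le> (s\<^sup>2 + C\<^sup>2) * (norm x)\<^sup>2" for x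
  proof -
    have "0 \<le> s * Re (cinner x (c x))" using c(2)[of x] s by (simp add: Re_cinner_commute[of x "c x"])
    moreover have "(norm (c x))\<^sup>2 \<le> C\<^sup>2 * (norm x)\<^sup>2"
      using power_mono[OF C(2)[of x], of 2] by (simp add: power_mult_distrib)
    ultimately show ?thesis
      unfolding norm_diff_sq by (simp add: cinner_simps power_mult_distrib algebra_simps)
  qed
  have low: "(s\<^sup>2 + 2 * C\<^sup>2) * (norm y)\<^sup>2 \<le> (norm (s *\<^sub>R y + d y))\<^sup>2" for y
  proof -
    have "2 * C\<^sup>2 * (norm y)\<^sup>2 = 2 * s * (e * (norm y)\<^sup>2)" using d(2) by (simp add: s_def)
    also have "\<dots> \<le> 2 * s * Re (cinner y (d y))"
      using d(3)[of y] s by (simp add: Re_cinner_commute[of y "d y"])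
    finally have "s\<^sup>2 * (norm y)\<^sup>2 + 2 * C\<^sup>2 * (norm y)\<^sup>2
        \<le> s\<^sup>2 * (norm y)\<^sup>2 + 2 * s * Re (cinner y (d y)) + (norm (d y))\<^sup>2"
      using zero_le_power2[of "norm (d y)"] by linarith
    then show ?thesis
      unfolding norm_add_sq by (simp add: cinner_simps power_mult_distrib algebra_simps)
  qed
  define k where "k = (s\<^sup>2 + C\<^sup>2) / (s\<^sup>2 + 2 * C\<^sup>2)"
  have k: "0 \<le> k" "k < 1" using C s by (auto simp: k_def field_simps add_pos_pos)
  obtain B where B: "B > 0" "\<And>x. norm (X x) \<le> B * norm x"
    using bounded_clinear_bound[OF X(1)] by blast
  \<comment> \<open>The squared operator norm of \<open>X\<close>. At \<open>x = 0\<close> the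
    quotient is \<open>0 / 0 = 0\<close>, so the supremum may run over all \<open>x\<close> and is
    nonnegative.\<close>
  define N where "N = (SUP x. (norm (X x))\<^sup>2 / (norm x)\<^sup>2)"
  have "bdd_above (range (\<lambda>x. (norm (X x))\<^sup>2 / (norm x)\<^sup>2))"
  proof (rule bdd_aboveI2)
    show "(norm (X x))\<^sup>2 / (norm x)\<^sup>2 \<le> B\<^sup>2" for x
      using power_mono[OF B(2)[of x], of 2]
      by (cases "x = 0") (auto simp: power_mult_distrib divide_simps)
  qed
  then have upN: "(norm (X x))\<^sup>2 / (norm x)\<^sup>2 \<le> N" for x unfolding N_def by (intro cSUP_upper) auto
  have N: "(norm (X x))\<^sup>2 \<le> N * (norm x)\<^sup>2" for x
    using upN[of x] by (cases "x = 0") (auto simp: divide_simps bounded_clinear_simps[OF X(1)])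
  have N0: "N \<ge> 0" using upN[of 0] by simp
  have step: "(norm (X x))\<^sup>2 / (norm x)\<^sup>2 \<le> k * N" for x
  proof (cases "x = 0")
    case True then show ?thesis using k N0 by simp
  next
    case False
    have "(s\<^sup>2 + 2 * C\<^sup>2) * (norm (X x))\<^sup>2 \<le> (norm (s *\<^sub>R X x + d (X x)))\<^sup>2" by (rule low)
    also have "s *\<^sub>R X x + d (X x) = X (s *\<^sub>R x - c x)"
      using X(2)[of x] by (simp add: bounded_clinear_simps[OF X(1)] eq_neg_iff_add_eq_0)
    also have "(norm (X (s *\<^sub>R x - c x)))\<^sup>2 \<le> N * (norm (s *\<^sub>R x - c x))\<^sup>2" by (rule N)
    also have "\<dots> \<le> N * ((s\<^sup>2 + C\<^sup>2) * (norm x)\<^sup>2)" using up N0 by (rule mult_left_mono)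
    finally show ?thesis
      using False s C by (simp add: k_def divide_simps mult_ac add_pos_pos zero_less_mult_iff)
  qed
  have "N \<le> k * N" unfolding N_def by (rule cSUP_least) (use step N_def in auto)
  then have "N * (1 - k) \<le> 0" by (simp add: algebra_simps)
  then have "N = 0" using k(2) N0 by (simp add: mult_le_0_iff)
  then show ?thesis using N[of x] by simp
qed

text \<open>With \<open>X = 1 - P / \<mu>\<close> a strict contraction, \<open>\<surd>P = \<surd>\<mu> (1 - Y)\<close> where
  \<open>Y = (X + Y\<^sup>2) / 2\<close>.\<close>

lemma coercive_sqrt_exists:
  fixes p :: "'a::complex_hilbert \<Rightarrow> 'a"
  assumes "coercive p"
  obtains d where "coercive d" "\<And>x. d (d x) = p x"
proof -
  from assms obtain c where p: "bounded_clinear p" "adjoint_pair p p" and c: "c > 0"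
    "\<And>x. c * (norm x)\<^sup>2 \<le> Re (cinner (p x) x)" unfolding coercive_def by blast
  obtain B0 where B0: "B0 > 0" "\<And>x. norm (p x) \<le> B0 * norm x"
    using bounded_clinear_bound[OF p(1)] by blast
  \<comment> \<open>The maximum with \<open>c\<close> makes \<open>1 - c\<^sup>2 / B\<^sup>2\<close>
    nonnegative even on the zero space.\<close>
  define B where "B = max B0 c"
  have B: "B > 0" "B \<ge> c" "\<And>x. norm (p x) \<le> B * norm x"
    using B0 c(1) mult_right_mono[of B0 B] unfolding B_def
    by (auto intro: order_trans[OF B0(2)] mult_right_mono)
  \<comment> \<open>\<open>1 / \<mu> = c / B\<^sup>2\<close> minimises the bound
    \<open>1 - 2 c / \<mu> + B\<^sup>2 / \<mu>\<^sup>2\<close> for the squared norm of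
    \<open>1 - p / \<mu>\<close>; the minimum is \<open>q\<^sup>2\<close> below.\<close>
  define \<mu> where "\<mu> = B\<^sup>2 / c"
  have \<mu>: "\<mu> > 0" using B c by (simp add: \<mu>_def)
  define q where "q = sqrt (1 - c\<^sup>2 / B\<^sup>2)"
  have cB: "c\<^sup>2 / B\<^sup>2 \<le> 1" "c\<^sup>2 / B\<^sup>2 > 0" using B c(1) by (auto simp: power_mono)
  have q: "0 \<le> q" "q < 1" "q\<^sup>2 = 1 - c\<^sup>2 / B\<^sup>2" using cB by (auto simp: q_def)
  define X where "X = Blinfun (\<lambda>x. x - (1 / \<mu>) *\<^sub>R p x)"
  have X: "blinfun_apply X x = x - (1 / \<mu>) *\<^sub>R p x" for x
    unfolding X_def
    by (subst bounded_linear_Blinfun_apply)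
      (auto intro!: bounded_linear_intros bounded_clinear_imp_bounded_linear[OF p(1)])
  have Xn: "norm X \<le> q"
  proof (rule norm_blinfun_bound[OF q(1)])
    fix x
    have "(norm (blinfun_apply X x))\<^sup>2
        = (norm x)\<^sup>2 - 2 / \<mu> * Re (cinner (p x) x) + (norm (p x))\<^sup>2 / \<mu>\<^sup>2"
      unfolding X norm_diff_sq
      using Re_cinner_commute[of x "p x"] by (simp add: cinner_simps power_mult_distrib power_divide)
    also have "\<dots> \<le> (norm x)\<^sup>2 - 2 / \<mu> * (c * (norm x)\<^sup>2) + (B * norm x)\<^sup>2 / \<mu>\<^sup>2"
      using c(2)[of x] \<mu> B(3)[of x]
      by (intro add_mono diff_mono mult_left_mono divide_right_mono power_mono) auto
    also have "\<dots> = (q * norm x)\<^sup>2"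
      using B(1) c(1) unfolding power_mult_distrib q(3) \<mu>_def
      by (simp add: field_simps power2_eq_square)
    finally show "norm (blinfun_apply X x) \<le> q * norm x"
      by (rule power2_le_imp_le) (use q(1) in simp)
  qed
  \<comment> \<open>Self-adjointness is a closed condition preserved by the iteration, so the fixed
    point inherits it.\<close>
  define S where "S = {Y :: 'a \<Rightarrow>\<^sub>L 'a. norm Y \<le> q \<and> adjoint_pair (blinfun_apply Y) (blinfun_apply Y)}"
  have "closed S"
  proof -
    have "S = cball 0 q \<inter> (\<Inter>x. \<Inter>y. {Y. cinner (blinfun_apply Y x) y = cinner x (blinfun_apply Y y)})"
      by (auto simp: S_def adjoint_pair_def)
    moreover have "closed {Y :: 'a \<Rightarrow>\<^sub>L 'a. cinner (blinfun_apply Y x) y = cinner x (blinfun_apply Y y)}" for x y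
      by (intro closed_Collect_eq continuous_intros
          bounded_bilinear.continuous_on[OF bounded_bilinear_cinner])
    ultimately show ?thesis by (auto intro!: closed_Int closed_INT)
  qed
  then have Sc: "complete S" by (simp add: complete_eq_closed)
  define F where "F = (\<lambda>Y :: 'a \<Rightarrow>\<^sub>L 'a. (1/2) *\<^sub>R (X + (Y o\<^sub>L Y)))"
  have XS: "adjoint_pair (blinfun_apply X) (blinfun_apply X)"
    using adjoint_pairD[OF p(2)] by (simp add: adjoint_pair_def X cinner_simps)
  have FS: "F Y \<in> S" if "Y \<in> S" for Y
  proof -
    from that have Y: "norm Y \<le> q" "adjoint_pair (blinfun_apply Y) (blinfun_apply Y)" by (auto simp: S_def)
    have "norm (Y o\<^sub>L Y) \<le> q * q"
      using norm_blinfun_compose[of Y Y] mult_mono[OF Y(1) Y(1) q(1) norm_ge_zero] by linarith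
    also have "\<dots> \<le> q" using q by (simp add: mult_left_le)
    finally have "norm (F Y) \<le> q"
      unfolding F_def using norm_triangle_ineq[of X "Y o\<^sub>L Y"] Xn by simp
    moreover have "adjoint_pair (blinfun_apply (F Y)) (blinfun_apply (F Y))"
      using adjoint_pairD[OF XS] adjoint_pairD[OF Y(2)]
      by (simp add: F_def adjoint_pair_def blinfun.add_left blinfun.scaleR_left cinner_simps)
    ultimately show ?thesis by (simp add: S_def)
  qed
  have lip: "dist (F Y) (F Z) \<le> q * dist Y Z" if "Y \<in> S" "Z \<in> S" for Y Z
  proof -
    have Y: "norm Y \<le> q" and Z: "norm Z \<le> q" using that by (auto simp: S_def)
    have "F Y - F Z = (1/2) *\<^sub>R ((Y o\<^sub>L (Y - Z)) + ((Y - Z) o\<^sub>L Z))"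
      by (rule blinfun_eqI)
        (simp add: F_def blinfun.add_left blinfun.diff_left blinfun.scaleR_left blinfun.diff_right algebra_simps)
    then have "norm (F Y - F Z) \<le> (norm (Y o\<^sub>L (Y - Z)) + norm ((Y - Z) o\<^sub>L Z)) / 2"
      using norm_triangle_ineq[of "Y o\<^sub>L (Y - Z)" "(Y - Z) o\<^sub>L Z"] by simp
    also have "\<dots> \<le> (norm Y * norm (Y - Z) + norm (Y - Z) * norm Z) / 2"
      by (intro divide_right_mono add_mono norm_blinfun_compose) auto
    also have "\<dots> \<le> (q * norm (Y - Z) + norm (Y - Z) * q) / 2"
      using Y Z by (intro divide_right_mono add_mono mult_right_mono mult_left_mono) auto
    finally show ?thesis by (simp add: dist_norm)
  qed
  have "0 \<in> S" using q(1) by (simp add: S_def adjoint_pair_def)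
  then have "S \<noteq> {}" by blast
  then obtain Y where Y: "Y \<in> S" "F Y = Y"
    using Banach_fix[OF Sc _ q(1,2), of F] FS lip by blast
  define y where "y = blinfun_apply Y"
  have yl: "linear y" unfolding y_def by (rule bounded_linear.linear[OF blinfun.bounded_linear_right])
  have yn: "norm (y x) \<le> q * norm x" for x
  proof -
    have "norm Y * norm x \<le> q * norm x" using Y(1) by (intro mult_right_mono) (auto simp: S_def)
    with norm_blinfun[of Y x] show ?thesis unfolding y_def by linarith
  qed
  have ya: "adjoint_pair y y" using Y(1) by (simp add: S_def y_def)
  have fixp: "2 *\<^sub>R y x = x - (1 / \<mu>) *\<^sub>R p x + y (y x)" for x
    using arg_cong[OF Y(2), of "\<lambda>Y. 2 *\<^sub>R blinfun_apply Y x"]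
    by (simp add: F_def blinfun.add_left blinfun.scaleR_left X y_def)
  define d where "d = (\<lambda>x. sqrt \<mu> *\<^sub>R (x - y x))"
  have dbl: "bounded_linear d"
    unfolding d_def y_def by (intro bounded_linear_intros)
  have da: "adjoint_pair d d"
    using adjoint_pairD[OF ya] by (simp add: adjoint_pair_def d_def cinner_simps)
  \<comment> \<open>The fixed point was found among real-linear operators; self-adjointness for the
    complex inner product forces complex linearity.\<close>
  have "d (c *\<^sub>C x) = c *\<^sub>C d x" for c x
    by (rule cinner_ext) (simp add: cinner_simps adjoint_pairD[OF da])
  with dbl have dc: "bounded_clinear d" by (simp add: bounded_clinear_def)
  have coe: "(sqrt \<mu> * (1 - q)) * (norm x)\<^sup>2 \<le> Re (cinner (d x) x)" for x
  proof -
    have "Re (cinner (y x) x) \<le> norm (y x) * norm x"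
      using cinner_Cauchy_Schwarz[of "y x" x] complex_Re_le_cmod[of "cinner (y x) x"] by linarith
    also have "\<dots> \<le> q * (norm x)\<^sup>2"
      using mult_right_mono[OF yn[of x], of "norm x"] by (simp add: power2_eq_square)
    finally have "sqrt \<mu> * ((1 - q) * (norm x)\<^sup>2) \<le> sqrt \<mu> * ((norm x)\<^sup>2 - Re (cinner (y x) x))"
      using \<mu> by (intro mult_left_mono) (auto simp: algebra_simps)
    then show ?thesis by (simp add: d_def cinner_simps Re_cinner_self mult.assoc)
  qed
  have "sqrt \<mu> * (1 - q) > 0" using \<mu> q by simp
  then have "coercive d" unfolding coercive_def using dc da coe by blast
  moreover have "d (d x) = p x" for x
  proof -
    have "d (d x) = \<mu> *\<^sub>R (x - 2 *\<^sub>R y x + y (y x))"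
      unfolding d_def using \<mu>
      by (simp add: linear_diff[OF yl] linear_scale[OF yl] real_sqrt_mult_self algebra_simps scaleR_2)
    also have "\<dots> = p x" unfolding fixp using \<mu> by (simp add: algebra_simps)
    finally show ?thesis .
  qed
  ultimately show thesis using that by blast
qed

section \<open>Consequences of coercivity: uniqueness of roots, lower bounds, injectivity\<close>

lemma coercive_positive: "coercive d \<Longrightarrow> 0 \<le> Re (cinner (d x) x)"
  unfolding coercive_def by (meson dual_order.trans less_imp_le mult_nonneg_nonneg zero_le_power2)

lemma
  assumes "coercive d"
  shows coercive_bounded_clinear: "bounded_clinear d" and coercive_adjoint: "adjoint_pair d d"
  using assms by (auto simp: coercive_def)

lemma coercive_Sylvester_zero:
  assumes "coercive d" "bounded_clinear c" "\<And>x. 0 \<le> Re (cinner (c x) x)"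
    "bounded_clinear X" "\<And>x. d (X x) + X (c x) = 0"
  shows "X x = 0"
proof -
  obtain e where "e > 0" "\<And>x. e * (norm x)\<^sup>2 \<le> Re (cinner (d x) x)"
    using assms(1) unfolding coercive_def by blast
  then show ?thesis using Sylvester_zero[of d e c X x] assms by (auto simp: coercive_def)
qed

text \<open>The difference \<open>X = d - f\<close> solves
  \<open>d X + X f = d\<^sup>2 - f\<^sup>2 = 0\<close>, so the Sylvester argument applies without
  first showing that \<open>d\<close> and \<open>f\<close> commute.\<close>

lemma coercive_sqrt_unique:
  assumes d: "coercive d" and f: "bounded_clinear f" "\<And>x. 0 \<le> Re (cinner (f x) x)"
    and eq: "\<And>x. d (d x) = f (f x)"
  shows "f = d"
proof
  fix x
  have "d x - f x = 0"
    using coercive_Sylvester_zero[OF d f bounded_clinear_sub[OF coercive_bounded_clinear[OF d] f(1)], of x]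
    by (simp add: bounded_clinear_simps[OF coercive_bounded_clinear[OF d]] bounded_clinear_simps[OF f(1)] eq)
  then show "f x = d x" by simp
qed

lemma coercive_norm_lower:
  assumes "coercive d"
  obtains e where "e > 0" "\<And>x. e * norm x \<le> norm (d x)"
proof -
  obtain e where e: "e > 0" "\<And>x. e * (norm x)\<^sup>2 \<le> Re (cinner (d x) x)"
    using assms unfolding coercive_def by blast
  have "e * norm x \<le> norm (d x)" for x
  proof (cases "x = 0")
    case False
    have "e * (norm x)\<^sup>2 \<le> norm (d x) * norm x"
      using e(2)[of x] cinner_Cauchy_Schwarz[of "d x" x] complex_Re_le_cmod[of "cinner (d x) x"]
      by linarith
    then show ?thesis using False by (simp add: power2_eq_square)
  qed (simp add: bounded_clinear_simps[OF coercive_bounded_clinear[OF assms]])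
  with e(1) show thesis using that by blast
qed

lemma coercive_inj: "coercive d \<Longrightarrow> inj d"
proof (rule injI)
  fix x y assume d: "coercive d" "d x = d y"
  obtain e where "e > 0" "\<And>x. e * norm x \<le> norm (d x)" using coercive_norm_lower[OF d(1)] by blast
  from this(1) this(2)[of "x - y"] d(2) show "x = y"
    by (simp add: bounded_clinear_simps[OF coercive_bounded_clinear[OF d(1)]] mult_le_0_iff)
qed


section \<open>Operators into a finite-dimensional space\<close>

text \<open>Bolzano-Weierstrass by induction on the spanning set. The coefficients of a new vector
  \<open>b\<close> are bounded because \<open>b\<close> has positive distance from the span of
  \<open>B\<close>, which is closed by the induction hypothesis.\<close>

lemma bounded_seq_in_span_convergent_subseq:
  fixes x :: "nat \<Rightarrow> 'a::complex_normed_vector"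
  assumes "finite B" "\<And>n. x n \<in> complex_vector.span B" "\<And>n. norm (x n) \<le> C"
  shows "\<exists>l r. strict_mono (r :: nat \<Rightarrow> nat) \<and> l \<in> complex_vector.span B \<and> (x \<circ> r) \<longlonglongrightarrow> l"
  using assms
proof (induction B arbitrary: x C rule: finite_induct)
  case empty
  then have "x = (\<lambda>n. 0)" by auto
  then show ?case by (intro exI[of _ 0] exI[of _ id]) (auto simp: strict_mono_def o_def)
next
  case (insert b B)
  note IH = insert.IH
  show ?case
  proof (cases "b \<in> complex_vector.span B")
    case True
    then have "complex_vector.span (insert b B) = complex_vector.span B"
      by (rule complex_vector.span_redundant)
    then show ?thesis using IH insert.prems by metis
  next
    case False
    have "closed (complex_vector.span B)"
      unfolding closed_sequential_limits
    proof (intro allI impI, elim conjE)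
      fix w l assume w: "\<forall>n. w n \<in> complex_vector.span B" and l: "w \<longlonglongrightarrow> l"
      obtain D where "\<And>n. norm (w n) \<le> D"
        using convergent_imp_Bseq[of w] l unfolding convergent_def Bseq_def by blast
      then obtain l' r where "strict_mono (r :: nat \<Rightarrow> nat)" "l' \<in> complex_vector.span B" "(w \<circ> r) \<longlonglongrightarrow> l'"
        using IH[of w D] w by blast
      then show "l \<in> complex_vector.span B"
        using LIMSEQ_subseq_LIMSEQ[OF l] LIMSEQ_unique by blast
    qed
    then have "open (- complex_vector.span B)" by (rule open_Compl)
    then obtain d where d: "d > 0" "ball b d \<subseteq> - complex_vector.span B"
      using False openE[of "- complex_vector.span B" b] by blast
    have far: "d \<le> norm (b + w)" if "w \<in> complex_vector.span B" for w
    proof (rule ccontr)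
      assume "\<not> d \<le> norm (b + w)"
      then have "- w \<in> ball b d" by (simp add: dist_norm)
      then show False using d(2) complex_vector.span_neg[OF that] by blast
    qed
    have "\<forall>n. \<exists>c. x n - c *\<^sub>C b \<in> complex_vector.span B"
      using insert.prems(1) unfolding complex_vector.span_insert by simp
    then obtain c where c: "\<And>n. x n - c n *\<^sub>C b \<in> complex_vector.span B"
      by metis
    have cb: "norm (c n) \<le> C / d" for n
    proof (cases "c n = 0")
      case True
      then show ?thesis using d(1) insert.prems(2)[of n] norm_ge_zero[of "x n"]
        by (simp only: norm_zero) (metis divide_nonneg_pos order_trans)
    next
      case False
      \<comment> \<open>Dividing by the coefficient writes \<open>x n\<close> as \<open>c n\<close>
        times a vector \<open>b + w\<close> with \<open>w\<close> in the span; such a vector has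
        norm at least \<open>d\<close>.\<close>
      let ?w = "inverse (c n) *\<^sub>C (x n - c n *\<^sub>C b)"
      have "x n = c n *\<^sub>C (b + ?w)"
        using False by (simp add: scaleC_add_right complex_vector.scale_right_diff_distrib)
      then have "norm (x n) = norm (c n) * norm (b + ?w)" by (metis norm_scaleC)
      also have "\<dots> \<ge> norm (c n) * d"
        by (intro mult_left_mono far complex_vector.span_scale c) auto
      finally show ?thesis using d(1) insert.prems(2)[of n] by (simp add: pos_le_divide_eq)
    qed
    then have "bounded (range c)" by (auto simp: bounded_iff)
    then obtain lc r where r: "strict_mono (r :: nat \<Rightarrow> nat)" "(c \<circ> r) \<longlonglongrightarrow> lc"
      using bounded_imp_convergent_subsequence by blast
    define w where "w = (\<lambda>n. x (r n) - c (r n) *\<^sub>C b)"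
    have "norm (w n) \<le> C + C / d * norm b" for n
    proof -
      have "norm (w n) \<le> norm (x (r n)) + norm (c (r n)) * norm b"
        unfolding w_def by (metis norm_triangle_ineq4 norm_scaleC)
      also have "\<dots> \<le> C + C / d * norm b"
        by (intro add_mono mult_right_mono cb insert.prems) auto
      finally show ?thesis .
    qed
    moreover have "w n \<in> complex_vector.span B" for n unfolding w_def by (rule c)
    ultimately obtain lw r' where r': "strict_mono (r' :: nat \<Rightarrow> nat)" "lw \<in> complex_vector.span B" "(w \<circ> r') \<longlonglongrightarrow> lw"
      using IH[of w] by blast
    have bl: "bounded_linear (\<lambda>c. c *\<^sub>C b)"
    proof (rule bounded_linear_intro[where K = "norm b"])
      show "(r *\<^sub>R c) *\<^sub>C b = r *\<^sub>R c *\<^sub>C b" for r c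
        by (simp only: scaleR_conv_of_real scaleC_of_real[symmetric] scaleC_scaleC)
    qed (auto simp: scaleC_add_left norm_scaleC)
    have "(\<lambda>n. c (r (r' n)) *\<^sub>C b) \<longlonglongrightarrow> lc *\<^sub>C b"
      using bounded_linear.tendsto[OF bl LIMSEQ_subseq_LIMSEQ[OF r(2) r'(1)]] by (simp add: o_def)
    from tendsto_add[OF this r'(3)] have "(x \<circ> (r \<circ> r')) \<longlonglongrightarrow> lc *\<^sub>C b + lw"
      by (simp add: w_def o_def)
    moreover have "lc *\<^sub>C b + lw \<in> complex_vector.span (insert b B)"
      using r'(2) complex_vector.span_mono[of B "insert b B"]
      by (intro complex_vector.span_add complex_vector.span_scale) (auto intro: complex_vector.span_base)
    moreover have "strict_mono (r \<circ> r')" using r(1) r'(1) by (rule strict_mono_o)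
    ultimately show ?thesis by blast
  qed
qed

lemma finite_cdim_convergent_subseq:
  fixes x :: "nat \<Rightarrow> 'k::complex_normed_vector"
  assumes "finite_cdim (UNIV :: 'k set)" "\<And>n. norm (x n) \<le> C"
  obtains l and r :: "nat \<Rightarrow> nat" where "strict_mono r" "(x \<circ> r) \<longlonglongrightarrow> l"
  using assms bounded_seq_in_span_convergent_subseq[of _ x C] unfolding finite_cdim_def by (metis UNIV_I)

lemma finite_cdim_basis:
  assumes "finite_cdim (UNIV :: 'k::complex_vector set)"
  obtains B :: "'k::complex_vector set" where "finite_dimensional_vector_space scaleC B"
proof -
  obtain B0 :: "'k set" where B0: "finite B0" "complex_vector.span B0 = UNIV"
    using assms by (auto simp: finite_cdim_def)
  obtain B where B: "B \<subseteq> B0" "complex_vector.independent B" "complex_vector.span B0 = complex_vector.span B"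
    using complex_vector.basis_exists[of B0]
    by (metis complex_vector.span_minimal complex_vector.span_mono complex_vector.span_span
        complex_vector.subspace_span subset_antisym)
  have "finite_dimensional_vector_space scaleC B"
    using B B0 finite_subset by unfold_locales auto
  then show thesis by (rule that)
qed

text \<open>Lower bounds give only injectivity of \<open>den x\<close> and of coercive maps on
  \<open>K\<close>; their surjectivity, hence every inverse on \<open>K\<close>, comes from finite
  dimension here.\<close>

lemma bounded_clinear_inj_imp_surj:
  fixes f :: "'k::complex_normed_vector \<Rightarrow> 'k"
  assumes "finite_cdim (UNIV :: 'k set)" "bounded_clinear f" "inj f"
  shows "surj f"
proof -
  obtain B :: "'k set" where "finite_dimensional_vector_space scaleC B"
    using finite_cdim_basis[OF assms(1)] .
  then interpret fd: finite_dimensional_vector_space scaleC B .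
  have "Vector_Spaces.linear scaleC scaleC f"
    by unfold_locales (auto simp: bounded_clinear_simps[OF assms(2)])
  then show ?thesis using assms(3) by (rule fd.linear_inj_imp_surj)
qed


section \<open>Everywhere defined operators as graphs\<close>

definition graph_of :: "('a \<Rightarrow> 'b) \<Rightarrow> ('a \<times> 'b) set" where
  "graph_of f = {(x, y). y = f x}"

lemma in_graph_of [simp]: "(x, y) \<in> graph_of f \<longleftrightarrow> y = f x"
  by (simp add: graph_of_def)

lemma graph_of_comp [simp]: "graph_of g \<circ>\<^sub>o graph_of f = graph_of (\<lambda>x. g (f x))"
  by (auto simp: graph_of_def)

lemma Id_add_graph_of [simp]: "Id +\<^sub>o graph_of g = graph_of (\<lambda>x. x + g x)"
  by (auto simp: graph_of_def op_add_def)

lemma graph_of_diff [simp]: "graph_of f -\<^sub>o graph_of g = graph_of (\<lambda>x. f x - g x)"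
  by (auto simp: graph_of_def op_diff_def)

lemma graph_of_eq_iff [simp]: "graph_of f = graph_of g \<longleftrightarrow> f = g"
  by (auto simp: graph_of_def set_eq_iff fun_eq_iff)

lemma Domain_graph_of [simp]: "Domain (graph_of f) = UNIV"
  by (auto simp: graph_of_def)

lemma adj_graph_of: "adjoint_pair f g \<Longrightarrow> adj (graph_of f) = graph_of g"
  by (auto simp: adj_def graph_of_def adjoint_pair_def intro: cinner_ext_right)

lemma linear_operator_graph_of: "bounded_clinear f \<Longrightarrow> linear_operator (graph_of f)"
  unfolding linear_operator_def complex_vector.subspace_def
  by (auto simp: graph_of_def zero_prod_def scaleC_prod_def single_valued_def bounded_clinear_simps)

lemma densely_defined_graph_of: "densely_defined (graph_of f)"
  by (simp add: densely_defined_def)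

lemma closed_graph_of:
  fixes f :: "'a::complex_normed_vector \<Rightarrow> 'b::complex_normed_vector"
  assumes "bounded_clinear f"
  shows "closed (graph_of f)"
proof -
  have "graph_of f = {p. snd p = f (fst p)}" by (auto simp: graph_of_def)
  then show ?thesis
    by (simp only:) (intro closed_Collect_eq continuous_intros
        bounded_linear.continuous_on[OF bounded_clinear_imp_bounded_linear[OF assms]])
qed

text \<open>A competing root \<open>R\<close> may a priori be unbounded and partial. Since
  \<open>R O R\<close> is everywhere defined, so is \<open>R\<close>; and
  \<open>norm (f x) = norm (d x)\<close>, as both squares equal \<open>Re (cinner (p x) x)\<close>,
  makes it bounded, so \<open>coercive_sqrt_unique\<close> applies.\<close>

lemma op_sqrt_graph_of:
  assumes d: "coercive d" and eq: "\<And>x. d (d x) = p x"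
  shows "op_sqrt (graph_of p) = graph_of d"
  unfolding op_sqrt_def
proof (rule the_equality)
  have "adj (graph_of d) = graph_of d" by (rule adj_graph_of[OF coercive_adjoint[OF d]])
  then show "positive_selfadjoint (graph_of d) \<and> graph_of d \<circ>\<^sub>o graph_of d = graph_of p"
    using coercive_positive[OF d] eq
    by (auto simp: positive_selfadjoint_def densely_defined_graph_of
        linear_operator_graph_of[OF coercive_bounded_clinear[OF d]])
next
  fix R assume R: "positive_selfadjoint R \<and> R \<circ>\<^sub>o R = graph_of p"
  then have sv: "single_valued R" and sub: "complex_vector.subspace R" and sa: "adj R = R"
    and pos: "\<And>x y. (x, y) \<in> R \<Longrightarrow> 0 \<le> Re (cinner y x)"
    and RR: "R \<circ>\<^sub>o R = graph_of p"
    by (auto simp: positive_selfadjoint_def linear_operator_def)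
  have "\<exists>y. (x, y) \<in> R" for x
  proof -
    have "(x, p x) \<in> R \<circ>\<^sub>o R" unfolding RR by simp
    then show ?thesis by blast
  qed
  then obtain f where f: "\<And>x. (x, f x) \<in> R" by metis
  have Rf: "R = graph_of f" using f sv by (auto simp: single_valued_def graph_of_def)
  have ff: "f (f x) = p x" for x using RR by (auto simp: Rf fun_eq_iff)
  have fa: "adjoint_pair f f"
  proof -
    have "(x, f x) \<in> adj R" for x using sa f by simp
    then show ?thesis by (fastforce simp: adj_def Rf adjoint_pair_def)
  qed
  obtain B where B: "B > 0" "\<And>x. norm (d x) \<le> B * norm x"
    using bounded_clinear_bound[OF coercive_bounded_clinear[OF d]] by blast
  have "bounded_clinear f"
  proof (rule bounded_clinearI[where B = B])
    show "f (x + y) = f x + f y" for x y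
      using complex_vector.subspace_add[OF sub f[of x] f[of y]] by (simp add: Rf)
    show "f (c *\<^sub>C x) = c *\<^sub>C f x" for c x
      using complex_vector.subspace_scale[OF sub f[of x], of c] by (simp add: Rf scaleC_prod_def)
    show "norm (f x) \<le> norm x * B" for x
    proof (rule power2_le_imp_le)
      have "(norm (f x))\<^sup>2 = Re (cinner (f (f x)) x)"
        by (simp only: adjoint_pairD[OF fa] Re_cinner_self[symmetric])
      also have "\<dots> = Re (cinner (d (d x)) x)" by (simp add: ff eq)
      also have "\<dots> = (norm (d x))\<^sup>2"
        by (simp only: adjoint_pairD[OF coercive_adjoint[OF d]] Re_cinner_self[symmetric])
      also have "\<dots> \<le> (norm x * B)\<^sup>2" using B(2)[of x] by (intro power_mono) (auto simp: mult.commute)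
      finally show "(norm (f x))\<^sup>2 \<le> (norm x * B)\<^sup>2" .
    qed (use B in simp)
  qed
  then have "f = d"
    by (rule coercive_sqrt_unique[OF d]) (use pos f ff eq in auto)
  then show "R = graph_of d" by (simp add: Rf)
qed

text \<open>If \<open>T\<close> were unbounded, normalised values \<open>T x\<^sub>n\<close> with \<open>x\<^sub>n \<rightarrow> 0\<close> would accumulate at a unit
  vector \<open>l\<close> with \<open>(0, l)\<close> in the closed graph.\<close>

lemma closed_op_bounded:
  fixes T :: "('h::complex_hilbert \<times> 'k::complex_hilbert) set"
  assumes fin: "finite_cdim (UNIV :: 'k set)"
    and T: "linear_operator T" "closed T" "densely_defined T"
  obtains t where "bounded_clinear t" "T = graph_of t"
proof -
  have sub: "complex_vector.subspace T" and sv: "single_valued T"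
    using T(1) by (auto simp: linear_operator_def)
  have add: "(x + x', y + y') \<in> T" if "(x, y) \<in> T" "(x', y') \<in> T" for x y x' y'
    using complex_vector.subspace_add[OF sub that] by simp
  have diff: "(x - x', y - y') \<in> T" if "(x, y) \<in> T" "(x', y') \<in> T" for x y x' y'
    using complex_vector.subspace_diff[OF sub that] by simp
  have scale: "(c *\<^sub>C x, c *\<^sub>C y) \<in> T" if "(x, y) \<in> T" for c x y
    using complex_vector.subspace_scale[OF sub that, of c] by (simp add: scaleC_prod_def)
  have zero: "(0, 0) \<in> T" using complex_vector.subspace_0[OF sub] by (simp add: zero_prod_def)
  have "\<exists>C. \<forall>(x, y)\<in>T. norm y \<le> C * norm x"
  proof (rule ccontr)
    assume neg: "\<nexists>C. \<forall>(x, y)\<in>T. norm y \<le> C * norm x"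
    have "\<exists>x y. (x, y) \<in> T \<and> norm y = 1 \<and> norm x \<le> inverse (real (Suc n))" for n
    proof -
      from neg obtain x y where xy: "(x, y) \<in> T" "norm y > real (Suc n) * norm x"
        by (metis (mono_tags, lifting) case_prodI2 not_le)
      from xy(2) have y: "norm y > 0" by (smt (verit) mult_nonneg_nonneg norm_ge_zero of_nat_0_le_iff)
      let ?c = "complex_of_real (inverse (norm y))"
      have "(?c *\<^sub>C x, ?c *\<^sub>C y) \<in> T" by (rule scale[OF xy(1)])
      moreover have "norm (?c *\<^sub>C y) = 1" using y by (simp add: norm_scaleC norm_inverse)
      moreover have "norm (?c *\<^sub>C x) = norm x / norm y"
        using y by (simp add: norm_scaleC norm_inverse divide_inverse mult.commute)
      moreover have "norm x / norm y \<le> inverse (real (Suc n))"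
        using y xy(2) by (simp add: field_simps)
      ultimately show ?thesis by metis
    qed
    then obtain x y where xy: "\<And>n. (x n, y n) \<in> T" "\<And>n. norm (y n) = 1"
      "\<And>n. norm (x n) \<le> inverse (real (Suc n))" by metis
    obtain l and r :: "nat \<Rightarrow> nat" where r: "strict_mono r" "(y \<circ> r) \<longlonglongrightarrow> l"
      by (rule finite_cdim_convergent_subseq[OF fin, of y 1]) (auto simp: xy(2))
    have "x \<longlonglongrightarrow> 0"
      by (rule Lim_null_comparison[OF _ LIMSEQ_inverse_real_of_nat]) (use xy(3) in auto)
    then have "(x \<circ> r) \<longlonglongrightarrow> 0" by (rule LIMSEQ_subseq_LIMSEQ[OF _ r(1)])
    from tendsto_Pair[OF this r(2)] have "(0, l) \<in> T"
      using T(2) xy(1) unfolding closed_sequential_limits by (metis (mono_tags, lifting) comp_apply)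
    then have "l = 0" using zero sv by (auto simp: single_valued_def)
    moreover have "norm l = 1"
    proof -
      have "(\<lambda>n. norm ((y \<circ> r) n)) \<longlonglongrightarrow> norm l" by (rule tendsto_norm[OF r(2)])
      then show ?thesis using xy(2) by (simp add: o_def LIMSEQ_const_iff)
    qed
    ultimately show False by simp
  qed
  then obtain C where C: "\<And>x y. (x, y) \<in> T \<Longrightarrow> norm y \<le> C * norm x" by blast
  \<comment> \<open>The bound makes the values along a sequence in the dense domain Cauchy, and
    closedness puts the limit pair into \<open>T\<close>.\<close>
  have "\<exists>y. (x, y) \<in> T" for x
  proof -
    have "x \<in> closure (Domain T)" using T(3) by (simp add: densely_defined_def)
    then obtain u where u: "\<And>n. u n \<in> Domain T" "u \<longlonglongrightarrow> x" by (auto simp: closure_sequential)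
    then have "\<forall>n. \<exists>y. (u n, y) \<in> T" by blast
    then obtain v where v: "\<And>n. (u n, v n) \<in> T" by metis
    have "Cauchy v"
    proof (rule metric_CauchyI)
      fix e :: real assume e: "e > 0"
      define D where "D = \<bar>C\<bar> + 1"
      have D: "D > 0" "C \<le> D" by (auto simp: D_def)
      obtain N where N: "\<And>m n. m \<ge> N \<Longrightarrow> n \<ge> N \<Longrightarrow> dist (u m) (u n) < e / D"
        using metric_CauchyD[OF LIMSEQ_imp_Cauchy[OF u(2)], of "e / D"] e D by auto
      have "dist (v m) (v n) < e" if "m \<ge> N" "n \<ge> N" for m n
      proof -
        have "dist (v m) (v n) \<le> C * dist (u m) (u n)"
          using C[OF diff[OF v[of m] v[of n]]] by (simp add: dist_norm)
        also have "\<dots> \<le> D * dist (u m) (u n)" using D by (intro mult_right_mono) auto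
        also have "\<dots> < e" using N[OF that] D by (simp add: pos_less_divide_eq mult.commute)
        finally show ?thesis .
      qed
      then show "\<exists>M. \<forall>m\<ge>M. \<forall>n\<ge>M. dist (v m) (v n) < e" by blast
    qed
    then obtain y where "v \<longlonglongrightarrow> y" using Cauchy_convergent convergent_def by blast
    from tendsto_Pair[OF u(2) this] have "(x, y) \<in> T"
      using T(2) v unfolding closed_sequential_limits by (metis (mono_tags, lifting))
    then show ?thesis by blast
  qed
  then obtain t where t: "\<And>x. (x, t x) \<in> T" by metis
  have uniq: "y = t x" if "(x, y) \<in> T" for x y using that t[of x] sv by (auto simp: single_valued_def)
  have "T = graph_of t" using t uniq by (auto simp: graph_of_def)
  moreover have "bounded_clinear t"
    by (rule bounded_clinearI[where B = C])
      (use uniq add scale t C in \<open>auto simp: mult.commute intro!: uniq[symmetric]\<close>)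
  ultimately show thesis using that by blast
qed


section \<open>Operator balls and Moebius maps\<close>

abbreviation cblinfun_apply ::
    "('a::complex_normed_vector, 'b::complex_normed_vector) cblinfun \<Rightarrow> 'a \<Rightarrow> 'b" (infixr "*\<^sub>V" 70) where
  "A *\<^sub>V x \<equiv> blinfun_apply (blinfun_of_cblinfun A) x"

lemma cblinfun_eqI: "(\<And>x. A *\<^sub>V x = B *\<^sub>V x) \<Longrightarrow> A = B"
  by transfer (rule blinfun_eqI)

lemma bounded_clinear_apply: "bounded_clinear (\<lambda>x. A *\<^sub>V x)"
  unfolding bounded_clinear_def
  using blinfun_of_cblinfun[of A] blinfun.bounded_linear_right by auto

lemmas apply_simps = bounded_clinear_simps[OF bounded_clinear_apply]

lemma norm_apply: "norm (A *\<^sub>V x) \<le> norm A * norm x"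
  by transfer (rule norm_blinfun)

lemma norm_apply_bound: "0 \<le> b \<Longrightarrow> (\<And>x. norm (A *\<^sub>V x) \<le> b * norm x) \<Longrightarrow> norm A \<le> b"
  by transfer (rule norm_blinfun_bound)

lemma apply_left_simps:
  "(A + B) *\<^sub>V x = A *\<^sub>V x + B *\<^sub>V x"
  "(A - B) *\<^sub>V x = A *\<^sub>V x - B *\<^sub>V x"
  "(- A) *\<^sub>V x = - (A *\<^sub>V x)"
  "0 *\<^sub>V x = 0"
  "(r *\<^sub>R A) *\<^sub>V x = r *\<^sub>R (A *\<^sub>V x)"
  "(c *\<^sub>C A) *\<^sub>V x = c *\<^sub>C (A *\<^sub>V x)"
  by (transfer; simp add: blinfun.add_left blinfun.diff_left blinfun.minus_left blinfun.scaleR_left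
      blinfun_scaleC.rep_eq)+

lemma apply_sum_left: "(sum f S) *\<^sub>V x = (\<Sum>i\<in>S. f i *\<^sub>V x)"
  by (induction S rule: infinite_finite_induct) (auto simp: apply_left_simps)

definition cblinfun_of :: "('a::complex_normed_vector \<Rightarrow> 'b::complex_normed_vector) \<Rightarrow> ('a, 'b) cblinfun" where
  "cblinfun_of f = Abs_cblinfun (Blinfun f)"

lemma apply_cblinfun_of [simp]: "bounded_clinear f \<Longrightarrow> cblinfun_of f *\<^sub>V x = f x"
  unfolding cblinfun_of_def
  by (subst Abs_cblinfun_inverse)
    (auto simp: bounded_clinear_def bounded_linear_Blinfun_apply)

text \<open>\<open>hform x y k v\<close> is the value of the indefinite form \<open>\<langle>k, k'\<rangle> - \<langle>h, h'\<rangle>\<close> on \<open>H \<times> K\<close> at the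
  points \<open>(x k, k)\<close> and \<open>(y v, v)\<close> of the graphs of \<open>x\<close> and \<open>y\<close>.  In the open unit ball
  \<open>hyp_near s x y\<close> says that the hyperbolic distance of \<open>x\<close> and \<open>y\<close> is at most
  \<open>artanh (sqrt (1 - s))\<close>.\<close>

definition hform :: "('k::complex_hilbert, 'h::complex_hilbert) cblinfun \<Rightarrow> ('k, 'h) cblinfun \<Rightarrow> 'k \<Rightarrow> 'k \<Rightarrow> complex" where
  "hform x y k v = cinner k v - cinner (x *\<^sub>V k) (y *\<^sub>V v)"

definition hyp_near :: "real \<Rightarrow> ('k::complex_hilbert, 'h::complex_hilbert) cblinfun \<Rightarrow> ('k, 'h) cblinfun \<Rightarrow> bool" where
  "hyp_near s x y \<longleftrightarrow>
     (\<forall>k v. s * (cmod (hform x y k v))\<^sup>2 \<le> Re (hform x x k k) * Re (hform y y v v))"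

lemma hform_cnj: "hform y x v k = cnj (hform x y k v)"
  unfolding hform_def by (metis cinner_commute complex_cnj_diff)

lemma hyp_near_sym: "hyp_near s x y \<Longrightarrow> hyp_near s y x"
  unfolding hyp_near_def by (subst hform_cnj) (simp add: mult.commute)

lemma Re_hform_self: "Re (hform x x k k) = (norm k)\<^sup>2 - (norm (x *\<^sub>V k))\<^sup>2"
  by (simp add: hform_def Re_cinner_self)

lemma Re_hform_lower: "(1 - (norm x)\<^sup>2) * (norm k)\<^sup>2 \<le> Re (hform x x k k)"
  using power_mono[OF norm_apply[of x k], of 2]
  by (simp add: Re_hform_self power_mult_distrib algebra_simps)

text \<open>Taking \<open>v = k\<close> one way and Cauchy-Schwarz the other reduces the condition
  to a bound on \<open>x\<close> alone: about 0 hyperbolic balls are norm balls, of radius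
  \<open>sqrt (1 - s)\<close> for \<open>s \<le> 1\<close>, which the Schwarz lemma can
  handle.\<close>

lemma hyp_near_zero:
  assumes "0 \<le> s"
  shows "hyp_near s x 0 \<longleftrightarrow> (\<forall>k. s * (norm k)\<^sup>2 \<le> (norm k)\<^sup>2 - (norm (x *\<^sub>V k))\<^sup>2)"
proof
  assume n: "hyp_near s x 0"
  show "\<forall>k. s * (norm k)\<^sup>2 \<le> (norm k)\<^sup>2 - (norm (x *\<^sub>V k))\<^sup>2"
  proof
    fix k :: 'a
    show "s * (norm k)\<^sup>2 \<le> (norm k)\<^sup>2 - (norm (x *\<^sub>V k))\<^sup>2"
    proof (cases "k = 0")
      case False
      have "s * (norm k)\<^sup>2 * (norm k)\<^sup>2 \<le> ((norm k)\<^sup>2 - (norm (x *\<^sub>V k))\<^sup>2) * (norm k)\<^sup>2"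
        using n[unfolded hyp_near_def, rule_format, of k k]
        by (simp only: Re_hform_self) (simp add: hform_def apply_left_simps cinner_self norm_mult norm_power power2_eq_square mult_ac)
      then show ?thesis using False by simp
    qed (simp add: apply_simps)
  qed
next
  assume a: "\<forall>k. s * (norm k)\<^sup>2 \<le> (norm k)\<^sup>2 - (norm (x *\<^sub>V k))\<^sup>2"
  show "hyp_near s x 0"
    unfolding hyp_near_def
  proof (intro allI)
    fix k v :: 'a
    have eq: "hform x 0 k v = cinner k v" by (simp add: hform_def apply_left_simps)
    have cs: "(cmod (cinner k v))\<^sup>2 \<le> (norm k)\<^sup>2 * (norm v)\<^sup>2"
      using power_mono[OF cinner_Cauchy_Schwarz[of k v], of 2] by (simp add: power_mult_distrib)
    show "s * (cmod (hform x 0 k v))\<^sup>2 \<le> Re (hform x x k k) * Re (hform 0 0 v v)"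
    proof -
      have "s * (cmod (cinner k v))\<^sup>2 \<le> s * ((norm k)\<^sup>2 * (norm v)\<^sup>2)"
        using cs assms by (rule mult_left_mono)
      also have "\<dots> \<le> ((norm k)\<^sup>2 - (norm (x *\<^sub>V k))\<^sup>2) * (norm v)\<^sup>2"
        using mult_right_mono[OF a[rule_format, of k], of "(norm v)\<^sup>2"] by (simp add: mult.assoc)
      finally show ?thesis by (simp add: eq Re_hform_self apply_left_simps)
    qed
  qed
qed

text \<open>For an operator \<open>t\<close> with adjoint \<open>ts\<close>, the maps \<open>d\<close> and \<open>c\<close> are the square roots of
  \<open>1 + ts t\<close> and \<open>1 + t ts\<close>.  The block matrix \<open>((d, ts), (t, c))\<close> preserves the indefinite form,
  so its graph transform \<open>x \<mapsto> (d x + ts) (t x + c)\<^sup>-\<^sup>1\<close>, called \<open>mob\<close>, acts on the unit ball.\<close>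

locale mobius =
  fixes t :: "'h::complex_hilbert \<Rightarrow> 'k::complex_hilbert" and ts :: "'k \<Rightarrow> 'h"
    and d :: "'h \<Rightarrow> 'h" and c :: "'k \<Rightarrow> 'k"
  assumes fin: "finite_cdim (UNIV :: 'k set)"
    and t: "bounded_clinear t" and adj: "adjoint_pair t ts"
    and d: "coercive d" and c: "coercive c"
    and dd: "\<And>x. d (d x) = x + ts (t x)" and cc: "\<And>k. c (c k) = k + t (ts k)"
begin

lemma ts: "bounded_clinear ts"
  by (rule adjoint_pair_bounded_clinear[OF t adj])

lemmas dl = coercive_bounded_clinear[OF d]
lemmas cl = coercive_bounded_clinear[OF c]

lemmas lin_simps = bounded_clinear_simps[OF t] bounded_clinear_simps[OF ts]
  bounded_clinear_simps[OF dl] bounded_clinear_simps[OF cl]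

text \<open>By \<open>dd\<close> and \<open>cc\<close> both \<open>d\<^sup>2 ts\<close> and
  \<open>ts c\<^sup>2\<close> equal \<open>ts + ts t ts\<close>, so \<open>X = d ts - ts c\<close>
  solves the Sylvester equation \<open>d X + X c = 0\<close>.\<close>

lemma d_ts: "d (ts k) = ts (c k)"
proof -
  have "d (ts k) - ts (c k) = 0"
    by (rule coercive_Sylvester_zero[OF d cl coercive_positive[OF c],
          of "\<lambda>k. d (ts k) - ts (c k)"])
      (auto simp: dd cc lin_simps intro!: bounded_clinear_sub bounded_clinear_compose[OF dl ts]
        bounded_clinear_compose[OF ts cl])
  then show ?thesis by simp
qed

lemma c_t: "c (t x) = t (d x)"
  by (rule cinner_ext)
    (simp add: adjoint_pairD[OF adj] adjoint_pairD[OF coercive_adjoint[OF c]]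
      adjoint_pairD[OF coercive_adjoint[OF d]] d_ts)

lemma block_isometry:
  "cinner (t h + c k) (t h' + c k') - cinner (d h + ts k) (d h' + ts k') = cinner k k' - cinner h h'"
proof -
  have 1: "cinner (d h) (d h') = cinner h h' + cinner (t h) (t h')"
    by (simp add: adjoint_pairD[OF coercive_adjoint[OF d]] dd cinner_add_right adjoint_pairD[OF adj])
  have 2: "cinner (c k) (c k') = cinner k k' + cinner (ts k) (ts k')"
    by (simp add: adjoint_pairD[OF coercive_adjoint[OF c]] cc cinner_add_right adjoint_pairD'[OF adj])
  have 3: "cinner (t h) (c k') = cinner (d h) (ts k')"
    by (simp add: adjoint_pairD[OF coercive_adjoint[OF d]] d_ts adjoint_pairD[OF adj])
  have 4: "cinner (c k) (t h') = cinner (ts k) (d h')"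
    by (metis 3 adj adjoint_pairD' coercive_adjoint c_t c d)
  show ?thesis by (simp add: cinner_add_left cinner_add_right 1 2 3 4)
qed

text \<open>The block matrix sends the graph point \<open>(x k, k)\<close> to
  \<open>(num x k, den x k)\<close>.\<close>

definition num :: "('k, 'h) cblinfun \<Rightarrow> 'k \<Rightarrow> 'h" where
  "num x k = d (x *\<^sub>V k) + ts k"

definition den :: "('k, 'h) cblinfun \<Rightarrow> 'k \<Rightarrow> 'k" where
  "den x k = t (x *\<^sub>V k) + c k"

lemma num: "bounded_clinear (num x)" and den: "bounded_clinear (den x)"
  unfolding num_def den_def
  by (intro bounded_clinear_plus bounded_clinear_compose[OF dl] bounded_clinear_compose[OF t]
      bounded_clinear_apply ts cl)+

lemma form_num_den: "cinner (den x k) (den y v) - cinner (num x k) (num y v) = hform x y k v"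
  unfolding num_def den_def hform_def by (rule block_isometry)

lemma norm_num_den: "(norm (den x k))\<^sup>2 - (norm (num x k))\<^sup>2 = Re (hform x x k k)"
  using arg_cong[OF form_num_den[of x k x k], of Re] by (simp add: Re_cinner_self)

lemma den_lower: "(1 - (norm x)\<^sup>2) * (norm k)\<^sup>2 \<le> (norm (den x k))\<^sup>2"
  using Re_hform_lower[of x k] norm_num_den[of x k] zero_le_power2[of "norm (num x k)"] by linarith

lemma den_lower':
  assumes "norm x < 1"
  shows "norm k \<le> norm (den x k) / sqrt (1 - (norm x)\<^sup>2)"
proof -
  have "0 < 1 - (norm x)\<^sup>2" using assms by (simp add: power_less_one_iff)
  moreover have "(sqrt (1 - (norm x)\<^sup>2) * norm k)\<^sup>2 \<le> (norm (den x k))\<^sup>2"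
    using den_lower[of x k] calculation by (simp add: power_mult_distrib)
  then have "sqrt (1 - (norm x)\<^sup>2) * norm k \<le> norm (den x k)" by (rule power2_le_imp_le) simp
  ultimately show ?thesis by (simp add: pos_le_divide_eq mult.commute)
qed

lemma bij_den:
  assumes "norm x < 1"
  shows "bij (den x)"
proof -
  have "inj (den x)"
  proof (rule injI)
    fix k k' assume "den x k = den x k'"
    then show "k = k'"
      using den_lower'[OF assms, of "k - k'"] by (simp add: bounded_clinear_simps[OF den])
  qed
  moreover from this have "surj (den x)" by (rule bounded_clinear_inj_imp_surj[OF fin den])
  ultimately show ?thesis by (simp add: bij_def)
qed

definition mob :: "('k, 'h) cblinfun \<Rightarrow> ('k, 'h) cblinfun" where
  "mob x = cblinfun_of (\<lambda>k. num x (inv_into UNIV (den x) k))"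

lemma inv_den: "norm x < 1 \<Longrightarrow> inv_into UNIV (den x) (den x k) = k"
  using bij_den by (simp add: bij_def)

lemma den_inv: "norm x < 1 \<Longrightarrow> den x (inv_into UNIV (den x) k) = k"
  using bij_den by (simp add: bij_def surj_f_inv_f)

lemma inv_den_bounded_clinear:
  assumes "norm x < 1"
  shows "bounded_clinear (inv_into UNIV (den x))"
proof (rule bounded_clinearI[where B = "1 / sqrt (1 - (norm x)\<^sup>2)"])
  have inj: "den x a = den x b \<Longrightarrow> a = b" for a b by (metis assms inv_den)
  show "inv_into UNIV (den x) (a + b) = inv_into UNIV (den x) a + inv_into UNIV (den x) b" for a b
    by (rule inj) (simp add: bounded_clinear_simps[OF den] den_inv[OF assms])
  show "inv_into UNIV (den x) (r *\<^sub>C a) = r *\<^sub>C inv_into UNIV (den x) a" for r a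
    by (rule inj) (simp add: bounded_clinear_simps[OF den] den_inv[OF assms])
  show "norm (inv_into UNIV (den x) a) \<le> norm a * (1 / sqrt (1 - (norm x)\<^sup>2))" for a
    using den_lower'[OF assms, of "inv_into UNIV (den x) a"] by (simp add: den_inv[OF assms])
qed

lemma mob_den:
  assumes "norm x < 1"
  shows "mob x *\<^sub>V den x k = num x k"
  unfolding mob_def
  by (subst apply_cblinfun_of)
    (simp_all add: inv_den assms bounded_clinear_compose[OF num inv_den_bounded_clinear])

lemma mob_eqI:
  assumes "norm x < 1" "\<And>k. z *\<^sub>V den x k = num x k"
  shows "mob x = z"
proof (rule cblinfun_eqI)
  fix k
  show "mob x *\<^sub>V k = z *\<^sub>V k"
    using mob_den[OF assms(1), of "inv_into UNIV (den x) k"] assms(2)[of "inv_into UNIV (den x) k"]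
    by (simp add: den_inv[OF assms(1)])
qed

text \<open>For \<open>k' = den x k\<close> the form gives \<open>(norm k')\<^sup>2 - (norm (mob x
  k'))\<^sup>2 \<ge> (1 - (norm x)\<^sup>2) (norm k)\<^sup>2\<close>; an upper bound for
  \<open>den x\<close> turns this into a uniform gap, hence strictness.\<close>

lemma norm_mob:
  assumes "norm x < 1"
  shows "norm (mob x) < 1"
proof -
  obtain B0 where B0: "B0 > 0" "\<And>k. norm (den x k) \<le> B0 * norm k"
    using bounded_clinear_bound[OF den] by blast
  \<comment> \<open>The maximum with 1 ensures \<open>e \<le> 1\<close>, so that
    \<open>sqrt (1 - e)\<close> is a valid bound.\<close>
  define B where "B = max B0 1"
  have "B0 * norm k \<le> B * norm k" for k by (intro mult_right_mono) (auto simp: B_def)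
  then have B: "B \<ge> 1" "\<And>k. norm (den x k) \<le> B * norm k"
    by (auto simp: B_def intro: order_trans[OF B0(2)])
  define e where "e = (1 - (norm x)\<^sup>2) / B\<^sup>2"
  have x: "(norm x)\<^sup>2 < 1" using assms by (simp add: power_less_one_iff)
  have B2: "B\<^sup>2 \<ge> 1" using B(1) by simp
  have "1 - (norm x)\<^sup>2 \<le> B\<^sup>2" using B2 zero_le_power2[of "norm x"] by linarith
  then have e: "0 < e" "e \<le> 1" using x B2 by (auto simp: e_def divide_le_eq intro!: divide_pos_pos)
  have "norm (mob x) \<le> sqrt (1 - e)"
  proof (rule norm_apply_bound)
    show "0 \<le> sqrt (1 - e)" using e by simp
    fix k'
    define k where "k = inv_into UNIV (den x) k'"
    have k': "k' = den x k" by (simp add: k_def den_inv[OF assms])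
    have "e * (norm k')\<^sup>2 \<le> e * (B * norm k)\<^sup>2"
      using B(2)[of k] e unfolding k' by (intro mult_left_mono power_mono) auto
    also have "\<dots> = (1 - (norm x)\<^sup>2) * (norm k)\<^sup>2"
      using B(1) by (simp add: e_def power_mult_distrib)
    also have "\<dots> \<le> (norm k')\<^sup>2 - (norm (num x k))\<^sup>2"
      unfolding k' norm_num_den by (rule Re_hform_lower)
    finally have "(norm (mob x *\<^sub>V k'))\<^sup>2 \<le> (sqrt (1 - e) * norm k')\<^sup>2"
      using e unfolding k' mob_den[OF assms] by (simp add: power_mult_distrib algebra_simps)
    then show "norm (mob x *\<^sub>V k') \<le> sqrt (1 - e) * norm k'"
      by (rule power2_le_imp_le) (use e in simp)
  qed
  also have "\<dots> < 1" using e by simp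
  finally show ?thesis .
qed

lemma hform_mob:
  assumes "norm x < 1" "norm y < 1"
  shows "hform (mob x) (mob y) (den x k) (den y v) = hform x y k v"
  using form_num_den[of x k y v] by (simp add: hform_def[of "mob x"] mob_den assms)

text \<open>By \<open>hform_mob\<close> the forms change only by the bijective substitutions
  \<open>den x\<close> and \<open>den y\<close>, and \<open>hyp_near\<close> quantifies over all
  \<open>k\<close> and \<open>v\<close>.\<close>

lemma hyp_near_mob:
  assumes "norm x < 1" "norm y < 1"
  shows "hyp_near s (mob x) (mob y) \<longleftrightarrow> hyp_near s x y"
  unfolding hyp_near_def
  by (metis hform_mob[OF assms] hform_mob[OF assms(1) assms(1)] hform_mob[OF assms(2) assms(2)]
      den_inv[OF assms(1)] den_inv[OF assms(2)])

text \<open>Changing the signs of \<open>t\<close> and \<open>ts\<close> inverts the block matrix,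
  by \<open>dd\<close>, \<open>cc\<close>, \<open>d_ts\<close> and \<open>c_t\<close>. This instance
  therefore supplies the inverse Moebius map.\<close>

lemma mobius_neg: "mobius (\<lambda>x. - t x) (\<lambda>k. - ts k) d c"
  using fin t adj d c dd cc
  by unfold_locales (auto simp: bounded_clinear_uminus adjoint_pair_def cinner_simps lin_simps)

end

lemma (in mobius) mob_neg_mob:
  assumes "norm x < 1"
  shows "mobius.mob (\<lambda>x. - t x) (\<lambda>k. - ts k) d c (mob x) = x"
proof -
  interpret neg: mobius "\<lambda>x. - t x" "\<lambda>k. - ts k" d c by (rule mobius_neg)
  show ?thesis
  proof (rule neg.mob_eqI[OF norm_mob[OF assms]])
    fix k'
    define k where "k = inv_into UNIV (den x) k'"
    have k': "k' = den x k" by (simp add: k_def den_inv[OF assms])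
    have 1: "neg.den (mob x) k' = k"
      unfolding neg.den_def k' mob_den[OF assms]
      by (simp add: num_def den_def lin_simps cc c_t)
    have 2: "neg.num (mob x) k' = x *\<^sub>V k"
      unfolding neg.num_def k' mob_den[OF assms]
      by (simp add: num_def den_def lin_simps dd d_ts)
    show "x *\<^sub>V neg.den (mob x) k' = neg.num (mob x) k'" by (simp add: 1 2)
  qed
qed

lemma (in mobius) mob_mob_neg:
  assumes "norm x < 1"
  shows "mob (mobius.mob (\<lambda>x. - t x) (\<lambda>k. - ts k) d c x) = x"
proof -
  interpret neg: mobius "\<lambda>x. - t x" "\<lambda>k. - ts k" d c by (rule mobius_neg)
  show ?thesis using neg.mob_neg_mob[OF assms] by simp
qed

text \<open>Differentiating \<open>mob x (den x k) = num x k\<close> in \<open>x\<close> along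
  \<open>v\<close> gives \<open>D v (den x k) = d (v k) - mob x (t (v k))\<close>, which is
  \<open>E v k\<close>; this determines the derivative \<open>D\<close>.\<close>

lemma (in mobius) mob_holomorphic: "cholomorphic_on mob (ball 0 1)"
  unfolding cholomorphic_on_def
proof
  fix x :: "('k, 'h) cblinfun"
  assume "x \<in> ball 0 1"
  then have x: "norm x < 1" by simp
  define E where "E = (\<lambda>(v :: ('k, 'h) cblinfun) k. d (v *\<^sub>V k) - mob x *\<^sub>V t (v *\<^sub>V k))"
  obtain Bd where Bd: "Bd > 0" "\<And>h. norm (d h) \<le> Bd * norm h" using bounded_clinear_bound[OF dl] by blast
  obtain Bt where Bt: "Bt > 0" "\<And>h. norm (t h) \<le> Bt * norm h" using bounded_clinear_bound[OF t] by blast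
  have E: "bounded_clinear (E v)" for v
    unfolding E_def
    by (intro bounded_clinear_sub bounded_clinear_compose[OF dl] bounded_clinear_apply
        bounded_clinear_compose[OF bounded_clinear_apply] bounded_clinear_compose[OF t])
  have En: "norm (E v k) \<le> (Bd + Bt) * norm v * norm k" for v k
  proof -
    have "norm (E v k) \<le> norm (d (v *\<^sub>V k)) + norm (mob x *\<^sub>V t (v *\<^sub>V k))"
      unfolding E_def by (rule norm_triangle_ineq4)
    also have "norm (mob x *\<^sub>V t (v *\<^sub>V k)) \<le> 1 * norm (t (v *\<^sub>V k))"
      using norm_mob[OF x] by (intro order_trans[OF norm_apply] mult_right_mono) auto
    also have "norm (d (v *\<^sub>V k)) + 1 * norm (t (v *\<^sub>V k)) \<le> Bd * norm (v *\<^sub>V k) + Bt * norm (v *\<^sub>V k)"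
      using Bd(2)[of "v *\<^sub>V k"] Bt(2)[of "v *\<^sub>V k"] by simp
    also have "\<dots> = (Bd + Bt) * norm (v *\<^sub>V k)" by (simp add: algebra_simps)
    also have "\<dots> \<le> (Bd + Bt) * (norm v * norm k)"
      using Bd(1) Bt(1) norm_apply by (intro mult_left_mono) auto
    finally show ?thesis by simp
  qed
  define D where "D = (\<lambda>v. cblinfun_of (\<lambda>k. E v (inv_into UNIV (den x) k)))"
  have D: "D v *\<^sub>V k = E v (inv_into UNIV (den x) k)" for v k
    unfolding D_def by (rule apply_cblinfun_of) (rule bounded_clinear_compose[OF E inv_den_bounded_clinear[OF x]])
  define q where "q = (Bd + Bt) / sqrt (1 - (norm x)\<^sup>2)"
  have x2: "1 - (norm x)\<^sup>2 > 0" using x by (simp add: power_less_one_iff)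
  have q: "q > 0" using Bd(1) Bt(1) x2 by (simp add: q_def)
  have Dn: "norm (D v) \<le> q * norm v" for v
  proof (rule norm_apply_bound)
    fix k
    have "norm (D v *\<^sub>V k) \<le> (Bd + Bt) * norm v * norm (inv_into UNIV (den x) k)" unfolding D by (rule En)
    also have "\<dots> \<le> (Bd + Bt) * norm v * (norm k / sqrt (1 - (norm x)\<^sup>2))"
      using den_lower'[OF x, of "inv_into UNIV (den x) k"] Bd(1) Bt(1)
      by (intro mult_left_mono) (auto simp: den_inv[OF x])
    finally show "norm (D v *\<^sub>V k) \<le> q * norm v * norm k" by (simp add: q_def)
  qed (use q in simp)
  have Dc: "bounded_clinear D"
    by (rule bounded_clinearI[where B = q])
      (auto intro!: cblinfun_eqI simp: D E_def apply_left_simps lin_simps apply_simps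
        complex_vector.scale_right_diff_distrib Dn[unfolded mult.commute[of q]])
  \<comment> \<open>A radius strictly between \<open>norm x\<close> and 1: for all \<open>w\<close>
    in this ball \<open>den w\<close> has the common lower bound
    \<open>sqrt (1 - r\<^sup>2)\<close>.\<close>
  define r where "r = (1 + norm x) / 2"
  have r: "norm x < r" "0 < r" "r < 1" using x by (auto simp: r_def add_pos_nonneg)
  have r2: "1 - r\<^sup>2 > 0" using r by (simp add: power_less_one_iff)
  have "(mob has_derivative D) (at x)"
  proof (rule has_derivativeI_sandwich[where e = "r - norm x"])
    show "0 < r - norm x" using r by simp
    show "bounded_linear D" by (rule bounded_clinear_imp_bounded_linear[OF Dc])
    show "((\<lambda>w. q * Bt / sqrt (1 - r\<^sup>2) * norm (w - x)) \<longlongrightarrow> 0) (at x)"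
      using r2 by (auto intro!: tendsto_eq_intros)
    fix w assume w: "w \<noteq> x" "dist w x < r - norm x"
    have wr: "norm w < r" using w(2) norm_triangle_sub[of w x] by (simp add: dist_norm)
    then have w1: "norm w < 1" using r by simp
    have "norm (mob w - mob x - D (w - x)) \<le> q * Bt / sqrt (1 - r\<^sup>2) * norm (w - x) * norm (w - x)"
    proof (rule norm_apply_bound)
      fix k'
      define k where "k = inv_into UNIV (den w) k'"
      define v where "v = w - x"
      have k': "k' = den w k" by (simp add: k_def den_inv[OF w1])
      have wx: "w *\<^sub>V k = x *\<^sub>V k + v *\<^sub>V k" by (simp add: v_def apply_left_simps)
      have dw: "den w k = den x k + t (v *\<^sub>V k)" and nw: "num w k = num x k + d (v *\<^sub>V k)"
        unfolding den_def num_def wx by (simp_all add: lin_simps)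
      have "mob x *\<^sub>V k' = num x k + mob x *\<^sub>V t (v *\<^sub>V k)"
        unfolding k' dw by (simp add: apply_simps mob_den[OF x])
      moreover have "D v *\<^sub>V k' = E v k + D v *\<^sub>V t (v *\<^sub>V k)"
        unfolding k' dw by (simp add: apply_simps) (simp add: D inv_den[OF x])
      moreover have "mob w *\<^sub>V k' = num x k + d (v *\<^sub>V k)" unfolding k' mob_den[OF w1] nw ..
      \<comment> \<open>The remainder is exact and contains \<open>v\<close> twice, hence is of
        second order.\<close>
      ultimately have "(mob w - mob x - D (w - x)) *\<^sub>V k' = - (D v *\<^sub>V t (v *\<^sub>V k))"
        by (simp add: apply_left_simps v_def[symmetric] E_def)
      then have "norm ((mob w - mob x - D (w - x)) *\<^sub>V k') = norm (D v *\<^sub>V t (v *\<^sub>V k))" by simp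
      also have "\<dots> \<le> norm (D v) * norm (t (v *\<^sub>V k))" by (rule norm_apply)
      also have "\<dots> \<le> (q * norm v) * (Bt * (norm v * norm k))"
      proof (rule mult_mono)
        show "norm (t (v *\<^sub>V k)) \<le> Bt * (norm v * norm k)"
          using Bt(1) by (intro order_trans[OF Bt(2)] mult_left_mono norm_apply) auto
      qed (use Dn q in auto)
      also have "\<dots> \<le> (q * norm v) * (Bt * (norm v * (norm k' / sqrt (1 - r\<^sup>2))))"
      proof -
        have "sqrt (1 - r\<^sup>2) \<le> sqrt (1 - (norm w)\<^sup>2)" using wr r(2) by (simp add: power_mono)
        then have "norm k \<le> norm k' / sqrt (1 - r\<^sup>2)" unfolding k' using r2
          by (intro order_trans[OF den_lower'[OF w1]] divide_left_mono) (auto intro!: mult_pos_pos)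
        then show ?thesis using q Bt(1) by (intro mult_left_mono) auto
      qed
      finally show "norm ((mob w - mob x - D (w - x)) *\<^sub>V k')
          \<le> q * Bt / sqrt (1 - r\<^sup>2) * norm (w - x) * norm (w - x) * norm k'"
        by (simp add: v_def mult_ac)
    qed (use q Bt r2 in simp)
    then show "norm (mob w - mob x - D (w - x)) / norm (w - x) \<le> q * Bt / sqrt (1 - r\<^sup>2) * norm (w - x)"
      using w(1) by (simp add: pos_divide_le_eq)
  qed
  then show "\<exists>D. (mob has_derivative D) (at x) \<and> (\<forall>c v. D (c *\<^sub>C v) = c *\<^sub>C D v)"
    using bounded_clinear_scaleC[OF Dc] by blast
qed


section \<open>The Schwarz lemma in operator balls\<close>

lemma cholomorphic_on_compose:
  assumes "cholomorphic_on f U" "cholomorphic_on g V" "\<And>x. x \<in> U \<Longrightarrow> f x \<in> V"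
  shows "cholomorphic_on (\<lambda>x. g (f x)) U"
  unfolding cholomorphic_on_def
proof
  fix x assume x: "x \<in> U"
  obtain D E where D: "(f has_derivative D) (at x)" "\<And>c v. D (c *\<^sub>C v) = c *\<^sub>C D v"
    and E: "(g has_derivative E) (at (f x))" "\<And>c v. E (c *\<^sub>C v) = c *\<^sub>C E v"
    using assms x unfolding cholomorphic_on_def by metis
  show "\<exists>D. ((\<lambda>x. g (f x)) has_derivative D) (at x) \<and> (\<forall>c v. D (c *\<^sub>C v) = c *\<^sub>C D v)"
    using diff_chain_at[OF D(1) E(1)] D(2) E(2) by (auto simp: o_def intro!: exI[of _ "\<lambda>v. E (D v)"])
qed

lemma bounded_linear_apply_cinner: "bounded_linear (\<lambda>A. cinner (A *\<^sub>V k) h)"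
  by (rule bounded_linear_intro[where K = "norm k * norm h"])
    (auto simp: apply_left_simps cinner_simps scaleR_conv_of_real mult.assoc[symmetric]
      intro!: order_trans[OF cinner_Cauchy_Schwarz] mult_right_mono norm_apply)

text \<open>The classical Schwarz lemma on the disc through 0 and \<open>z\<close>, applied to every
  matrix coefficient \<open>\<langle>\<phi> (l u) k, h\<rangle>\<close> with \<open>k\<close>,
  \<open>h\<close> in the unit balls; the norm is the supremum of these coefficients.\<close>

lemma cball_Schwarz:
  fixes \<phi> :: "('k::complex_hilbert, 'h::complex_hilbert) cblinfun \<Rightarrow> ('k, 'h) cblinfun"
  assumes hol: "cholomorphic_on \<phi> (ball 0 1)" and into: "\<And>z. norm z < 1 \<Longrightarrow> norm (\<phi> z) < 1"
    and zero: "\<phi> 0 = 0" and z: "norm z < 1"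
  shows "norm (\<phi> z) \<le> norm z"
proof (cases "z = 0")
  case True
  then show ?thesis by (simp add: zero)
next
  case False
  define u where "u = complex_of_real (1 / norm z) *\<^sub>C z"
  have u: "norm u = 1" using False by (simp add: u_def norm_scaleC norm_divide)
  have zu: "complex_of_real (norm z) *\<^sub>C u = z"
    using False by (simp add: u_def scaleC_scaleC scaleC_one)
  have key: "cmod (cinner (\<phi> z *\<^sub>V k) h) \<le> norm z" if k: "norm k \<le> 1" and h: "norm h \<le> 1" for k h
  proof -
    define f where "f = (\<lambda>l. cinner (\<phi> (l *\<^sub>C u) *\<^sub>V k) h)"
    have "f holomorphic_on ball 0 1"
      unfolding holomorphic_on_def field_differentiable_def
    proof
      fix l :: complex assume "l \<in> ball 0 1"
      then have l: "l *\<^sub>C u \<in> ball 0 1" by (simp add: norm_scaleC u)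
      then obtain D where D: "(\<phi> has_derivative D) (at (l *\<^sub>C u))" "\<And>c v. D (c *\<^sub>C v) = c *\<^sub>C D v"
        using hol unfolding cholomorphic_on_def by blast
      have bl: "bounded_linear (\<lambda>l. l *\<^sub>C u)"
      proof (rule bounded_linear_intro[where K = "norm u"])
        show "(r *\<^sub>R c) *\<^sub>C u = r *\<^sub>R c *\<^sub>C u" for r c
          by (simp only: scaleR_conv_of_real scaleC_of_real[symmetric] scaleC_scaleC)
      qed (auto simp: scaleC_add_left norm_scaleC)
      have "((\<lambda>l. \<phi> (l *\<^sub>C u)) has_derivative (\<lambda>v. D (v *\<^sub>C u))) (at l)"
        using diff_chain_at[OF bounded_linear_imp_has_derivative[OF bl] D(1)] by (simp add: o_def)
      from bounded_linear.has_derivative[OF bounded_linear_apply_cinner this, of k h]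
      have "(f has_derivative (\<lambda>v. v * cinner (D u *\<^sub>V k) h)) (at l)"
        by (simp add: f_def D(2) apply_left_simps cinner_simps)
      then have "(f has_field_derivative cinner (D u *\<^sub>V k) h) (at l)"
        by (simp add: has_field_derivative_def mult_commute_abs)
      then show "\<exists>f'. (f has_field_derivative f') (at l within ball 0 1)"
        using has_field_derivative_at_within by blast
    qed
    moreover have "f 0 = 0" by (simp add: f_def zero apply_left_simps)
    moreover have "norm (f l) < 1" if "norm l < 1" for l
    proof -
      have "norm (f l) \<le> norm (\<phi> (l *\<^sub>C u) *\<^sub>V k) * norm h"
        unfolding f_def by (rule cinner_Cauchy_Schwarz)
      also have "\<dots> \<le> norm (\<phi> (l *\<^sub>C u) *\<^sub>V k) * 1" using h by (intro mult_left_mono) auto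
      also have "\<dots> \<le> norm (\<phi> (l *\<^sub>C u)) * norm k" using norm_apply by simp
      also have "\<dots> \<le> norm (\<phi> (l *\<^sub>C u)) * 1" using k by (intro mult_left_mono) auto
      also have "\<dots> < 1" using into[of "l *\<^sub>C u"] that by (simp add: norm_scaleC u)
      finally show ?thesis .
    qed
    ultimately have "norm (f (of_real (norm z))) \<le> norm (complex_of_real (norm z))"
      by (rule Schwarz_Lemma(1)) (use z in \<open>simp_all only: norm_of_real abs_norm_cancel\<close>)
    then show ?thesis by (simp add: f_def zu)
  qed
  show ?thesis
  proof (rule norm_apply_bound)
    fix k
    show "norm (\<phi> z *\<^sub>V k) \<le> norm z * norm k"
    proof (cases "k = 0")
      case False
      define k1 where "k1 = (1 / norm k) *\<^sub>R k"
      have "norm (\<phi> z *\<^sub>V k1) \<le> norm z"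
        by (rule norm_le_if_cinner_le, rule key) (use False in \<open>auto simp: k1_def\<close>)
      then show ?thesis using False by (simp add: k1_def apply_simps pos_divide_le_eq)
    qed (simp add: apply_simps)
  qed simp
qed


section \<open>Parametrisation of the ball by closed operators\<close>

lemma coercive_one_plus:
  assumes "bounded_clinear t" "adjoint_pair t ts"
  shows "coercive (\<lambda>x. x + ts (t x))"
proof -
  note ts = adjoint_pair_bounded_clinear[OF assms]
  have "adjoint_pair (\<lambda>x. x + ts (t x)) (\<lambda>x. x + ts (t x))"
    by (simp add: adjoint_pair_def cinner_add_left cinner_add_right
        adjoint_pairD'[OF assms(2)] adjoint_pairD[OF assms(2), symmetric])
  moreover have "1 * (norm x)\<^sup>2 \<le> Re (cinner (x + ts (t x)) x)" for x
    by (simp add: cinner_add_left adjoint_pairD'[OF assms(2)] Re_cinner_self)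
  moreover have "bounded_clinear (\<lambda>x. x + ts (t x))"
    by (intro bounded_clinear_plus bounded_clinear_id bounded_clinear_compose[OF ts assms(1)])
  ultimately show ?thesis unfolding coercive_def using zero_less_one by blast
qed

lemma closed_op_mobius:
  fixes X :: "('h::complex_hilbert, 'k::complex_hilbert) closed_op"
  assumes "finite_cdim (UNIV :: 'k set)"
  obtains t ts d c where "mobius t ts d c" "graph X = graph_of t"
proof -
  have "linear_operator (graph X)" "closed (graph X)" "densely_defined (graph X)"
    using graph[of X] by auto
  from closed_op_bounded[OF assms this] obtain t where t: "bounded_clinear t" "graph X = graph_of t" .
  obtain ts where ts: "adjoint_pair t ts" "bounded_clinear ts" using adjoint_exists[OF t(1)] .
  obtain d where d: "coercive d" "\<And>x. d (d x) = x + ts (t x)"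
    using coercive_sqrt_exists[OF coercive_one_plus[OF t(1) ts(1)]] by blast
  obtain c where c: "coercive c" "\<And>k. c (c k) = k + t (ts k)"
    using coercive_sqrt_exists[OF coercive_one_plus[OF ts(2) adjoint_pair_sym[OF ts(1)]]] by blast
  have "mobius t ts d c" by unfold_locales fact+
  then show thesis using t(2) that by blast
qed

lemma bounded_operator_eqI:
  assumes "\<And>x y. (x, y) \<in> T \<Longrightarrow> A *\<^sub>V x = y" "\<And>x. x \<in> Domain T"
  shows "bounded_operator T = A"
  unfolding bounded_operator_def
proof (rule the_equality)
  show "\<forall>(x, y)\<in>T. A *\<^sub>V x = y" using assms(1) by blast
  fix B assume B: "\<forall>(x, y)\<in>T. B *\<^sub>V x = y"
  show "B = A"
  proof (rule cblinfun_eqI)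
    fix x
    obtain y where "(x, y) \<in> T" using assms(2)[of x] by blast
    then show "B *\<^sub>V x = A *\<^sub>V x" using B assms(1) by auto
  qed
qed

context mobius
begin

lemma op_sqrt_d: "op_sqrt (graph_of (\<lambda>x. x + ts (t x))) = graph_of d"
  by (rule op_sqrt_graph_of[OF d dd])

lemma op_sqrt_c: "op_sqrt (graph_of (\<lambda>k. k + t (ts k))) = graph_of c"
  by (rule op_sqrt_graph_of[OF c cc])

lemma den_zero: "den 0 = c" and num_zero: "num 0 = ts"
  by (auto simp: den_def num_def apply_left_simps lin_simps)

lemma bij_c: "bij c"
  using bij_den[of 0] by (simp add: den_zero)

lemma mob_zero: "mob 0 *\<^sub>V c k = ts k"
  using mob_den[of 0 k] by (simp add: den_zero num_zero)

lemma d_mob_zero: "d (mob 0 *\<^sub>V k) = ts k"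
proof -
  obtain k' where k': "k = c k'" using bij_c by (metis bij_pointE)
  show ?thesis unfolding k' mob_zero by (rule d_ts)
qed

text \<open>By \<open>d_ts\<close> the operators \<open>d\<^sup>-\<^sup>1 ts\<close> and
  \<open>ts c\<^sup>-\<^sup>1\<close> agree, and the second is the image of the origin. So
  \<open>mob\<close> is a Moebius map carrying 0 to \<open>hat X\<close>.\<close>

lemma hat_eq_mob_zero:
  assumes "graph X = graph_of t"
  shows "hat X = mob 0"
  unfolding hat_def assms adj_graph_of[OF adj] graph_of_comp Id_add_graph_of op_sqrt_d
proof (rule bounded_operator_eqI)
  fix k x assume "(k, x) \<in> (graph_of d)\<inverse> \<circ>\<^sub>o graph_of ts"
  then have "d x = ts k" by (auto simp: graph_of_def)
  then have "d x = d (mob 0 *\<^sub>V k)" by (simp add: d_mob_zero)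
  then show "mob 0 *\<^sub>V k = x" using coercive_inj[OF d] by (simp add: inj_eq)
next
  fix k
  have "(k, mob 0 *\<^sub>V k) \<in> (graph_of d)\<inverse> \<circ>\<^sub>o graph_of ts"
    by (auto simp: d_mob_zero intro!: relcompI[of k "ts k"])
  then show "k \<in> Domain ((graph_of d)\<inverse> \<circ>\<^sub>o graph_of ts)" by blast
qed

end

section \<open>Range, surjectivity and injectivity of \<open>hat\<close>\<close>

lemma norm_hat:
  fixes X :: "('h::complex_hilbert, 'k::complex_hilbert) closed_op"
  assumes "finite_cdim (UNIV :: 'k set)"
  shows "norm (hat X) < 1"
proof -
  obtain t ts d c where m: "mobius t ts d c" "graph X = graph_of t" using closed_op_mobius[OF assms] .
  interpret mobius t ts d c by (rule m(1))
  show ?thesis using norm_mob[of 0] by (simp add: hat_eq_mob_zero[OF m(2)])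
qed

lemma coercive_inverse:
  fixes w :: "'k::complex_hilbert \<Rightarrow> 'k"
  assumes fin: "finite_cdim (UNIV :: 'k set)" and w: "coercive w"
  obtains v where "coercive v" "\<And>k. w (v k) = k" "\<And>k. v (w k) = k"
proof -
  note wl = coercive_bounded_clinear[OF w]
  have inj: "inj w" by (rule coercive_inj[OF w])
  have surj: "surj w" by (rule bounded_clinear_inj_imp_surj[OF fin wl inj])
  define v where "v = inv_into UNIV w"
  have wv: "w (v k) = k" for k by (simp add: v_def surj surj_f_inv_f)
  have vw: "v (w k) = k" for k by (simp add: v_def inj)
  obtain e where e: "e > 0" "\<And>x. e * norm x \<le> norm (w x)" using coercive_norm_lower[OF w] by blast
  obtain c where c: "c > 0" "\<And>x. c * (norm x)\<^sup>2 \<le> Re (cinner (w x) x)"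
    using w unfolding coercive_def by blast
  obtain B where B: "B > 0" "\<And>x. norm (w x) \<le> B * norm x" using bounded_clinear_bound[OF wl] by blast
  have eqI: "w a = w b \<Longrightarrow> a = b" for a b using inj by (simp add: inj_eq)
  have bv: "bounded_clinear v"
  proof (rule bounded_clinearI[where B = "1 / e"])
    show "v (x + y) = v x + v y" for x y by (rule eqI) (simp add: wv bounded_clinear_simps[OF wl])
    show "v (a *\<^sub>C x) = a *\<^sub>C v x" for a x by (rule eqI) (simp add: wv bounded_clinear_simps[OF wl])
    show "norm (v x) \<le> norm x * (1 / e)" for x
      using e(2)[of "v x"] e(1) by (simp add: wv pos_le_divide_eq mult.commute)
  qed
  have av: "adjoint_pair v v"
    unfolding adjoint_pair_def using adjoint_pairD[OF coercive_adjoint[OF w]] by (metis wv)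
  \<comment> \<open>For \<open>u = v x\<close> this combines coercivity of \<open>w\<close> at
    \<open>u\<close> with \<open>norm x \<le> B * norm u\<close>.\<close>
  have "c / B\<^sup>2 * (norm x)\<^sup>2 \<le> Re (cinner (v x) x)" for x
  proof -
    have "(norm x)\<^sup>2 \<le> B\<^sup>2 * (norm (v x))\<^sup>2"
      using power_mono[OF B(2)[of "v x"], of 2] by (simp add: wv power_mult_distrib)
    then have "c / B\<^sup>2 * (norm x)\<^sup>2 \<le> c / B\<^sup>2 * (B\<^sup>2 * (norm (v x))\<^sup>2)"
      using B(1) c(1) by (intro mult_left_mono) auto
    also have "\<dots> = c * (norm (v x))\<^sup>2" using B(1) by simp
    also have "\<dots> \<le> Re (cinner (v x) x)"
      using c(2)[of "v x"] Re_cinner_commute[of "v x" x] by (simp add: wv)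
    finally show ?thesis .
  qed
  moreover have "c / B\<^sup>2 > 0" using B(1) c(1) by simp
  ultimately have "coercive v" unfolding coercive_def using bv av by blast
  then show thesis using that wv vw by blast
qed

text \<open>The preimage of \<open>y\<close> is
  \<open>(1 - ys y)\<^sup>-\<^sup>1\<^sup>/\<^sup>2 ys\<close>. The root \<open>c\<close> belonging
  to it is \<open>v\<close> itself, since
  \<open>v\<^sup>2 = (1 - ys y)\<^sup>-\<^sup>1 = 1 + t ts\<close>, and then
  \<open>mob 0 = ts v\<^sup>-\<^sup>1 = y\<close>.\<close>

lemma hat_surj:
  fixes y :: "('k::complex_hilbert, 'h::complex_hilbert) cblinfun"
  assumes fin: "finite_cdim (UNIV :: 'k set)" and y: "norm y < 1"
  obtains X :: "('h, 'k) closed_op" where "hat X = y"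
proof -
  obtain ys where ys: "adjoint_pair (\<lambda>k. y *\<^sub>V k) ys" "bounded_clinear ys"
    using adjoint_exists[OF bounded_clinear_apply] .
  have "coercive (\<lambda>k. k - ys (y *\<^sub>V k))"
    unfolding coercive_def
  proof (intro conjI exI[of _ "1 - (norm y)\<^sup>2"] allI)
    show "bounded_clinear (\<lambda>k. k - ys (y *\<^sub>V k))"
      by (intro bounded_clinear_sub bounded_clinear_id bounded_clinear_compose[OF ys(2)] bounded_clinear_apply)
    show "adjoint_pair (\<lambda>k. k - ys (y *\<^sub>V k)) (\<lambda>k. k - ys (y *\<^sub>V k))"
      by (simp add: adjoint_pair_def cinner_diff_left cinner_diff_right
          adjoint_pairD'[OF ys(1)] adjoint_pairD[OF ys(1), symmetric])
    show "0 < 1 - (norm y)\<^sup>2" using y by (simp add: power_less_one_iff)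
    show "(1 - (norm y)\<^sup>2) * (norm k)\<^sup>2 \<le> Re (cinner (k - ys (y *\<^sub>V k)) k)" for k
      using Re_hform_lower[of y k]
      by (simp add: cinner_diff_left adjoint_pairD'[OF ys(1)] hform_def)
  qed
  then obtain w where w: "coercive w" "\<And>k. w (w k) = k - ys (y *\<^sub>V k)" using coercive_sqrt_exists by blast
  obtain v where v: "coercive v" "\<And>k. w (v k) = k" "\<And>k. v (w k) = k" using coercive_inverse[OF fin w(1)] by blast
  note vl = coercive_bounded_clinear[OF v(1)]
  define t where "t = (\<lambda>h. v (ys h))"
  define ts where "ts = (\<lambda>k. y *\<^sub>V v k)"
  have t: "bounded_clinear t" unfolding t_def by (rule bounded_clinear_compose[OF vl ys(2)])
  have adj: "adjoint_pair t ts"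
    by (simp add: t_def ts_def adjoint_pair_def adjoint_pairD[OF coercive_adjoint[OF v(1)]] adjoint_pairD'[OF ys(1)])
  obtain d where d: "coercive d" "\<And>x. d (d x) = x + ts (t x)"
    using coercive_sqrt_exists[OF coercive_one_plus[OF t adj]] by blast
  have cc: "v (v k) = k + t (ts k)" for k
  proof -
    have "v k = w (w (v k)) + ys (y *\<^sub>V v k)" unfolding w(2)[of "v k"] by simp
    then have "v (v k) = v (w k + ys (y *\<^sub>V v k))" by (simp add: v(2))
    then show ?thesis by (simp add: bounded_clinear_simps[OF vl] v(3) t_def ts_def)
  qed
  interpret mobius t ts d v by unfold_locales (fact fin t adj d v(1) cc)+
  define X :: "('h, 'k) closed_op" where "X = Abs_closed_op (graph_of t)"
  have "graph X = graph_of t"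
    unfolding X_def
    by (rule Abs_closed_op_inverse) (simp add: linear_operator_graph_of t closed_graph_of densely_defined_graph_of)
  then have "hat X = mob 0" by (rule hat_eq_mob_zero)
  also have "mob 0 = y" by (rule mob_eqI; simp only: den_zero num_zero norm_zero zero_less_one; simp add: ts_def)
  finally show thesis by (rule that)
qed

text \<open>On the inverse \<open>e\<close> of \<open>(1 + T T\<^sup>*)\<^sup>1\<^sup>/\<^sup>2\<close> the form \<open>\<langle>e k, e v\<rangle>\<close> is \<open>hform A A k v\<close>
  for \<open>A = hat T\<close>; so \<open>A\<close> determines \<open>e\<^sup>2\<close>, hence \<open>e\<close>, hence \<open>T\<^sup>*\<close>.\<close>

lemma hat_inj:
  fixes X Y :: "('h::complex_hilbert, 'k::complex_hilbert) closed_op"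
  assumes fin: "finite_cdim (UNIV :: 'k set)" and eq: "hat X = hat Y"
  shows "X = Y"
proof -
  have *: "\<exists>t ts c e. graph Z = graph_of t \<and> adjoint_pair t ts \<and> (\<forall>k. ts k = hat Z *\<^sub>V c k)
      \<and> coercive e \<and> (\<forall>k. e (c k) = k) \<and> (\<forall>k. c (e k) = k) \<and> (\<forall>k v. cinner (e (e k)) v = hform (hat Z) (hat Z) k v)"
    for Z :: "('h, 'k) closed_op"
  proof -
    obtain t ts d c where m: "mobius t ts d c" "graph Z = graph_of t" using closed_op_mobius[OF fin] .
    interpret mobius t ts d c by (rule m(1))
    obtain e where e: "coercive e" "\<And>k. c (e k) = k" "\<And>k. e (c k) = k" using coercive_inverse[OF fin c] by blast
    have "cinner (e (e k)) v = hform (mob 0) (mob 0) k v" for k v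
      using hform_mob[of 0 0 "e k" "e v"] adjoint_pairD[OF coercive_adjoint[OF e(1)], of "e k" v]
      by (simp add: den_zero e(2) hform_def[of 0 0] apply_left_simps)
    then have "graph Z = graph_of t \<and> adjoint_pair t ts \<and> (\<forall>k. ts k = hat Z *\<^sub>V c k)
        \<and> coercive e \<and> (\<forall>k. e (c k) = k) \<and> (\<forall>k. c (e k) = k)
        \<and> (\<forall>k v. cinner (e (e k)) v = hform (hat Z) (hat Z) k v)"
      using m(2) adj mob_zero e by (simp add: hat_eq_mob_zero[OF m(2)])
    then show ?thesis by blast
  qed
  obtain t ts c e where 1: "graph X = graph_of t" "adjoint_pair t ts" "\<And>k. ts k = hat X *\<^sub>V c k" "coercive e"
    "\<And>k. e (c k) = k" "\<And>k. c (e k) = k" "\<And>k v. cinner (e (e k)) v = hform (hat X) (hat X) k v"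
    using *[of X] by blast
  obtain t' ts' c' e' where 2: "graph Y = graph_of t'" "adjoint_pair t' ts'" "\<And>k. ts' k = hat Y *\<^sub>V c' k" "coercive e'"
    "\<And>k. e' (c' k) = k" "\<And>k. c' (e' k) = k" "\<And>k v. cinner (e' (e' k)) v = hform (hat Y) (hat Y) k v"
    using *[of Y] by blast
  have "e (e k) = e' (e' k)" for k by (rule cinner_ext) (simp add: 1(7) 2(7) eq)
  then have "e' = e"
    by (intro coercive_sqrt_unique[OF 1(4)] coercive_bounded_clinear[OF 2(4)] coercive_positive[OF 2(4)])
  then have "c' k = c k" for k using 2(6)[of "c k"] 1(5)[of k] by simp
  then have ts: "ts' = ts" by (auto simp: 1(3) 2(3) eq)
  have "t' x = t x" for x
    by (rule cinner_ext) (simp only: adjoint_pairD[OF 1(2)] adjoint_pairD[OF 2(2)] ts)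
  then have "graph X = graph Y" by (simp add: 1(1) 2(1) fun_eq_iff)
  then show ?thesis by (simp add: graph_inject)
qed


section \<open>The hyperbolic distance and its invariance\<close>

text \<open>As \<open>hat S\<close> maps \<open>c2 k\<close> to \<open>ts2 k\<close>, the operators
  \<open>L_op T S\<close> and \<open>R_op S T\<close> are \<open>neg.num\<close> and
  \<open>neg.den\<close> at \<open>hat S\<close>, composed with \<open>c2\<close>. Their quotient is
  thus \<open>neg.mob (hat S)\<close>; since \<open>neg.mob\<close> moves \<open>hat T\<close> to 0,
  the distance is read off at the origin.\<close>

lemma hyp_dist_le_imp_near:
  fixes T S :: "('h::complex_hilbert, 'k::complex_hilbert) closed_op"
  assumes fin: "finite_cdim (UNIV :: 'k set)" and le: "hyp_dist T S \<le> r"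
  shows "hyp_near (1 - (tanh r)\<^sup>2) (hat S) (hat T)"
proof -
  obtain t ts d c where T: "mobius t ts d c" "graph T = graph_of t" using closed_op_mobius[OF fin] .
  obtain t2 ts2 d2 c2 where S: "mobius t2 ts2 d2 c2" "graph S = graph_of t2" using closed_op_mobius[OF fin] .
  interpret mobius t ts d c by (rule T(1))
  interpret S: mobius t2 ts2 d2 c2 by (rule S(1))
  interpret neg: mobius "\<lambda>x. - t x" "\<lambda>k. - ts k" d c by (rule mobius_neg)
  define x where "x = hat S"
  have x: "norm x < 1" unfolding x_def by (rule norm_hat[OF fin])
  have xc: "x *\<^sub>V c2 k = ts2 k" for k unfolding x_def S.hat_eq_mob_zero[OF S(2)] by (rule S.mob_zero)
  have L: "L_op T S = graph_of (\<lambda>k. neg.num x (c2 k))"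
    unfolding L_op_def T(2) S(2) adj_graph_of[OF adj] adj_graph_of[OF S.adj]
    by (simp add: op_sqrt_d S.op_sqrt_c neg.num_def xc)
  have R: "R_op S T = graph_of (\<lambda>k. neg.den x (c2 k))"
    unfolding R_op_def T(2) S(2) adj_graph_of[OF adj] adj_graph_of[OF S.adj]
    by (simp add: op_sqrt_c S.op_sqrt_c neg.den_def xc)
  have "bounded_operator (L_op T S \<circ>\<^sub>o (R_op S T)\<inverse>) = neg.mob x"
  proof (rule bounded_operator_eqI)
    fix a b assume "(a, b) \<in> L_op T S \<circ>\<^sub>o (R_op S T)\<inverse>"
    then obtain k where "a = neg.den x (c2 k)" "b = neg.num x (c2 k)" by (auto simp: L R graph_of_def)
    then show "neg.mob x *\<^sub>V a = b" using neg.mob_den[OF x] by simp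
  next
    fix a
    obtain k' where k': "a = neg.den x k'" using neg.bij_den[OF x] by (metis bij_pointE)
    obtain k where k: "k' = c2 k" using S.bij_c by (metis bij_pointE)
    have "(a, neg.num x (c2 k)) \<in> L_op T S \<circ>\<^sub>o (R_op S T)\<inverse>"
      unfolding L R k' k by (auto intro!: relcompI[of _ k])
    then show "a \<in> Domain (L_op T S \<circ>\<^sub>o (R_op S T)\<inverse>)" by blast
  qed
  then have n: "artanh (norm (neg.mob x)) \<le> r" using le by (simp add: hyp_dist_def)
  have n1: "norm (neg.mob x) < 1" by (rule neg.norm_mob[OF x])
  \<comment> \<open>Writing the norm as \<open>tanh a\<close>, by the intermediate value theorem,
    turns the bound on \<open>artanh\<close> into a bound on the norm.\<close>
  have tr: "norm (neg.mob x) \<le> tanh r"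
  proof -
    obtain a where a: "norm (neg.mob x) = tanh a"
    proof -
      have "\<exists>a\<ge>0. a \<le> b \<and> tanh a = norm (neg.mob x)" if "norm (neg.mob x) \<le> tanh b" "b \<ge> 0" for b :: real
        using that by (intro IVT') (auto intro!: continuous_intros simp: tanh_0)
      moreover have "\<forall>\<^sub>F b :: real in at_top. norm (neg.mob x) < tanh b"
        using order_tendstoD(1)[OF tanh_real_at_top n1] .
      then obtain b :: real where "norm (neg.mob x) < tanh b" "b \<ge> 0"
        using eventually_happens[OF eventually_conj[OF _ eventually_ge_at_top[of 0]]] by auto
      ultimately show thesis using that by (metis less_imp_le)
    qed
    then show ?thesis using n by (simp add: artanh_tanh_real)
  qed
  have "hyp_near (1 - (tanh r)\<^sup>2) (neg.mob x) 0"
  proof (subst hyp_near_zero)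
    show "0 \<le> 1 - (tanh r)\<^sup>2" using tanh_real_bounds[of r] by (simp add: abs_square_le_1 abs_le_iff)
    have "(norm (neg.mob x *\<^sub>V k))\<^sup>2 \<le> (tanh r * norm k)\<^sup>2" for k
      by (intro power_mono order_trans[OF norm_apply] mult_right_mono tr) auto
    then show "\<forall>k. (1 - (tanh r)\<^sup>2) * (norm k)\<^sup>2 \<le> (norm k)\<^sup>2 - (norm (neg.mob x *\<^sub>V k))\<^sup>2"
      by (simp add: power_mult_distrib algebra_simps)
  qed
  moreover have "neg.mob (hat T) = 0" using mob_neg_mob[of 0] by (simp add: hat_eq_mob_zero[OF T(2)])
  ultimately have "hyp_near (1 - (tanh r)\<^sup>2) (neg.mob x) (neg.mob (hat T))" by simp
  then show ?thesis using neg.hyp_near_mob[OF x norm_hat[OF fin]] by (simp add: x_def)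
qed

text \<open>Moebius maps carrying 0 to \<open>y\<close> and \<open>\<psi> y\<close> to 0 turn
  \<open>\<psi>\<close> into a self-map \<open>\<phi>\<close> of the ball fixing 0. About 0 the
  relation is a norm bound, which \<open>cball_Schwarz\<close> passes on.\<close>

lemma hyp_near_holomorphic:
  fixes \<psi> :: "('k::complex_hilbert, 'h::complex_hilbert) cblinfun \<Rightarrow> ('k, 'h) cblinfun"
  assumes fin: "finite_cdim (UNIV :: 'k set)"
    and hol: "cholomorphic_on \<psi> (ball 0 1)" and into: "\<And>z. norm z < 1 \<Longrightarrow> norm (\<psi> z) < 1"
    and x: "norm x < 1" and y: "norm y < 1" and s: "0 \<le> s" and near: "hyp_near s x y"
  shows "hyp_near s (\<psi> x) (\<psi> y)"
proof -
  obtain Y :: "('h, 'k) closed_op" where Y: "hat Y = y" using hat_surj[OF fin y] .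
  obtain Z :: "('h, 'k) closed_op" where Z: "hat Z = \<psi> y" using hat_surj[OF fin into[OF y]] .
  obtain t ts d c where T: "mobius t ts d c" "graph Y = graph_of t" using closed_op_mobius[OF fin] .
  obtain t2 ts2 d2 c2 where S: "mobius t2 ts2 d2 c2" "graph Z = graph_of t2" using closed_op_mobius[OF fin] .
  interpret mobius t ts d c by (rule T(1))
  interpret S: mobius t2 ts2 d2 c2 by (rule S(1))
  interpret neg: mobius "\<lambda>x. - t x" "\<lambda>k. - ts k" d c by (rule mobius_neg)
  interpret Sneg: mobius "\<lambda>x. - t2 x" "\<lambda>k. - ts2 k" d2 c2 by (rule S.mobius_neg)
  have y0: "mob 0 = y" and y1: "S.mob 0 = \<psi> y"
    using hat_eq_mob_zero[OF T(2)] S.hat_eq_mob_zero[OF S(2)] Y Z by auto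
  define z where "z = neg.mob x"
  have z: "norm z < 1" "mob z = x" unfolding z_def by (rule neg.norm_mob[OF x], rule mob_mob_neg[OF x])
  define \<phi> where "\<phi> = (\<lambda>w. Sneg.mob (\<psi> (mob w)))"
  have hol\<phi>: "cholomorphic_on \<phi> (ball 0 1)"
    unfolding \<phi>_def
    by (rule cholomorphic_on_compose[OF cholomorphic_on_compose[OF mob_holomorphic hol] Sneg.mob_holomorphic])
      (auto intro: into norm_mob)
  have zero: "\<phi> 0 = 0" unfolding \<phi>_def y0 y1[symmetric] by (rule S.mob_neg_mob) simp
  have le: "norm (\<phi> z) \<le> norm z"
    by (rule cball_Schwarz[OF hol\<phi> _ zero z(1)]) (auto simp: \<phi>_def intro: into norm_mob Sneg.norm_mob)
  have "hyp_near s (mob z) (mob 0)" using near by (simp add: z(2) y0)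
  then have "hyp_near s z 0" using hyp_near_mob[OF z(1), of 0] by simp
  then have zk: "(norm (z *\<^sub>V k))\<^sup>2 \<le> (1 - s) * (norm k)\<^sup>2" for k
    using s by (simp add: hyp_near_zero algebra_simps)
  have \<phi>k: "(norm (\<phi> z *\<^sub>V k))\<^sup>2 \<le> (1 - s) * (norm k)\<^sup>2" for k
  proof (cases "k = 0")
    case False
    \<comment> \<open>If \<open>K\<close> is the zero space, \<open>s > 1\<close> is possible; a
      nonzero \<open>k\<close> excludes it and makes \<open>sqrt (1 - s)\<close> usable.\<close>
    then have "0 \<le> (1 - s)"
      using zk[of k] zero_le_power2[of "norm (z *\<^sub>V k)"] by (metis (no_types, opaque_lifting) norm_eq_zero order_trans zero_less_power2 zero_le_mult_iff not_le)
    have "norm z \<le> sqrt (1 - s)"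
    proof (rule norm_apply_bound)
      show "norm (z *\<^sub>V k) \<le> sqrt (1 - s) * norm k" for k
        by (rule power2_le_imp_le) (use zk[of k] \<open>0 \<le> 1 - s\<close> in \<open>auto simp: power_mult_distrib\<close>)
    qed (use \<open>0 \<le> 1 - s\<close> in simp)
    then have "norm (\<phi> z *\<^sub>V k) \<le> sqrt (1 - s) * norm k"
      using le by (intro order_trans[OF norm_apply] mult_right_mono) auto
    from power_mono[OF this, of 2] show ?thesis using \<open>0 \<le> 1 - s\<close> by (simp add: power_mult_distrib)
  qed (simp add: apply_simps)
  have "hyp_near s (\<phi> z) 0" using s \<phi>k by (simp add: hyp_near_zero algebra_simps)
  then have "hyp_near s (Sneg.mob (\<psi> x)) (Sneg.mob (\<psi> y))"
    using zero by (simp add: \<phi>_def z(2) y0)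
  then show ?thesis using Sneg.hyp_near_mob[OF into[OF x] into[OF y]] by simp
qed


section \<open>Convexity and compactness of hyperbolic balls\<close>

lemma hform_scaleR_left: "hform x y (a *\<^sub>R k) v = of_real a * hform x y k v"
  and hform_scaleR_right: "hform x y k (a *\<^sub>R v) = of_real a * hform x y k v"
  by (simp_all add: hform_def apply_simps cinner_simps right_diff_distrib)

lemma Re_hform_nonneg: "norm x \<le> 1 \<Longrightarrow> 0 \<le> Re (hform x x k k)"
  by (intro order_trans[OF _ Re_hform_lower] mult_nonneg_nonneg) (auto simp: power_le_one)

lemma hform_Cauchy_Schwarz:
  assumes "norm x \<le> 1"
  shows "(cmod (hform x x k v))\<^sup>2 \<le> Re (hform x x k k) * Re (hform x x v v)"
proof (rule form_Cauchy_Schwarz)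
  show "0 \<le> Re (hform x x k k)" for k
    using assms by (rule Re_hform_nonneg)
  show "hform x x k v = cnj (hform x x v k)" for k v by (rule hform_cnj)
qed (simp_all add: hform_def apply_simps cinner_simps right_diff_distrib)

lemma norm_hform_le:
  assumes "norm x \<le> 1" "norm y \<le> 1"
  shows "cmod (hform x y k v) \<le> 2 * norm k * norm v"
proof -
  have "cmod (hform x y k v) \<le> cmod (cinner k v) + cmod (cinner (x *\<^sub>V k) (y *\<^sub>V v))"
    unfolding hform_def by (rule norm_triangle_ineq4)
  also have "\<dots> \<le> norm k * norm v + norm (x *\<^sub>V k) * norm (y *\<^sub>V v)"
    by (intro add_mono cinner_Cauchy_Schwarz)
  also have "norm (x *\<^sub>V k) * norm (y *\<^sub>V v) \<le> (1 * norm k) * (1 * norm v)"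
    using assms by (intro mult_mono order_trans[OF norm_apply] mult_right_mono) auto
  finally show ?thesis by simp
qed

section \<open>Hyperbolic balls compared with norm balls\<close>

lemma hyp_near_mono: "hyp_near s x y \<Longrightarrow> s' \<le> s \<Longrightarrow> hyp_near s' x y"
  unfolding hyp_near_def by (meson mult_right_mono order_trans zero_le_power2)

text \<open>Polarisation gives \<open>Re (hform x y k k) = (a + b + w) / 2\<close>, so nearness
  yields \<open>(a + b + w)\<^sup>2 \<le> 4 a b\<close>. As
  \<open>4 a b \<le> (a + b)\<^sup>2\<close>, the squared deviation \<open>w\<close>
  vanishes.\<close>

lemma hyp_near_one_imp_eq:
  assumes "hyp_near 1 x y" "norm x \<le> 1" "norm y \<le> 1"
  shows "x = y"
proof (rule cblinfun_eqI)
  fix k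
  define a b w where "a = Re (hform x x k k)" and "b = Re (hform y y k k)"
    and "w = (norm (x *\<^sub>V k - y *\<^sub>V k))\<^sup>2"
  have "Re (hform x y k k) = (a + b + w) / 2"
    unfolding a_def b_def w_def norm_diff_sq Re_hform_self
    by (simp add: hform_def Re_cinner_self field_simps)
  then have "((a + b + w) / 2)\<^sup>2 \<le> (cmod (hform x y k k))\<^sup>2"
    by (metis abs_Re_le_cmod abs_le_square_iff abs_norm_cancel)
  also have "\<dots> \<le> a * b" using assms(1) unfolding hyp_near_def a_def b_def by (metis mult_1)
  finally have le: "(a + b + w)\<^sup>2 \<le> 4 * (a * b)" by (simp add: power_divide)
  have "a \<ge> 0" "b \<ge> 0" "w \<ge> 0" using assms(2,3) by (simp_all add: a_def b_def w_def Re_hform_nonneg)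
  then have "0 \<le> (a - b)\<^sup>2 + 2 * ((a + b) * w)" by simp
  then have "w\<^sup>2 \<le> 0" using le by (simp add: power2_eq_square algebra_simps)
  then show "x *\<^sub>V k = y *\<^sub>V k" by (simp add: w_def)
qed

text \<open>Here \<open>x\<close> is an arbitrary operator; nearness to an interior point itself
  forces it into the ball. For \<open>v = k\<close> the left side is at least
  \<open>s (1 - norm y)\<^sup>2 (norm k)\<^sup>4\<close>, while the factor belonging to
  \<open>y\<close> is at most \<open>(norm k)\<^sup>2\<close>.\<close>

lemma hyp_near_norm_bound:
  assumes y: "norm y < 1" and s: "0 < s"
  obtains r where "r < 1" "\<And>x. hyp_near s y x \<Longrightarrow> norm x \<le> r"
proof -
  \<comment> \<open>\<open>max 0\<close> keeps the radius \<open>sqrt b\<close> meaningful for every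
    \<open>s\<close>.\<close>
  define b where "b = max 0 (1 - s * (1 - norm y)\<^sup>2)"
  have b: "0 \<le> b" "b < 1" using y s by (auto simp: b_def)
  have "norm x \<le> sqrt b" if near: "hyp_near s y x" for x
  proof (rule norm_apply_bound)
    show "norm (x *\<^sub>V k) \<le> sqrt b * norm k" for k
    proof (cases "k = 0")
      case False
      have yk: "norm (y *\<^sub>V k) \<le> norm y * norm k" by (rule norm_apply)
      also have "\<dots> < norm k" using y False by simp
      finally have yk': "norm (y *\<^sub>V k) < norm k" .
      have ypos: "0 < (norm k)\<^sup>2 - (norm (y *\<^sub>V k))\<^sup>2" using yk' by (simp add: power_strict_mono)
      have main: "s * (cmod (hform y x k k))\<^sup>2 \<le> ((norm k)\<^sup>2 - (norm (y *\<^sub>V k))\<^sup>2) * ((norm k)\<^sup>2 - (norm (x *\<^sub>V k))\<^sup>2)"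
        using near unfolding hyp_near_def by (metis Re_hform_self)
      have "0 \<le> s * (cmod (hform y x k k))\<^sup>2" using s by simp
      then have xk2: "0 \<le> (norm k)\<^sup>2 - (norm (x *\<^sub>V k))\<^sup>2" using main ypos by (smt (verit) mult_pos_neg)
      then have xk: "norm (x *\<^sub>V k) \<le> norm k" by (subst power_mono_iff[symmetric, of _ _ 2]) auto
      have "cmod (cinner (y *\<^sub>V k) (x *\<^sub>V k)) \<le> norm (y *\<^sub>V k) * norm (x *\<^sub>V k)"
        by (rule cinner_Cauchy_Schwarz)
      also have "\<dots> \<le> (norm y * norm k) * norm k" using yk xk by (intro mult_mono) auto
      finally have "(1 - norm y) * (norm k)\<^sup>2 \<le> cmod (cinner k k) - cmod (cinner (y *\<^sub>V k) (x *\<^sub>V k))"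
        by (simp add: cinner_self norm_power norm_mult power2_eq_square algebra_simps)
      also have "\<dots> \<le> cmod (hform y x k k)" unfolding hform_def by (rule norm_triangle_ineq2)
      finally have "((1 - norm y) * (norm k)\<^sup>2)\<^sup>2 \<le> (cmod (hform y x k k))\<^sup>2"
        using y by (intro power_mono) auto
      then have "s * ((1 - norm y) * (norm k)\<^sup>2)\<^sup>2 \<le> s * (cmod (hform y x k k))\<^sup>2"
        using s by (intro mult_left_mono) auto
      also note main
      also have "((norm k)\<^sup>2 - (norm (y *\<^sub>V k))\<^sup>2) * ((norm k)\<^sup>2 - (norm (x *\<^sub>V k))\<^sup>2)
          \<le> (norm k)\<^sup>2 * ((norm k)\<^sup>2 - (norm (x *\<^sub>V k))\<^sup>2)"
        using xk2 by (intro mult_right_mono) auto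
      finally have "(norm k)\<^sup>2 * (s * (1 - norm y)\<^sup>2 * (norm k)\<^sup>2)
          \<le> (norm k)\<^sup>2 * ((norm k)\<^sup>2 - (norm (x *\<^sub>V k))\<^sup>2)"
        by (simp add: power_mult_distrib power2_eq_square mult_ac)
      then have "s * (1 - norm y)\<^sup>2 * (norm k)\<^sup>2 \<le> (norm k)\<^sup>2 - (norm (x *\<^sub>V k))\<^sup>2"
        using False by simp
      then have "(norm (x *\<^sub>V k))\<^sup>2 \<le> (1 - s * (1 - norm y)\<^sup>2) * (norm k)\<^sup>2" by (simp add: algebra_simps)
      also have "\<dots> \<le> b * (norm k)\<^sup>2" by (intro mult_right_mono) (auto simp: b_def)
      finally have "(norm (x *\<^sub>V k))\<^sup>2 \<le> (sqrt b * norm k)\<^sup>2" using b by (simp add: power_mult_distrib)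
      then show ?thesis by (rule power2_le_imp_le) (use b in simp)
    qed (simp add: apply_simps)
  qed (use b in simp)
  moreover have "sqrt b < 1" using b by simp
  ultimately show thesis using that by blast
qed

text \<open>On unit vectors the mixed form has modulus at most 2 and each diagonal form is at least
  \<open>1 - r\<^sup>2\<close>; this gives the constant. It makes the diameter of the minimal set
  finite.\<close>

lemma hyp_near_uniform:
  assumes "r < 1" "norm x \<le> r" "norm y \<le> r"
  shows "hyp_near (((1 - r\<^sup>2) / 2)\<^sup>2) x y"
  unfolding hyp_near_def
proof (intro allI)
  fix k v
  have r: "0 \<le> r" using assms(2) norm_ge_zero[of x] by linarith
  have r2: "0 \<le> 1 - r\<^sup>2" using r assms(1) by (simp add: power_le_one)
  have low: "(1 - r\<^sup>2) * (norm u)\<^sup>2 \<le> Re (hform z z u u)" if "norm z \<le> r" for z u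
    using that by (intro order_trans[OF _ Re_hform_lower] mult_right_mono) (auto simp: power_mono)
  have "(cmod (hform x y k v))\<^sup>2 \<le> (2 * norm k * norm v)\<^sup>2"
    using assms by (intro power_mono norm_hform_le) auto
  then have "((1 - r\<^sup>2) / 2)\<^sup>2 * (cmod (hform x y k v))\<^sup>2 \<le> ((1 - r\<^sup>2) / 2)\<^sup>2 * (2 * norm k * norm v)\<^sup>2"
    by (intro mult_left_mono) auto
  also have "\<dots> = ((1 - r\<^sup>2) * (norm k)\<^sup>2) * ((1 - r\<^sup>2) * (norm v)\<^sup>2)"
    by (simp add: power_mult_distrib power_divide power2_eq_square)
  also have "\<dots> \<le> Re (hform x x k k) * Re (hform y y v v)"
    by (intro mult_mono low assms(2,3) Re_hform_nonneg mult_nonneg_nonneg r2 zero_le_power2)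
      (use assms in auto)
  finally show "((1 - r\<^sup>2) / 2)\<^sup>2 * (cmod (hform x y k v))\<^sup>2 \<le> Re (hform x x k k) * Re (hform y y v v)" .
qed

lemma hyp_near_closed:
  assumes "\<And>n. hyp_near s y (u n)" "\<And>k. (\<lambda>n. u n *\<^sub>V k) \<longlonglongrightarrow> z *\<^sub>V k"
  shows "hyp_near s y z"
  unfolding hyp_near_def
proof (intro allI)
  fix k v
  have "(\<lambda>n. s * (cmod (hform y (u n) k v))\<^sup>2) \<longlonglongrightarrow> s * (cmod (hform y z k v))\<^sup>2"
    unfolding hform_def by (intro tendsto_intros tendsto_cinner assms(2))
  moreover have "(\<lambda>n. Re (hform y y k k) * Re (hform (u n) (u n) v v)) \<longlonglongrightarrow> Re (hform y y k k) * Re (hform z z v v)"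
    unfolding hform_def by (intro tendsto_intros tendsto_cinner assms(2))
  ultimately show "s * (cmod (hform y z k v))\<^sup>2 \<le> Re (hform y y k k) * Re (hform z z v v)"
    by (rule LIMSEQ_le) (use assms(1) in \<open>auto simp: hyp_near_def\<close>)
qed

section \<open>Averages and convexity\<close>

definition average :: "'a set \<Rightarrow> ('a \<Rightarrow> 'b::real_vector) \<Rightarrow> 'b" where
  "average F f = (1 / real (card F)) *\<^sub>R (\<Sum>i\<in>F. f i)"

lemma average_real: "average F f = (\<Sum>i\<in>F. f i) / real (card F)" for f :: "'a \<Rightarrow> real"
  by (simp add: average_def)

lemma average_mono: "(\<And>i. i \<in> F \<Longrightarrow> f i \<le> g i) \<Longrightarrow> average F f \<le> average F (g :: 'a \<Rightarrow> real)"
  by (simp add: average_real divide_right_mono sum_mono)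

lemma average_const: "finite F \<Longrightarrow> F \<noteq> {} \<Longrightarrow> average F (\<lambda>i. c) = c"
  by (simp add: average_def sum_constant_scaleR)

lemma average_diff: "average F (\<lambda>i. f i - g i) = average F f - average F g"
  by (simp add: average_def sum_subtractf scaleR_right_diff_distrib)

lemma average_mult_left: "average F (\<lambda>i. c * f i) = c * average F f" for f :: "'a \<Rightarrow> real"
  by (simp add: average_real sum_distrib_left[symmetric])

lemma average_mult_right: "average F (\<lambda>i. f i * c) = average F f * c" for f :: "'a \<Rightarrow> real"
  by (simp add: average_real sum_distrib_right[symmetric])

text \<open>The source of strict convexity. It is used for complex numbers, where the variance is
  only known to be nonnegative, and for vectors of \<open>H\<close>, where the exact value is
  kept.\<close>

lemma average_variance:
  fixes f :: "'a \<Rightarrow> 'b::complex_hilbert"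
  assumes "finite F" "F \<noteq> {}"
  shows "average F (\<lambda>i. (norm (f i - average F f))\<^sup>2) = average F (\<lambda>i. (norm (f i))\<^sup>2) - (norm (average F f))\<^sup>2"
proof -
  define m where "m = average F f"
  have "bounded_linear (\<lambda>x. Re (cinner x m))"
    by (rule bounded_linear_compose[OF bounded_linear_Re bounded_linear_cinner_left])
  note lin = bounded_linear.linear[OF this]
  have "average F (\<lambda>i. 2 * Re (cinner (f i) m)) = 2 * Re (cinner m m)"
    unfolding average_mult_left unfolding m_def average_def
    using linear_sum[OF lin, of f F] linear_scale[OF lin, of "1 / real (card F)" "\<Sum>i\<in>F. f i"]
    by (simp add: m_def average_def)
  then have "average F (\<lambda>i. (norm (f i))\<^sup>2 - 2 * Re (cinner (f i) m) + (norm m)\<^sup>2)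
      = average F (\<lambda>i. (norm (f i))\<^sup>2) - 2 * Re (cinner m m) + (norm m)\<^sup>2"
    using average_const[OF assms, of "(norm m)\<^sup>2"] by (simp add: average_real sum.distrib sum_subtractf diff_divide_distrib add_divide_distrib)
  then show ?thesis unfolding norm_diff_sq m_def[symmetric] by (simp add: Re_cinner_self)
qed

lemma average_apply: "average F (\<lambda>x. x) *\<^sub>V k = average F (\<lambda>x. x *\<^sub>V k)"
  by (simp add: average_def apply_left_simps apply_sum_left)

text \<open>Hyperbolic balls are strictly convex in every direction \<open>k\<close> on which the averaged
  operators do not all agree.\<close>

lemma hyp_near_average_strict:
  fixes y :: "('k::complex_hilbert, 'h::complex_hilbert) cblinfun"
  assumes F: "finite F" "F \<noteq> {}" and near: "\<And>x. x \<in> F \<Longrightarrow> hyp_near s x y" and s: "0 \<le> s"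
  defines "z \<equiv> average F (\<lambda>x. x)"
  shows "s * (cmod (hform z y k v))\<^sup>2
    \<le> (Re (hform z z k k) - average F (\<lambda>x. (norm (x *\<^sub>V k - z *\<^sub>V k))\<^sup>2)) * Re (hform y y v v)"
proof -
  have zk: "z *\<^sub>V k = average F (\<lambda>x. x *\<^sub>V k)" unfolding z_def by (rule average_apply)
  have avh: "hform z y k v = average F (\<lambda>x. hform x y k v)"
  proof -
    have lin: "linear (\<lambda>a. cinner a (y *\<^sub>V v))"
      by (rule bounded_linear.linear[OF bounded_linear_cinner_left])
    have "average F (\<lambda>x. cinner (x *\<^sub>V k) (y *\<^sub>V v)) = cinner (average F (\<lambda>x. x *\<^sub>V k)) (y *\<^sub>V v)"
      unfolding average_def
      using linear_sum[OF lin, of "\<lambda>x. x *\<^sub>V k" F]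
      by (simp add: cinner_simps scaleR_conv_of_real)
    then show ?thesis
      unfolding hform_def average_diff average_const[OF F] zk by simp
  qed
  \<comment> \<open>Nonnegative variance of the numbers \<open>hform x y k v\<close> bounds the left
    side; the exact variance of the vectors \<open>x k\<close> below leaves the deficit on the
    right.\<close>
  have "0 \<le> average F (\<lambda>x. (norm (hform x y k v - average F (\<lambda>x. hform x y k v)))\<^sup>2)"
    by (simp add: average_real sum_nonneg)
  then have "s * (cmod (hform z y k v))\<^sup>2 \<le> s * average F (\<lambda>x. (cmod (hform x y k v))\<^sup>2)"
    unfolding average_variance[OF F] avh by (intro mult_left_mono s) simp
  also have "\<dots> = average F (\<lambda>x. s * (cmod (hform x y k v))\<^sup>2)" by (simp add: average_mult_left)
  also have "\<dots> \<le> average F (\<lambda>x. Re (hform x x k k) * Re (hform y y v v))"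
    by (rule average_mono) (use near in \<open>auto simp: hyp_near_def\<close>)
  also have "\<dots> = average F (\<lambda>x. Re (hform x x k k)) * Re (hform y y v v)" by (rule average_mult_right)
  also have "average F (\<lambda>x. Re (hform x x k k)) = Re (hform z z k k) - average F (\<lambda>x. (norm (x *\<^sub>V k - z *\<^sub>V k))\<^sup>2)"
    unfolding zk average_variance[OF F] Re_hform_self average_diff average_const[OF F] by simp
  finally show ?thesis .
qed

lemma hyp_near_average:
  fixes y :: "('k::complex_hilbert, 'h::complex_hilbert) cblinfun"
  assumes F: "finite F" "F \<noteq> {}" and near: "\<And>x. x \<in> F \<Longrightarrow> hyp_near s y x" and s: "0 \<le> s" and y: "norm y \<le> 1"
  shows "hyp_near s y (average F (\<lambda>x. x))"
proof (rule hyp_near_sym)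
  let ?z = "average F (\<lambda>x. x)"
  show "hyp_near s ?z y"
    unfolding hyp_near_def
  proof (intro allI)
    fix k v
    have "0 \<le> Re (hform y y v v)"
      using y by (rule Re_hform_nonneg)
    moreover have "0 \<le> average F (\<lambda>x. (norm (x *\<^sub>V k - ?z *\<^sub>V k))\<^sup>2)"
      by (simp add: average_real sum_nonneg)
    ultimately have "(Re (hform ?z ?z k k) - average F (\<lambda>x. (norm (x *\<^sub>V k - ?z *\<^sub>V k))\<^sup>2)) * Re (hform y y v v)
        \<le> Re (hform ?z ?z k k) * Re (hform y y v v)"
      by (intro mult_right_mono) auto
    then show "s * (cmod (hform ?z y k v))\<^sup>2 \<le> Re (hform ?z ?z k k) * Re (hform y y v v)"
      using hyp_near_average_strict[OF F hyp_near_sym[OF near] s, of k v] by linarith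
  qed
qed

lemma hyp_near_midpoint:
  assumes "hyp_near s y a" "hyp_near s y b" "0 \<le> s" "norm y \<le> 1"
  shows "hyp_near s y ((1/2) *\<^sub>R (a + b))"
proof (cases "a = b")
  case True
  then show ?thesis using assms(1) by (simp add: scaleR_2[symmetric])
next
  case False
  then have "average {a, b} (\<lambda>x. x) = (1/2) *\<^sub>R (a + b)" by (simp add: average_def)
  then show ?thesis using hyp_near_average[of "{a, b}" s y] assms by auto
qed

section \<open>Pointwise limits and intersections of chains\<close>

lemma pointwise_null_span:
  fixes u :: "nat \<Rightarrow> ('k::complex_hilbert, 'h::complex_hilbert) cblinfun"
  assumes "complex_vector.span B = UNIV" "\<And>b. b \<in> B \<Longrightarrow> (\<lambda>n. u n *\<^sub>V b) \<longlonglongrightarrow> 0"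
  shows "(\<lambda>n. u n *\<^sub>V k) \<longlonglongrightarrow> 0"
proof -
  have "complex_vector.subspace {k. (\<lambda>n. u n *\<^sub>V k) \<longlonglongrightarrow> 0}"
  proof (rule complex_vector.subspaceI; clarsimp simp: apply_simps)
    fix k l assume "(\<lambda>n. u n *\<^sub>V k) \<longlonglongrightarrow> 0" "(\<lambda>n. u n *\<^sub>V l) \<longlonglongrightarrow> 0"
    from tendsto_add[OF this] show "(\<lambda>n. u n *\<^sub>V k + u n *\<^sub>V l) \<longlonglongrightarrow> 0" by simp
  next
    fix c k assume "(\<lambda>n. u n *\<^sub>V k) \<longlonglongrightarrow> 0"
    from bounded_linear.tendsto[OF bounded_linear_scaleC this, of c]
    show "(\<lambda>n. c *\<^sub>C (u n *\<^sub>V k)) \<longlonglongrightarrow> 0" by simp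
  qed
  from complex_vector.span_minimal[OF _ this, of B] assms show ?thesis by blast
qed

text \<open>Elements of almost minimal Hilbert-Schmidt-like norm form a Cauchy sequence by the
  parallelogram law.\<close>

lemma chain_Inter_nonempty:
  fixes \<C> :: "('k::complex_hilbert, 'h::complex_hilbert) cblinfun set set"
  assumes fin: "finite_cdim (UNIV :: 'k set)" and ne: "\<C> \<noteq> {}"
    and chain: "\<And>S T. S \<in> \<C> \<Longrightarrow> T \<in> \<C> \<Longrightarrow> S \<subseteq> T \<or> T \<subseteq> S"
    and nonempty: "\<And>S. S \<in> \<C> \<Longrightarrow> S \<noteq> {}"
    and bound: "\<And>S x. S \<in> \<C> \<Longrightarrow> x \<in> S \<Longrightarrow> norm x \<le> 1"
    and midpoint: "\<And>S x y. S \<in> \<C> \<Longrightarrow> x \<in> S \<Longrightarrow> y \<in> S \<Longrightarrow> (1/2) *\<^sub>R (x + y) \<in> S"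
    and closed: "\<And>S u z. S \<in> \<C> \<Longrightarrow> (\<And>n. u n \<in> S) \<Longrightarrow> (\<And>k. (\<lambda>n. u n *\<^sub>V k) \<longlonglongrightarrow> z *\<^sub>V k) \<Longrightarrow> z \<in> S"
  shows "\<exists>z. \<forall>S\<in>\<C>. z \<in> S"
proof -
  obtain B :: "'k set" where B: "finite B" "complex_vector.span B = UNIV"
    using fin by (auto simp: finite_cdim_def)
  \<comment> \<open>\<open>B\<close> is only a spanning set, but \<open>n\<close> still obeys the
    parallelogram law and controls convergence on \<open>B\<close>, hence at every vector.\<close>
  define n where "n = (\<lambda>x :: ('k, 'h) cblinfun. \<Sum>b\<in>B. (norm (x *\<^sub>V b))\<^sup>2)"
  have n0: "0 \<le> n x" for x by (simp add: n_def sum_nonneg)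
  have nmid: "n ((1/2) *\<^sub>R (x + y)) = (n x + n y) / 2 - n (x - y) / 4" for x y
    unfolding n_def apply_left_simps norm_midpoint_sq
    by (simp add: sum_subtractf sum.distrib sum_divide_distrib[symmetric])
  have nb: "(norm (x *\<^sub>V b))\<^sup>2 \<le> n x" if "b \<in> B" for x b
    unfolding n_def using that B(1) by (intro member_le_sum) auto
  \<comment> \<open>Smaller members of the chain have larger infima, so the supremum
    \<open>a\<close> of these infima is approached along the chain.\<close>
  define \<alpha> where "\<alpha> = (\<lambda>S. Inf (n ` S))"
  have \<alpha>le: "\<alpha> S \<le> n x" if "x \<in> S" for S x
    unfolding \<alpha>_def using that n0 by (intro cINF_lower bdd_belowI2[where m = 0]) auto
  have "bdd_above (\<alpha> ` \<C>)"
  proof (rule bdd_aboveI2)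
    fix S assume S: "S \<in> \<C>"
    then obtain x where x: "x \<in> S" using nonempty by blast
    have "n x \<le> (\<Sum>b\<in>B. (norm b)\<^sup>2)"
      unfolding n_def
    proof (intro sum_mono power_mono norm_ge_zero)
      show "norm (x *\<^sub>V b) \<le> norm b" for b
        using norm_apply[of x b] mult_right_mono[OF bound[OF S x] norm_ge_zero[of b]] by simp
    qed
    then show "\<alpha> S \<le> (\<Sum>b\<in>B. (norm b)\<^sup>2)" using \<alpha>le[OF x] by linarith
  qed
  define a where "a = Sup (\<alpha> ` \<C>)"
  have \<alpha>a: "\<alpha> S \<le> a" if "S \<in> \<C>" for S
    unfolding a_def using that \<open>bdd_above (\<alpha> ` \<C>)\<close> by (intro cSUP_upper)
  have low: "\<exists>x\<in>S. n x < a + e" if "S \<in> \<C>" "e > 0" for S e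
  proof -
    have "Inf (n ` S) < a + e" using \<alpha>a[OF that(1)] that(2) by (simp add: \<alpha>_def)
    then show ?thesis using nonempty[OF that(1)] n0
      by (subst (asm) cInf_less_iff) (auto intro: bdd_belowI2[where m = 0])
  qed
  \<comment> \<open>The midpoint stays in \<open>S\<close>, so its value of \<open>n\<close> exceeds
    \<open>a - e\<close>, while both endpoints lie below \<open>a + e\<close>.\<close>
  have close: "n (x - y) \<le> 8 * e"
    if "S \<in> \<C>" "\<alpha> S > a - e" "x \<in> S" "y \<in> S" "n x < a + e" "n y < a + e" for S x y e
  proof -
    have "w \<le> 8 * e" if "A \<le> (p + q) / 2 - w / 4" "A > a - e" "p < a + e" "q < a + e" for A p q w :: real
      using that by (simp add: field_simps)
    from this[OF \<alpha>le[OF midpoint[OF that(1,3,4)], unfolded nmid] that(2,5,6)] show ?thesis .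
  qed
  define \<epsilon> where "\<epsilon> = (\<lambda>j. inverse (real (Suc j)))"
  have \<epsilon>: "\<epsilon> j > 0" for j by (simp add: \<epsilon>_def)
  have \<epsilon>0: "\<epsilon> \<longlonglongrightarrow> 0" unfolding \<epsilon>_def by (rule LIMSEQ_inverse_real_of_nat)
  have "\<exists>S\<in>\<C>. \<alpha> S > a - \<epsilon> j" for j
    using less_cSupD[of "\<alpha> ` \<C>" "a - \<epsilon> j"] ne \<epsilon>[of j] unfolding a_def by auto
  then obtain T where T: "\<And>j. T j \<in> \<C>" "\<And>j. \<alpha> (T j) > a - \<epsilon> j" by metis
  have "\<forall>j. \<exists>x. x \<in> T j \<and> n x < a + \<epsilon> j" using low[OF T(1) \<epsilon>] by blast
  then obtain x where x: "\<And>j. x j \<in> T j" "\<And>j. n (x j) < a + \<epsilon> j" by metis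
  have xx: "n (x i - x j) \<le> 8 * max (\<epsilon> i) (\<epsilon> j)" for i j
  proof -
    define e where "e = max (\<epsilon> i) (\<epsilon> j)"
    have e: "n (x i) < a + e" "n (x j) < a + e" "\<alpha> (T i) > a - e" "\<alpha> (T j) > a - e"
      using x(2)[of i] x(2)[of j] T(2)[of i] T(2)[of j] by (auto simp: e_def)
    consider "T i \<subseteq> T j" | "T j \<subseteq> T i" using chain[OF T(1) T(1)] by blast
    then show ?thesis
    proof cases
      case 1
      then show ?thesis using close[OF T(1)[of j] e(4) _ _ e(1,2)] x(1) unfolding e_def by blast
    next
      case 2
      then show ?thesis using close[OF T(1)[of i] e(3) _ _ e(1,2)] x(1) unfolding e_def by blast
    qed
  qed
  have null: "(\<lambda>j. u j *\<^sub>V k) \<longlonglongrightarrow> 0"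
    if "\<And>j. n (u j) \<le> 8 * \<epsilon> j" for u :: "nat \<Rightarrow> ('k, 'h) cblinfun" and k
  proof (rule pointwise_null_span[OF B(2)])
    fix b assume b: "b \<in> B"
    have "(\<lambda>j. (norm (u j *\<^sub>V b))\<^sup>2) \<longlonglongrightarrow> 0"
    proof (rule Lim_null_comparison[where g = "\<lambda>j. 8 * \<epsilon> j"])
      show "\<forall>\<^sub>F j in sequentially. norm ((norm (u j *\<^sub>V b))\<^sup>2) \<le> 8 * \<epsilon> j"
        using order_trans[OF nb[OF b] that] by (intro always_eventually) auto
      show "(\<lambda>j. 8 * \<epsilon> j) \<longlonglongrightarrow> 0" using tendsto_mult[OF tendsto_const[of 8] \<epsilon>0] by simp
    qed
    then have "(\<lambda>j. sqrt ((norm (u j *\<^sub>V b))\<^sup>2)) \<longlonglongrightarrow> sqrt 0" by (rule tendsto_real_sqrt)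
    then show "(\<lambda>j. u j *\<^sub>V b) \<longlonglongrightarrow> 0" by (simp add: tendsto_norm_zero_iff)
  qed
  have Cauchy_B: "Cauchy (\<lambda>j. x j *\<^sub>V b)" if b: "b \<in> B" for b
  proof (rule metric_CauchyI)
    fix e :: real assume e: "e > 0"
    have "\<forall>\<^sub>F j in sequentially. \<epsilon> j < e\<^sup>2 / 8" using order_tendstoD(2)[OF \<epsilon>0, of "e\<^sup>2 / 8"] e by simp
    then obtain N where N: "\<And>j. j \<ge> N \<Longrightarrow> \<epsilon> j < e\<^sup>2 / 8" by (auto simp: eventually_sequentially)
    have "dist (x i *\<^sub>V b) (x j *\<^sub>V b) < e" if ij: "i \<ge> N" "j \<ge> N" for i j
    proof -
      have "(norm ((x i - x j) *\<^sub>V b))\<^sup>2 \<le> 8 * max (\<epsilon> i) (\<epsilon> j)" using nb[OF b] xx order_trans by blast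
      also have "\<dots> < e\<^sup>2" using N[OF ij(1)] N[OF ij(2)] by simp
      finally have "norm ((x i - x j) *\<^sub>V b) < e" using e by (simp add: power2_less_imp_less)
      then show ?thesis by (simp add: dist_norm apply_left_simps)
    qed
    then show "\<exists>M. \<forall>i\<ge>M. \<forall>j\<ge>M. dist (x i *\<^sub>V b) (x j *\<^sub>V b) < e" by blast
  qed
  have "complex_vector.subspace {k. convergent (\<lambda>j. x j *\<^sub>V k)}"
  proof (rule complex_vector.subspaceI; clarsimp simp: apply_simps convergent_const)
    show "convergent (\<lambda>j. x j *\<^sub>V k + x j *\<^sub>V l)"
      if "convergent (\<lambda>j. x j *\<^sub>V k)" "convergent (\<lambda>j. x j *\<^sub>V l)" for k l
      using that by (rule convergent_add)
    show "convergent (\<lambda>j. c *\<^sub>C (x j *\<^sub>V k))" if "convergent (\<lambda>j. x j *\<^sub>V k)" for c k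
      using that bounded_linear.tendsto[OF bounded_linear_scaleC] unfolding convergent_def by blast
  qed
  from complex_vector.span_minimal[OF _ this, of B] Cauchy_B Cauchy_convergent B(2)
  have "convergent (\<lambda>j. x j *\<^sub>V k)" for k by blast
  then obtain f where f: "\<And>k. (\<lambda>j. x j *\<^sub>V k) \<longlonglongrightarrow> f k" unfolding convergent_def by metis
  have "bounded_clinear f"
  proof (rule bounded_clinearI[where B = 1])
    show "f (k + l) = f k + f l" for k l
      using tendsto_add[OF f[of k] f[of l]] f[of "k + l"] LIMSEQ_unique by (fastforce simp: apply_simps)
    show "f (c *\<^sub>C k) = c *\<^sub>C f k" for c k
      using bounded_linear.tendsto[OF bounded_linear_scaleC f[of k], of c] f[of "c *\<^sub>C k"] LIMSEQ_unique
      by (fastforce simp: apply_simps)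
    show "norm (f k) \<le> norm k * 1" for k
    proof (rule LIMSEQ_le_const2[OF tendsto_norm[OF f[of k]]])
      show "\<exists>N. \<forall>j\<ge>N. norm (x j *\<^sub>V k) \<le> norm k * 1"
        using norm_apply mult_right_mono[OF bound[OF T(1) x(1)] norm_ge_zero[of k]] order_trans
        by (metis mult.commute mult_1)
    qed
  qed
  then have z: "(\<lambda>j. x j *\<^sub>V k) \<longlonglongrightarrow> cblinfun_of f *\<^sub>V k" for k using f by simp
  have "cblinfun_of f \<in> S" if S: "S \<in> \<C>" for S
  proof -
    \<comment> \<open>Either \<open>S\<close> contains \<open>T j\<close>, and \<open>x j\<close>
      itself serves, or \<open>S\<close> lies in \<open>T j\<close>, and a near-minimal point of
      \<open>S\<close> is close to \<open>x j\<close>. Hence the limit is approached from within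
      \<open>S\<close>.\<close>
    have "\<exists>w\<in>S. n (w - x j) \<le> 8 * \<epsilon> j" for j
    proof (cases "T j \<subseteq> S")
      case True
      have "n (x j - x j) \<le> 8 * \<epsilon> j" using \<epsilon>[of j] by (simp add: n_def apply_left_simps)
      then show ?thesis using True x(1) by blast
    next
      case False
      then have sub: "S \<subseteq> T j" using chain[OF S T(1)] by blast
      obtain w where w: "w \<in> S" "n w < a + \<epsilon> j" using low[OF S \<epsilon>] by blast
      have "n (w - x j) \<le> 8 * \<epsilon> j"
        using close[OF T(1) T(2) _ x(1) w(2) x(2)] w(1) sub by blast
      then show ?thesis using w(1) by blast
    qed
    then obtain w where w: "\<And>j. w j \<in> S" "\<And>j. n (w j - x j) \<le> 8 * \<epsilon> j" by metis
    have "(\<lambda>j. w j *\<^sub>V k) \<longlonglongrightarrow> cblinfun_of f *\<^sub>V k" for k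
      using tendsto_add[OF null[of "\<lambda>j. w j - x j" k, OF w(2)] z[of k]] by (simp add: apply_left_simps)
    then show ?thesis by (rule closed[of S w, OF S w(1)])
  qed
  then show ?thesis by blast
qed


section \<open>Common fixed points of groups with a bounded orbit\<close>

text \<open>Both sides scale alike in \<open>k\<close> and in \<open>v\<close>, so a violation can
  be moved to unit vectors, where compactness is available.\<close>

lemma not_hyp_nearE:
  assumes "\<not> hyp_near s x y"
  obtains k v where "norm k = 1" "norm v = 1"
    "Re (hform x x k k) * Re (hform y y v v) < s * (cmod (hform x y k v))\<^sup>2"
proof -
  obtain k0 v0 where kv: "Re (hform x x k0 k0) * Re (hform y y v0 v0) < s * (cmod (hform x y k0 v0))\<^sup>2"
    using assms unfolding hyp_near_def by (auto simp: not_le)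
  have k0: "k0 \<noteq> 0" and v0: "v0 \<noteq> 0" using kv by (auto simp: hform_def apply_simps)
  define k v where "k = (1 / norm k0) *\<^sub>R k0" and "v = (1 / norm v0) *\<^sub>R v0"
  have "norm k = 1" "norm v = 1" using k0 v0 by (auto simp: k_def v_def)
  moreover have "Re (hform x x k k) * Re (hform y y v v) < s * (cmod (hform x y k v))\<^sup>2"
  proof -
    define c where "c = (1 / norm k0)\<^sup>2 * (1 / norm v0)\<^sup>2"
    have c: "c > 0" using k0 v0 by (simp add: c_def)
    have scale: "Re (hform w w (a *\<^sub>R u) (a *\<^sub>R u)) = a\<^sup>2 * Re (hform w w u u)" for w a u
      by (simp add: Re_hform_self apply_simps power_mult_distrib right_diff_distrib)
    have "Re (hform x x k k) * Re (hform y y v v) = c * (Re (hform x x k0 k0) * Re (hform y y v0 v0))"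
      unfolding k_def v_def c_def scale by (simp only: mult_ac)
    moreover have "s * (cmod (hform x y k v))\<^sup>2 = c * (s * (cmod (hform x y k0 v0))\<^sup>2)"
      by (simp add: k_def v_def c_def hform_scaleR_left hform_scaleR_right norm_divide norm_mult power_divide power_mult_distrib)
    ultimately show ?thesis using mult_strict_left_mono[OF kv c] by (simp only:)
  qed
  ultimately show thesis by (rule that)
qed

text \<open>A finite subset has a subspace of vectors on which its members agree. One of minimal
  dimension cannot shrink when another operator is added; so a finite set, which can be averaged,
  already detects every disagreement within \<open>M\<close>.\<close>

lemma finite_subset_determines_agreement:
  fixes M :: "('k::complex_hilbert, 'h::complex_hilbert) cblinfun set"
  assumes fin: "finite_cdim (UNIV :: 'k set)" and ne: "M \<noteq> {}"
  obtains F where "finite F" "F \<noteq> {}" "F \<subseteq> M"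
    "\<And>k x y w. (\<And>x. x \<in> F \<Longrightarrow> x *\<^sub>V k = w) \<Longrightarrow> y \<in> M \<Longrightarrow> y *\<^sub>V k = w"
proof -
  obtain B :: "'k set" where "finite_dimensional_vector_space scaleC B" using finite_cdim_basis[OF fin] .
  then interpret fd: finite_dimensional_vector_space scaleC B .
  obtain x0 where x0: "x0 \<in> M" using ne by blast
  define N where "N = (\<lambda>F :: ('k, 'h) cblinfun set. {k. \<forall>x\<in>F. x *\<^sub>V k = x0 *\<^sub>V k})"
  have sub: "complex_vector.subspace (N F)" for F
    by (rule complex_vector.subspaceI) (auto simp: N_def apply_simps)
  define P where "P = (\<lambda>F. finite F \<and> F \<subseteq> M \<and> x0 \<in> F)"
  have "P {x0}" using x0 by (simp add: P_def)
  then obtain F where F: "P F" "\<And>F'. P F' \<Longrightarrow> complex_vector.dim (N F) \<le> complex_vector.dim (N F')"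
    using ex_has_least_nat[of P "{x0}" "\<lambda>F. complex_vector.dim (N F)"] by blast
  have N: "N F \<subseteq> {k. y *\<^sub>V k = x0 *\<^sub>V k}" if "y \<in> M" for y
  proof -
    have "P (insert y F)" using F(1) that by (auto simp: P_def)
    then have "complex_vector.dim (N F) \<le> complex_vector.dim (N (insert y F))" by (rule F(2))
    moreover have "N (insert y F) \<subseteq> N F" by (auto simp: N_def)
    ultimately have "N (insert y F) = N F" by (intro fd.subspace_dim_equal sub)
    then show ?thesis by (auto simp: N_def)
  qed
  show thesis
  proof (rule that[of F])
    show "finite F" "F \<subseteq> M" "F \<noteq> {}" using F(1) by (auto simp: P_def)
    fix k w y assume w: "\<And>x. x \<in> F \<Longrightarrow> x *\<^sub>V k = w" and y: "y \<in> M"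
    have x0w: "x0 *\<^sub>V k = w" using w F(1) by (auto simp: P_def)
    then have "k \<in> N F" using w by (simp add: N_def)
    then show "y *\<^sub>V k = w" using N[OF y] x0w by auto
  qed
qed

text \<open>Averaging finitely many points of \<open>M\<close> whose common agreement space \<open>L\<close> is that of all of
  \<open>M\<close> gives a non-diametral point \<open>z\<close>: by strict convexity, unit vectors almost realising the
  diameter between \<open>z\<close> and points \<open>y\<^sub>n\<close> of \<open>M\<close> accumulate at a vector of \<open>L\<close>; but there \<open>z\<close> and
  \<open>y\<^sub>n\<close> coincide.\<close>

lemma nondiametral_point:
  fixes M :: "('k::complex_hilbert, 'h::complex_hilbert) cblinfun set"
  assumes fin: "finite_cdim (UNIV :: 'k set)" and ne: "M \<noteq> {}"
    and r: "r < 1" "\<And>x. x \<in> M \<Longrightarrow> norm x \<le> r"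
    and avg: "\<And>F. finite F \<Longrightarrow> F \<noteq> {} \<Longrightarrow> F \<subseteq> M \<Longrightarrow> average F (\<lambda>x. x) \<in> M"
    and s: "0 \<le> s" "s < 1" and near: "\<And>x y. x \<in> M \<Longrightarrow> y \<in> M \<Longrightarrow> hyp_near s x y"
  shows "\<exists>z\<in>M. \<exists>s'>s. \<forall>y\<in>M. hyp_near s' z y"
proof -
  obtain F where F: "finite F" "F \<noteq> {}" "F \<subseteq> M"
    "\<And>k x y w. (\<And>x. x \<in> F \<Longrightarrow> x *\<^sub>V k = w) \<Longrightarrow> y \<in> M \<Longrightarrow> y *\<^sub>V k = w"
    using finite_subset_determines_agreement[OF fin ne] by metis
  define z where "z = average F (\<lambda>x. x)"
  have zM: "z \<in> M" unfolding z_def by (rule avg[OF F(1-3)])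
  have r0: "0 \<le> r" using r(2)[OF zM] norm_ge_zero order_trans by blast
  define V where "V = (\<lambda>k. average F (\<lambda>x. (norm (x *\<^sub>V k - z *\<^sub>V k))\<^sup>2))"
  have V0: "0 \<le> V k" for k by (simp add: V_def average_real sum_nonneg)
  have norm1: "norm x \<le> 1" if "x \<in> M" for x using r(2)[OF that] r(1) by simp
  define \<tau> where "\<tau> = 1 - r\<^sup>2"
  have \<tau>: "\<tau> > 0" using r(1) r0 by (simp add: \<tau>_def power_less_one_iff)
  have low: "\<tau> \<le> Re (hform x x k k)" if "x \<in> M" "norm k = 1" for x k
  proof -
    have "\<tau> \<le> (1 - (norm x)\<^sup>2) * (norm k)\<^sup>2"
      using power_mono[OF r(2)[OF that(1)], of 2] that(2) by (simp add: \<tau>_def)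
    then show ?thesis using Re_hform_lower[of x k] by linarith
  qed
  have up: "Re (hform x x k k) \<le> 1" if "norm k = 1" for x k
    using that by (simp add: Re_hform_self)
  show ?thesis
  proof (rule ccontr)
    assume neg: "\<not> ?thesis"
    define \<epsilon> where "\<epsilon> = (\<lambda>n. inverse (real (Suc n)))"
    have \<epsilon>: "0 < \<epsilon> n" for n by (simp add: \<epsilon>_def)
    have "\<exists>y k v. y \<in> M \<and> norm k = 1 \<and> norm v = 1 \<and>
        Re (hform z z k k) * Re (hform y y v v) < (s + \<epsilon> n) * (cmod (hform z y k v))\<^sup>2" for n
    proof -
      obtain y where y: "y \<in> M" "\<not> hyp_near (s + \<epsilon> n) z y" using neg zM \<epsilon>[of n] by (metis less_add_same_cancel1)
      then show ?thesis using not_hyp_nearE[OF y(2)] by metis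
    qed
    then obtain y k v where y: "\<And>n. y n \<in> M" and k: "\<And>n. norm (k n) = 1" and v: "\<And>n. norm (v n) = 1"
      and far: "\<And>n. Re (hform z z (k n) (k n)) * Re (hform (y n) (y n) (v n) (v n))
          < (s + \<epsilon> n) * (cmod (hform z (y n) (k n) (v n)))\<^sup>2"
      by metis
    define R where "R = (\<lambda>n. Re (hform (y n) (y n) (v n) (v n)))"
    have R: "\<tau> \<le> R n" "R n \<le> 1" for n unfolding R_def by (rule low[OF y v], rule up[OF v])
    have h2: "(cmod (hform z (y n) a (v n)))\<^sup>2 \<le> 4 * (norm a)\<^sup>2" for n a
      using power_mono[OF norm_hform_le[OF norm1[OF zM] norm1[OF y[of n]], of a "v n"], of 2]
      by (simp add: v power_mult_distrib)
    \<comment> \<open>Strict convexity provides a gain \<open>V (k n) * R n\<close>, but the choice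
      of \<open>k n\<close> leaves room only for \<open>\<epsilon> n\<close> times a bounded
      quantity.\<close>
    have Vle: "V (k n) \<le> 4 / \<tau> * \<epsilon> n" for n
    proof -
      have "s * (cmod (hform z (y n) (k n) (v n)))\<^sup>2 \<le> (Re (hform z z (k n) (k n)) - V (k n)) * R n"
        unfolding V_def R_def z_def
        by (rule hyp_near_average_strict[OF F(1,2) near s(1)]) (use F(3) y in auto)
      then have "V (k n) * R n \<le> \<epsilon> n * (cmod (hform z (y n) (k n) (v n)))\<^sup>2"
        using far[of n] by (simp add: R_def algebra_simps)
      also have "\<dots> \<le> \<epsilon> n * 4" using h2[of n "k n"] \<epsilon>[of n] by (intro mult_left_mono) (auto simp: k)
      finally have "V (k n) * \<tau> \<le> 4 * \<epsilon> n" using mult_left_mono[OF R(1)[of n] V0[of "k n"]] by simp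
      then show ?thesis using \<tau> by (simp add: field_simps)
    qed
    have \<epsilon>0: "\<epsilon> \<longlonglongrightarrow> 0" unfolding \<epsilon>_def by (rule LIMSEQ_inverse_real_of_nat)
    \<comment> \<open>Only the vectors \<open>k n\<close> are made to converge. The operators
      \<open>y n\<close> have values in \<open>H\<close> and may have no convergent subsequence, so
      the estimates below are uniform in them.\<close>
    obtain k0 and q :: "nat \<Rightarrow> nat" where q: "strict_mono q" "(k \<circ> q) \<longlonglongrightarrow> k0"
      by (rule finite_cdim_convergent_subseq[OF fin, of k 1]) (auto simp: k)
    then have kq: "(\<lambda>n. k (q n)) \<longlonglongrightarrow> k0" by (simp add: o_def)
    have \<epsilon>q: "(\<lambda>n. \<epsilon> (q n)) \<longlonglongrightarrow> 0" using LIMSEQ_subseq_LIMSEQ[OF \<epsilon>0 q(1)] by (simp add: o_def)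
    have k0: "norm k0 = 1" using tendsto_norm[OF kq] by (simp add: k LIMSEQ_const_iff)
    have ap: "(\<lambda>n. x *\<^sub>V k (q n)) \<longlonglongrightarrow> x *\<^sub>V k0" for x :: "('k, 'h) cblinfun"
      by (rule bounded_linear.tendsto[OF bounded_clinear_imp_bounded_linear[OF bounded_clinear_apply] kq])
    have "(\<lambda>n. V (k (q n))) \<longlonglongrightarrow> V k0" unfolding V_def average_def by (intro tendsto_intros ap)
    moreover have "(\<lambda>n. 4 / \<tau> * \<epsilon> (q n)) \<longlonglongrightarrow> 4 / \<tau> * 0" by (intro tendsto_intros \<epsilon>q)
    ultimately have "V k0 \<le> 4 / \<tau> * 0" by (rule LIMSEQ_le) (use Vle in blast)
    then have "(\<Sum>x\<in>F. (norm (x *\<^sub>V k0 - z *\<^sub>V k0))\<^sup>2) = 0"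
      using V0[of k0] F(1,2) by (simp add: V_def average_real)
    then have "\<And>x. x \<in> F \<Longrightarrow> x *\<^sub>V k0 = z *\<^sub>V k0" using F(1) by (simp add: sum_nonneg_eq_0_iff)
    then have agree: "y n *\<^sub>V k0 = z *\<^sub>V k0" for n using F(4) y by blast
    define g where "g = Re (hform z z k0 k0)"
    have g: "\<tau> \<le> g" unfolding g_def by (rule low[OF zM k0])
    define \<delta> where "\<delta> = (\<lambda>n. norm (k n - k0))"
    define \<eta> where "\<eta> = (\<lambda>n. \<bar>g - Re (hform z z (k n) (k n))\<bar>)"
    have \<delta>0: "(\<lambda>n. \<delta> (q n)) \<longlonglongrightarrow> 0"
      unfolding \<delta>_def using tendsto_norm[OF tendsto_diff[OF kq tendsto_const[of k0]]] by simp
    have "(\<lambda>n. \<eta> (q n)) \<longlonglongrightarrow> \<bar>g - g\<bar>"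
      unfolding \<eta>_def g_def Re_hform_self by (intro tendsto_intros ap kq)
    then have \<eta>0: "(\<lambda>n. \<eta> (q n)) \<longlonglongrightarrow> 0" by simp
    \<comment> \<open>The violated inequality at \<open>k n\<close> is compared with Cauchy-Schwarz
      at \<open>k0\<close>; \<open>\<eta>\<close> and \<open>\<delta>\<close> measure the errors of
      replacing \<open>k n\<close> by \<open>k0\<close>. In the limit a factor
      \<open>1 - s > 0\<close> is left without any error to balance it.\<close>
    have main: "\<tau> * \<tau> * (1 - (s + \<epsilon> n)) \<le> \<eta> n + (s + \<epsilon> n) * (8 * \<delta> n + 4 * (\<delta> n)\<^sup>2)" for n
    proof (cases "s + \<epsilon> n \<le> 1")
      case False
      then have "\<tau> * \<tau> * (1 - (s + \<epsilon> n)) \<le> 0" using \<tau> by (simp add: mult_nonneg_nonpos)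
      moreover have "0 \<le> \<eta> n + (s + \<epsilon> n) * (8 * \<delta> n + 4 * (\<delta> n)\<^sup>2)"
        using s(1) \<epsilon>[of n] by (simp add: \<eta>_def \<delta>_def)
      ultimately show ?thesis by linarith
    next
      case True
      define h0 where "h0 = hform z (y n) k0 (v n)"
      \<comment> \<open>Since \<open>z\<close> and \<open>y n\<close> agree at \<open>k0\<close>,
        the mixed form is that of \<open>y n\<close> alone, and Cauchy-Schwarz acts like nearness
        with parameter 1.\<close>
      have "h0 = hform (y n) (y n) k0 (v n)" by (simp add: h0_def hform_def agree)
      moreover have "Re (hform (y n) (y n) k0 k0) = g" by (simp add: g_def Re_hform_self agree)
      ultimately have h0: "(cmod h0)\<^sup>2 \<le> g * R n"
        using hform_Cauchy_Schwarz[OF norm1[OF y[of n]], of k0 "v n"] by (simp add: R_def)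
      have h0b: "cmod h0 \<le> 2"
        using norm_hform_le[OF norm1[OF zM] norm1[OF y[of n]], of k0 "v n"] by (simp add: h0_def k0 v)
      have "hform z (y n) (k n) (v n) = h0 + hform z (y n) (k n - k0) (v n)"
        by (simp add: h0_def hform_def apply_simps cinner_simps)
      then have "cmod (hform z (y n) (k n) (v n)) \<le> cmod h0 + 2 * \<delta> n"
        using norm_triangle_ineq[of h0 "hform z (y n) (k n - k0) (v n)"]
          norm_hform_le[OF norm1[OF zM] norm1[OF y[of n]], of "k n - k0" "v n"]
        by (simp add: \<delta>_def v)
      then have "(cmod (hform z (y n) (k n) (v n)))\<^sup>2 \<le> (cmod h0 + 2 * \<delta> n)\<^sup>2" by (intro power_mono) auto
      also have "\<dots> = (cmod h0)\<^sup>2 + cmod h0 * (4 * \<delta> n) + 4 * (\<delta> n)\<^sup>2" by (simp add: power2_eq_square algebra_simps)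
      also have "\<dots> \<le> g * R n + 2 * (4 * \<delta> n) + 4 * (\<delta> n)\<^sup>2"
        using h0 h0b by (intro add_mono mult_right_mono) (auto simp: \<delta>_def)
      finally have hb: "(cmod (hform z (y n) (k n) (v n)))\<^sup>2 \<le> g * R n + (8 * \<delta> n + 4 * (\<delta> n)\<^sup>2)" by simp
      have "(g - \<eta> n) * R n \<le> Re (hform z z (k n) (k n)) * R n"
        using R(1)[of n] \<tau> by (intro mult_right_mono) (auto simp: \<eta>_def)
      also have "\<dots> \<le> (s + \<epsilon> n) * (cmod (hform z (y n) (k n) (v n)))\<^sup>2"
        using far[of n] by (simp add: R_def)
      also have "\<dots> \<le> (s + \<epsilon> n) * (g * R n + (8 * \<delta> n + 4 * (\<delta> n)\<^sup>2))"
        using hb s(1) \<epsilon>[of n] by (intro mult_left_mono) auto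
      finally have "g * R n * (1 - (s + \<epsilon> n)) \<le> \<eta> n * R n + (s + \<epsilon> n) * (8 * \<delta> n + 4 * (\<delta> n)\<^sup>2)"
        by (simp add: algebra_simps)
      moreover have "\<eta> n * R n \<le> \<eta> n * 1" using R(2)[of n] by (intro mult_left_mono) (auto simp: \<eta>_def)
      moreover have "\<tau> * \<tau> * (1 - (s + \<epsilon> n)) \<le> g * R n * (1 - (s + \<epsilon> n))"
        using g R(1)[of n] \<tau> True by (intro mult_right_mono mult_mono) auto
      ultimately show ?thesis by simp
    qed
    have "(\<lambda>n. \<tau> * \<tau> * (1 - (s + \<epsilon> (q n)))) \<longlonglongrightarrow> \<tau> * \<tau> * (1 - (s + 0))" by (intro tendsto_intros \<epsilon>q)
    moreover have "(\<lambda>n. \<eta> (q n) + (s + \<epsilon> (q n)) * (8 * \<delta> (q n) + 4 * (\<delta> (q n))\<^sup>2))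
        \<longlonglongrightarrow> 0 + (s + 0) * (8 * 0 + 4 * 0\<^sup>2)" by (intro tendsto_intros \<epsilon>q \<eta>0 \<delta>0)
    ultimately have "\<tau> * \<tau> * (1 - (s + 0)) \<le> 0 + (s + 0) * (8 * 0 + 4 * 0\<^sup>2)"
      by (rule LIMSEQ_le) (use main in blast)
    then have "\<tau> * \<tau> * (1 - s) \<le> 0" by simp
    moreover have "0 < \<tau> * \<tau> * (1 - s)" using \<tau> s(2) by simp
    ultimately show False by linarith
  qed
qed

text \<open>A larger family \<open>I\<close> of balls has a smaller intersection \<open>M I\<close>,
  so a maximal family gives a minimal intersection. Working with families makes the union the upper
  bound of a chain; \<open>chain_Inter_nonempty\<close> supplies a point in its
  intersection.\<close>

theorem hyp_near_common_fixed_point: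
  fixes \<Gamma> :: "(('k::complex_hilbert, 'h::complex_hilbert) cblinfun \<Rightarrow> ('k, 'h) cblinfun) set"
  assumes fin: "finite_cdim (UNIV :: 'k set)"
    and into: "\<And>\<gamma> x. \<gamma> \<in> \<Gamma> \<Longrightarrow> norm x < 1 \<Longrightarrow> norm (\<gamma> x) < 1"
    and pres: "\<And>\<gamma> s x y. \<gamma> \<in> \<Gamma> \<Longrightarrow> norm x < 1 \<Longrightarrow> norm y < 1 \<Longrightarrow> 0 \<le> s \<Longrightarrow> hyp_near s x y
      \<Longrightarrow> hyp_near s (\<gamma> x) (\<gamma> y)"
    and right_inverse: "\<And>\<gamma>. \<gamma> \<in> \<Gamma> \<Longrightarrow> \<exists>\<gamma>'\<in>\<Gamma>. \<forall>x. norm x < 1 \<longrightarrow> \<gamma> (\<gamma>' x) = x"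
    and orbit: "A \<noteq> {}" "\<And>x. x \<in> A \<Longrightarrow> norm x < 1" "\<And>\<gamma> x. \<gamma> \<in> \<Gamma> \<Longrightarrow> x \<in> A \<Longrightarrow> \<gamma> x \<in> A"
    and bounded: "0 < s0" "\<And>x. x \<in> A \<Longrightarrow> hyp_near s0 x b"
  shows "\<exists>z. norm z < 1 \<and> (\<forall>\<gamma>\<in>\<Gamma>. \<gamma> z = z)"
proof -
  define M where "M = (\<lambda>I :: (('k, 'h) cblinfun \<times> real) set. {x. \<forall>(y, s)\<in>I. hyp_near s y x})"
  define \<I> where "\<I> = {I. I \<noteq> {} \<and> (\<forall>(y, s)\<in>I. norm y < 1 \<and> 0 < s)
    \<and> (\<forall>\<gamma>\<in>\<Gamma>. \<forall>(y, s)\<in>I. (\<gamma> y, s) \<in> I) \<and> M I \<noteq> {}}"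
  have \<I>_bounds: "norm y < 1" "0 < s" if "I \<in> \<I>" "(y, s) \<in> I" for I y s
    using that by (auto simp: \<I>_def)
  have \<I>_nonempty: "\<exists>y s. (y, s) \<in> I" if "I \<in> \<I>" for I
    using that by (force simp: \<I>_def)
  have Mball: "norm x < 1" if I: "I \<in> \<I>" and x: "x \<in> M I" for I x
  proof -
    obtain y s where ys: "(y, s) \<in> I" "norm y < 1" "0 < s" using \<I>_nonempty[OF I] \<I>_bounds[OF I] by blast
    obtain r where "r < 1" "\<And>x. hyp_near s y x \<Longrightarrow> norm x \<le> r" using hyp_near_norm_bound[OF ys(2,3)] by blast
    then show ?thesis using x ys(1) by (fastforce simp: M_def)
  qed
  \<comment> \<open>Nearness of \<open>\<gamma> x\<close> to a centre \<open>y\<close> is the image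
    of nearness of \<open>x\<close> to the centre \<open>\<gamma>' y\<close>, which belongs to the
    family as well.\<close>
  have Minv: "\<gamma> x \<in> M I" if \<gamma>: "\<gamma> \<in> \<Gamma>" and I: "I \<in> \<I>" and x: "x \<in> M I" for \<gamma> I x
    unfolding M_def
  proof clarify
    fix y s assume ys: "(y, s) \<in> I"
    then have y: "norm y < 1" and s: "0 < s" using \<I>_bounds[OF I] by blast+
    obtain \<gamma>' where \<gamma>': "\<gamma>' \<in> \<Gamma>" "\<gamma> (\<gamma>' y) = y" using right_inverse[OF \<gamma>] y by blast
    have "(\<gamma>' y, s) \<in> I" using I \<gamma>'(1) ys by (auto simp: \<I>_def)
    then have "hyp_near s (\<gamma>' y) x" using x by (auto simp: M_def)
    then have "hyp_near s (\<gamma> (\<gamma>' y)) (\<gamma> x)"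
      using pres[OF \<gamma> into[OF \<gamma>'(1) y] Mball[OF I x]] s by simp
    then show "hyp_near s y (\<gamma> x)" by (simp add: \<gamma>'(2))
  qed
  have Mavg: "average F (\<lambda>x. x) \<in> M I" if "I \<in> \<I>" "finite F" "F \<noteq> {}" "F \<subseteq> M I" for I F
    unfolding M_def
  proof clarify
    fix y s assume ys: "(y, s) \<in> I"
    show "hyp_near s y (average F (\<lambda>x. x))"
      using that ys by (intro hyp_near_average) (auto simp: \<I>_def M_def less_imp_le)
  qed
  have "\<exists>I\<in>\<I>. \<forall>J\<in>\<I>. I \<subseteq> J \<longrightarrow> J = I"
  proof (rule subset_Zorn_nonempty)
    \<comment> \<open>The initial family consists of the balls about all points of \<open>A\<close>;
      symmetry puts \<open>b\<close> into each of them.\<close>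
    have "b \<in> M (A \<times> {s0})" using bounded(2) by (auto simp: M_def)
    then have "A \<times> {s0} \<in> \<I>" using orbit bounded(1) by (auto simp: \<I>_def)
    then show "\<I> \<noteq> {}" by blast
  next
    fix \<J> assume ne: "\<J> \<noteq> {}" and ch: "subset.chain \<I> \<J>"
    have sub: "I \<in> \<I>" if "I \<in> \<J>" for I using ch that by (auto simp: subset_chain_def)
    have "\<exists>z. \<forall>S\<in>M ` \<J>. z \<in> S"
    proof (rule chain_Inter_nonempty[OF fin])
      show "M ` \<J> \<noteq> {}" using ne by simp
      show "S \<subseteq> T \<or> T \<subseteq> S" if "S \<in> M ` \<J>" "T \<in> M ` \<J>" for S T
      proof -
        from that obtain I J where IJ: "I \<in> \<J>" "J \<in> \<J>" "S = M I" "T = M J" by blast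
        then have "I \<subseteq> J \<or> J \<subseteq> I" using ch by (auto simp: subset_chain_def)
        then show ?thesis unfolding IJ M_def by blast
      qed
      show "S \<noteq> {}" if "S \<in> M ` \<J>" for S using that sub by (auto simp: \<I>_def)
      show "norm x \<le> 1" if "S \<in> M ` \<J>" "x \<in> S" for S x using that sub Mball less_imp_le by blast
      show "(1/2) *\<^sub>R (x + y) \<in> S" if "S \<in> M ` \<J>" "x \<in> S" "y \<in> S" for S x y
      proof -
        from that(1) obtain I where I: "I \<in> \<J>" "S = M I" by blast
        show ?thesis unfolding I(2) M_def
        proof clarify
          fix w s assume "(w, s) \<in> I"
          then show "hyp_near s w ((1/2) *\<^sub>R (x + y))"
            using that(2,3) sub[OF I(1)] by (intro hyp_near_midpoint) (auto simp: I(2) M_def \<I>_def less_imp_le)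
        qed
      qed
      show "z \<in> S" if "S \<in> M ` \<J>" "\<And>n. u n \<in> S" "\<And>k. (\<lambda>n. u n *\<^sub>V k) \<longlonglongrightarrow> z *\<^sub>V k" for S u z
      proof -
        from that(1) obtain I where I: "I \<in> \<J>" "S = M I" by blast
        show ?thesis unfolding I(2) M_def
        proof clarify
          fix w s assume "(w, s) \<in> I"
          then have "hyp_near s w (u n)" for n using that(2)[of n] by (auto simp: I(2) M_def)
          then show "hyp_near s w z" by (rule hyp_near_closed) (rule that(3))
        qed
      qed
    qed
    then obtain z where z: "z \<in> M I" if "I \<in> \<J>" for I by blast
    have "z \<in> M (\<Union>\<J>)" using z unfolding M_def by blast
    moreover have "\<Union>\<J> \<noteq> {}" using ne sub \<I>_nonempty by blast
    moreover have "norm y < 1 \<and> 0 < s" if "(y, s) \<in> \<Union>\<J>" for y s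
      using that \<I>_bounds[OF sub] by blast
    moreover have "(\<gamma> y, s) \<in> \<Union>\<J>" if "\<gamma> \<in> \<Gamma>" "(y, s) \<in> \<Union>\<J>" for \<gamma> y s
      using that sub unfolding \<I>_def by blast
    ultimately show "\<Union>\<J> \<in> \<I>" unfolding \<I>_def by blast
  qed
  then obtain I where I: "I \<in> \<I>" and maxI: "\<And>J. J \<in> \<I> \<Longrightarrow> I \<subseteq> J \<Longrightarrow> J = I" by blast
  \<comment> \<open>Adding to \<open>I\<close> the balls of parameter \<open>c\<close> about all
    points of \<open>M I\<close> keeps it invariant, and \<open>z\<close> keeps the intersection
    nonempty. By maximality these balls were already in \<open>I\<close>, so nearness of one point
    to all becomes nearness of all pairs.\<close>
  have spread: "hyp_near c y x"
    if c: "0 < c" and z: "z \<in> M I" "\<And>y. y \<in> M I \<Longrightarrow> hyp_near c y z" and xy: "x \<in> M I" "y \<in> M I" for c x y z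
  proof -
    define J where "J = I \<union> M I \<times> {c}"
    have "z \<in> M J" using z by (auto simp: J_def M_def)
    then have "J \<in> \<I>" using I c Mball[OF I] Minv[OF _ I] by (auto simp: \<I>_def J_def)
    then have "J = I" using maxI by (auto simp: J_def)
    then have "(y, c) \<in> I" using xy(2) by (auto simp: J_def)
    then show ?thesis using xy(1) by (auto simp: M_def)
  qed
  obtain z0 where z0: "z0 \<in> M I" using I by (auto simp: \<I>_def)
  obtain y s where ys: "(y, s) \<in> I" "norm y < 1" "0 < s" using \<I>_nonempty[OF I] \<I>_bounds[OF I] by blast
  obtain r where r: "r < 1" "\<And>x. hyp_near s y x \<Longrightarrow> norm x \<le> r" using hyp_near_norm_bound[OF ys(2,3)] by blast
  have Mr: "norm x \<le> r" if "x \<in> M I" for x using r(2) that ys(1) by (auto simp: M_def)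
  have r0: "0 \<le> r" using Mr[OF z0] norm_ge_zero order_trans by blast
  \<comment> \<open>Parameters measure the diameter of \<open>M I\<close>, larger ones meaning
    smaller diameter. The cap at 1 bounds the set, and the value 1 means a single point.\<close>
  define \<Sigma> where "\<Sigma> = {s. 0 < s \<and> s \<le> 1 \<and> (\<forall>x\<in>M I. \<forall>y\<in>M I. hyp_near s x y)}"
  define c0 where "c0 = ((1 - r\<^sup>2) / 2)\<^sup>2"
  have r2: "0 < 1 - r\<^sup>2" "1 - r\<^sup>2 \<le> 1" using r(1) r0 by (auto simp: power_less_one_iff)
  have c0: "c0 \<in> \<Sigma>"
  proof -
    have "(1 - r\<^sup>2) / 2 \<le> 1" "0 \<le> (1 - r\<^sup>2) / 2" using r2 by (simp_all only: pos_divide_le_eq pos_le_divide_eq zero_less_numeral)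
    then have "c0 \<le> 1\<^sup>2" unfolding c0_def by (rule power_mono)
    moreover have "0 < c0" using r2 by (simp add: c0_def)
    ultimately show ?thesis using hyp_near_uniform[OF r(1)] Mr by (auto simp: \<Sigma>_def c0_def)
  qed
  define \<sigma> where "\<sigma> = Sup \<Sigma>"
  have bdd: "bdd_above \<Sigma>" by (rule bdd_aboveI[of _ 1]) (auto simp: \<Sigma>_def)
  have "c0 \<le> \<sigma>" unfolding \<sigma>_def by (rule cSup_upper[OF c0 bdd])
  then have \<sigma>0: "0 < \<sigma>" using c0 by (auto simp: \<Sigma>_def)
  have \<sigma>1: "\<sigma> \<le> 1" unfolding \<sigma>_def by (rule cSup_least) (use c0 in \<open>auto simp: \<Sigma>_def\<close>)
  \<comment> \<open>The condition is a non-strict inequality linear in the parameter, so the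
    supremum is attained.\<close>
  have near: "hyp_near \<sigma> x y" if "x \<in> M I" "y \<in> M I" for x y
    unfolding hyp_near_def
  proof (intro allI)
    fix k v
    show "\<sigma> * (cmod (hform x y k v))\<^sup>2 \<le> Re (hform x x k k) * Re (hform y y v v)" (is "_ * ?h \<le> ?c")
    proof (cases "hform x y k v = 0")
      case True
      then show ?thesis
        using that Mball[OF I] by (simp add: Re_hform_nonneg less_imp_le)
    next
      case False
      have "s \<le> ?c / ?h" if "s \<in> \<Sigma>" for s
        using that \<open>x \<in> M I\<close> \<open>y \<in> M I\<close> False by (simp add: \<Sigma>_def hyp_near_def pos_le_divide_eq)
      then have "\<sigma> \<le> ?c / ?h" unfolding \<sigma>_def using c0 by (intro cSup_least) auto
      then show ?thesis using False by (simp add: pos_le_divide_eq)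
    qed
  qed
  have "\<sigma> = 1"
  proof (rule ccontr)
    assume "\<sigma> \<noteq> 1"
    with \<sigma>1 have "\<sigma> < 1" by simp
    have "\<exists>z\<in>M I. \<exists>s'>\<sigma>. \<forall>y\<in>M I. hyp_near s' z y"
      by (rule nondiametral_point[OF fin _ r(1) Mr Mavg[OF I] _ \<open>\<sigma> < 1\<close> near]) (use z0 \<sigma>0 in auto)
    then obtain z s' where z: "z \<in> M I" "s' > \<sigma>" "\<And>y. y \<in> M I \<Longrightarrow> hyp_near s' z y"
      by blast
    define c where "c = min s' 1"
    have c: "\<sigma> < c" "0 < c" "c \<le> 1" using z(2) \<open>\<sigma> < 1\<close> \<sigma>0 by (auto simp: c_def)
    have "hyp_near c y z" if "y \<in> M I" for y
      using hyp_near_mono[OF hyp_near_sym[OF z(3)[OF that]], of c] by (simp add: c_def)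
    then have "c \<in> \<Sigma>" using spread[OF c(2) z(1)] c by (auto simp: \<Sigma>_def)
    then have "c \<le> \<sigma>" unfolding \<sigma>_def by (rule cSup_upper[OF _ bdd])
    then show False using c(1) by simp
  qed
  then have "x = y" if "x \<in> M I" "y \<in> M I" for x y
    using hyp_near_one_imp_eq near[OF that] Mball[OF I] that less_imp_le by blast
  then have "\<gamma> z0 = z0" if "\<gamma> \<in> \<Gamma>" for \<gamma> using Minv[OF that I z0] z0 by blast
  then show ?thesis using Mball[OF I z0] by blast
qed

theorem corollary4p10:
  fixes G :: "(('h::complex_hilbert, 'k::complex_hilbert) closed_op \<Rightarrow> ('h, 'k) closed_op) set"
  assumes "finite_cdim (UNIV :: 'k set)"
    and "subgroup G (BijGroup UNIV)"
    and "\<And>g. g \<in> G \<Longrightarrow> h_biholomorphic g"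
    and "\<exists>X. hyp_bounded {g X | g. g \<in> G}"
  shows "\<exists>X. \<forall>g\<in>G. g X = X"
proof -
  note fin = assms(1)
  \<comment> \<open>The conjugate of \<open>g\<close> under \<open>hat\<close>, a bijection onto the
    open ball; off the ball its values are arbitrary, whence the conditions
    \<open>norm x < 1\<close>.\<close>
  define lift where "lift = (\<lambda>(g :: ('h, 'k) closed_op \<Rightarrow> ('h, 'k) closed_op) A. hat (g (inv_into UNIV hat A)))"
  have hat_inv: "hat (inv_into UNIV hat A :: ('h, 'k) closed_op) = A" if "norm A < 1" for A
    using hat_surj[OF fin that] by (metis f_inv_into_f rangeI)
  have lift_hat: "lift g (hat X) = hat (g X)" for g X
    using hat_inj[OF fin, of "inv_into UNIV hat (hat X)" X] hat_inv[OF norm_hat[OF fin, of X]]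
    by (simp add: lift_def)
  \<comment> \<open>On \<open>UNIV\<close> the restricted composition and inverse of
    \<open>BijGroup\<close> are the ordinary ones.\<close>
  have comp: "g \<circ> h \<in> G" if "g \<in> G" "h \<in> G" for g h
  proof -
    have "g \<in> Bij UNIV" "h \<in> Bij UNIV"
      using subgroup.subset[OF assms(2)] that by (auto simp: BijGroup_def)
    then show ?thesis
      using subgroup.m_closed[OF assms(2) that] by (simp add: BijGroup_def compose_def o_def restrict_UNIV)
  qed
  have inverse: "\<exists>h\<in>G. \<forall>X. g (h X) = X" if g: "g \<in> G" for g
  proof -
    have gB: "g \<in> Bij UNIV" using subgroup.subset[OF assms(2)] g by (auto simp: BijGroup_def)
    have "inv\<^bsub>BijGroup UNIV\<^esub> g \<in> G" by (rule subgroup.m_inv_closed[OF assms(2) g])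
    then have "(\<lambda>x\<in>UNIV. (inv_into UNIV g) x) \<in> G" by (simp add: inv_BijGroup[OF gB])
    then have "inv_into UNIV g \<in> G" by (simp add: restrict_UNIV)
    moreover have "g (inv_into UNIV g X) = X" for X
      using gB by (simp add: Bij_def bij_betw_def surj_f_inv_f)
    ultimately show ?thesis by blast
  qed
  obtain X0 Y0 r where bd: "\<And>g. g \<in> G \<Longrightarrow> hyp_dist Y0 (g X0) \<le> r"
    using assms(4) unfolding hyp_bounded_def by blast
  have "\<exists>z. norm z < 1 \<and> (\<forall>\<gamma>\<in>lift ` G. \<gamma> z = z)"
  proof (rule hyp_near_common_fixed_point[OF fin])
    fix \<gamma> assume "\<gamma> \<in> lift ` G"
    then obtain g where g: "g \<in> G" "\<gamma> = lift g" by blast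
    obtain \<psi> where \<psi>: "biholomorphic_on \<psi> (ball 0 1) (ball 0 1)" "\<And>X. \<psi> (hat X) = hat (g X)"
      using assms(3)[OF g(1)] unfolding h_biholomorphic_def by blast
    have \<gamma>\<psi>: "\<gamma> x = \<psi> x" if "norm x < 1" for x
      using \<psi>(2)[of "inv_into UNIV hat x"] hat_inv[OF that] by (simp add: g(2) lift_def)
    have \<psi>b: "norm (\<psi> x) < 1" if "norm x < 1" for x
      using \<psi>(1) that by (auto simp: biholomorphic_on_def bij_betw_def)
    show "norm (\<gamma> x) < 1" if "norm x < 1" for x using \<psi>b \<gamma>\<psi> that by simp
    show "hyp_near s (\<gamma> x) (\<gamma> y)" if "norm x < 1" "norm y < 1" "0 \<le> s" "hyp_near s x y" for s x y
    proof -
      have "cholomorphic_on \<psi> (ball 0 1)" using \<psi>(1) by (simp add: biholomorphic_on_def)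
      then show ?thesis
        unfolding \<gamma>\<psi>[OF that(1)] \<gamma>\<psi>[OF that(2)] using \<psi>b that by (rule hyp_near_holomorphic[OF fin])
    qed
    obtain h where h: "h \<in> G" "\<And>X. g (h X) = X" using inverse[OF g(1)] by blast
    have "\<gamma> (lift h x) = x" if "norm x < 1" for x
    proof -
      have "lift h x = hat (h (inv_into UNIV hat x))" by (simp add: lift_def)
      then show ?thesis by (simp add: g(2) lift_hat h(2) hat_inv[OF that])
    qed
    then show "\<exists>\<gamma>'\<in>lift ` G. \<forall>x. norm x < 1 \<longrightarrow> \<gamma> (\<gamma>' x) = x" using h(1) by blast
    show "\<gamma> x \<in> {hat (g X0) | g. g \<in> G}" if "x \<in> {hat (g X0) | g. g \<in> G}" for x
    proof -
      from that obtain h where "h \<in> G" "x = hat (h X0)" by blast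
      then have "\<gamma> x = hat ((g \<circ> h) X0)" "g \<circ> h \<in> G" using comp g(1) by (auto simp: g(2) lift_hat)
      then show ?thesis by blast
    qed
  next
    show "{hat (g X0) | g. g \<in> G} \<noteq> {}" using subgroup.one_closed[OF assms(2)] by blast
    show "norm x < 1" if "x \<in> {hat (g X0) | g. g \<in> G}" for x using that norm_hat[OF fin] by blast
    show "0 < 1 - (tanh r)\<^sup>2" using tanh_real_bounds[of r] by (simp add: abs_square_less_1 abs_less_iff)
    show "hyp_near (1 - (tanh r)\<^sup>2) x (hat Y0)" if "x \<in> {hat (g X0) | g. g \<in> G}" for x
      using that hyp_dist_le_imp_near[OF fin bd] by blast
  qed
  then obtain z where z: "norm z < 1" "\<And>g. g \<in> G \<Longrightarrow> lift g z = z" by blast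
  obtain X :: "('h, 'k) closed_op" where X: "hat X = z" using hat_surj[OF fin z(1)] .
  have "g X = X" if "g \<in> G" for g
    using z(2)[OF that] hat_inj[OF fin, of "g X" X] by (simp add: X[symmetric] lift_hat)
  then show ?thesis by blast
qed

end
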